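(* Let $K$ and $L$ be simplicial complexes such that $K\cap L=\langle\sigma\rangle$ is a complete simplicial complex (a set $\sigma$ together with all of its subsets), with vertices labelled so that $(K\cup L)_{0}=[n]$, and let $T=\{ t_{1}<\dots<t_{j}<t_{j+1}\}\subseteq[n]$ (with $j\ge1$). Then $$T\in\Delta(K\cup L)\iff t_{j+1}-t_{j}\leq D_{K}(T)+D_{L}(T)-D_{\langle\sigma\rangle}(T).$$ In particular, any gluing of $K$ and $L$ along a $d$-simplex results in the same shifted complex $\Delta(K\cup L)$, depending only on $\Delta(K)$, $\Delta(L)$ and $d$.
   Context: Simplicial complexes are finite and contain the empty set. For a complex $K$, $K_0$ denotes its vertex set. $[n]=\{1,\dots,n\}$. Lexicographic order: for sets $S\ne T$ of positive integers of equal size, $S<_L T$ iff $\min(S\triangle T)\in S$. Algebraic shifting (exterior): let $K$ be a simplicial complex with vertex set contained in $[n]$ (label the vertices by positive integers if necessary). Let $V$ be a real vector space with basis $e_1,\dots,e_n$, and let $f_i=\sum_{j=1}^n\alpha_{ij}e_j$, $1\le i\le n$, where the $n^2$ real numbers $\alpha_{ij}$ are algebraically independent over $\mathbb{Q}$. For $S=\{s_1<\dots<s_k\}\subseteq[n]$ put $e_S=e_{s_1}\wedge\dots\wedge e_{s_k}$, $f_S=f_{s_1}\wedge\dots\wedge f_{s_k}$ in $\bigwedge V$, and let $\tilde f_S$ be the image of $f_S$ in $(\bigwedge V)/(e_T: T\subseteq[n],\,T\notin K)$. Then $$\Delta(K)=\{S\subseteq[n]:\ \tilde f_S\notin \mathrm{span}\{\tilde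 f_{S'}: |S'|=|S|,\ S'<_L S\}\}.$$ $\Delta(K)$ does not depend on the choice of the generic matrix, of $n$, or of the vertex labelling; it is a simplicial complex with vertex set $\{1,\dots,|K_0|\}$. For a finite set $T$ of positive integers, $\mathrm{init}_j(T)$ is the set of the $j$ smallest elements of $T$. For $S\subseteq[n]$, $I_S^1=\{T\subseteq[n]: |T|=|S|+1,\ \mathrm{init}_{|S|}(T)=S\}$. For a complex $H$ with $H_0\subseteq[n]$ and nonempty $T\subseteq[n]$, $D_H(T)=|I^1_{\mathrm{init}_{|T|-1}(T)}\cap\Delta(H)|$. *)

theory Defs
  imports "HOL-Analysis.Analysis" "HOL-Analysis.Finite_Function_Topology"
begin

section \<open>Simplicial complexes\<close>

definition abstract_complex :: "'a set set \<Rightarrow> bool" where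
  "abstract_complex K \<longleftrightarrow>
     finite K \<and> (\<forall>F\<in>K. finite F) \<and> {} \<in> K \<and> (\<forall>F\<in>K. \<forall>G. G \<subseteq> F \<longrightarrow> G \<in> K)"

definition vertices :: "'a set set \<Rightarrow> 'a set" where
  "vertices K = {v. {v} \<in> K}"

definition relabel :: "('a \<Rightarrow> 'b) \<Rightarrow> 'a set set \<Rightarrow> 'b set set" where
  "relabel \<phi> K = (\<lambda>F. \<phi> ` F) ` K"

text \<open>\<open>M\<close> is a gluing of \<open>K\<close> and \<open>L\<close> along a \<open>d\<close>-simplex: a union of isomorphic copies of \<open>K\<close> and
  \<open>L\<close> whose intersection is a \<open>d\<close>-simplex \<open>\<sigma>\<close> with all its subsets.
  The dimension is an integer so that the empty simplex (\<open>d = -1\<close>, disjoint union) is covered.\<close>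

definition is_gluing :: "int \<Rightarrow> 'a set set \<Rightarrow> 'b set set \<Rightarrow> 'c set set \<Rightarrow> bool" where
  "is_gluing d K L M \<longleftrightarrow>
     (\<exists>\<phi> \<psi> \<sigma>. inj_on \<phi> (vertices K) \<and> inj_on \<psi> (vertices L) \<and>
        M = relabel \<phi> K \<union> relabel \<psi> L \<and>
        relabel \<phi> K \<inter> relabel \<psi> L = Pow \<sigma> \<and> int (card \<sigma>) = d + 1)"


section \<open>Exterior algebra\<close>

text \<open>A vector is a finite formal real linear combination of basis vectors \<open>e\<^sub>S\<close> indexed by sets of
  positive integers.\<close>

type_synonym ext = "nat set \<Rightarrow>\<^sub>0 real"

definition ext_basis :: "nat set \<Rightarrow> ext" where
  "ext_basis S = Poly_Mapping.single S 1"

definition wedge_basis :: "nat set \<Rightarrow> nat set \<Rightarrow> ext" where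
  "wedge_basis S T =
     (if S \<inter> T = {} then (- 1) ^ card {(s, t). s \<in> S \<and> t \<in> T \<and> t < s} *\<^sub>R ext_basis (S \<union> T) else 0)"

definition wedge :: "ext \<Rightarrow> ext \<Rightarrow> ext" where
  "wedge x y =
     (\<Sum>S\<in>Poly_Mapping.keys x. \<Sum>T\<in>Poly_Mapping.keys y.
        (Poly_Mapping.lookup x S * Poly_Mapping.lookup y T) *\<^sub>R wedge_basis S T)"

text \<open>The exterior algebra of the space with basis \<open>e\<^sub>1, \<dots>, e\<^sub>n\<close>.\<close>

definition ext_algebra :: "nat \<Rightarrow> ext set" where
  "ext_algebra n = span {ext_basis T | T. T \<subseteq> {1..n}}"

text \<open>The two-sided ideal generated by the \<open>e\<^sub>T\<close> with \<open>T\<close> a non-face of \<open>K\<close>.\<close>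

definition face_ideal :: "nat \<Rightarrow> nat set set \<Rightarrow> ext set" where
  "face_ideal n K =
     span {wedge a (wedge (ext_basis T) b) | a T b.
             a \<in> ext_algebra n \<and> b \<in> ext_algebra n \<and> T \<subseteq> {1..n} \<and> T \<notin> K}"


section \<open>Algebraic shifting\<close>

text \<open>Polynomials over the rationals in variables of type \<open>'i\<close>: finitely supported maps from
  monomials (finitely supported exponent vectors) to coefficients.\<close>

definition eval_rat_poly :: "('i \<Rightarrow> real) \<Rightarrow> (('i \<Rightarrow>\<^sub>0 nat) \<Rightarrow>\<^sub>0 rat) \<Rightarrow> real" where
  "eval_rat_poly x p =
     (\<Sum>m\<in>Poly_Mapping.keys p.
        of_rat (Poly_Mapping.lookup p m) *
        (\<Prod>i\<in>Poly_Mapping.keys m. x i ^ Poly_Mapping.lookup m i))"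

definition algebraically_independent :: "'i set \<Rightarrow> ('i \<Rightarrow> real) \<Rightarrow> bool" where
  "algebraically_independent I x \<longleftrightarrow>
     (\<forall>p. (\<forall>m\<in>Poly_Mapping.keys p. Poly_Mapping.keys m \<subseteq> I) \<and> eval_rat_poly x p = 0 \<longrightarrow> p = 0)"

definition generic_matrix :: "nat \<Rightarrow> (nat \<Rightarrow> nat \<Rightarrow> real) \<Rightarrow> bool" where
  "generic_matrix n \<alpha> \<longleftrightarrow>
     algebraically_independent ({1..n} \<times> {1..n}) (\<lambda>(i, j). \<alpha> i j)"

definition lex_less :: "nat set \<Rightarrow> nat set \<Rightarrow> bool" where
  "lex_less S T \<longleftrightarrow> card S = card T \<and> S \<noteq> T \<and> Min ((S - T) \<union> (T - S)) \<in> S"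

definition gen_vec :: "nat \<Rightarrow> (nat \<Rightarrow> nat \<Rightarrow> real) \<Rightarrow> nat \<Rightarrow> ext" where
  "gen_vec n \<alpha> i = (\<Sum>j = 1..n. \<alpha> i j *\<^sub>R ext_basis {j})"

definition gen_ext :: "nat \<Rightarrow> (nat \<Rightarrow> nat \<Rightarrow> real) \<Rightarrow> nat set \<Rightarrow> ext" where
  "gen_ext n \<alpha> S = foldr wedge (map (gen_vec n \<alpha>) (sorted_list_of_set S)) (ext_basis {})"

text \<open>The image of \<open>f\<^sub>S\<close> in the quotient by the ideal lies in the span of the images of the
  preceding \<open>f\<^bsub>S'\<^esub>\<close> iff \<open>f\<^sub>S\<close> is congruent modulo the ideal to a vector in their span.\<close>

definition shifting_wrt :: "nat \<Rightarrow> (nat \<Rightarrow> nat \<Rightarrow> real) \<Rightarrow> nat set set \<Rightarrow> nat set set" where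
  "shifting_wrt n \<alpha> K =
     {S. S \<subseteq> {1..n} \<and>
         \<not> (\<exists>v\<in>span {gen_ext n \<alpha> S' | S'. S' \<subseteq> {1..n} \<and> lex_less S' S}.
              gen_ext n \<alpha> S - v \<in> face_ideal n K)}"

text \<open>\<open>D\<close> arises from \<open>K\<close> by some labelling of the vertices by elements of \<open>{1..n}\<close> and some
  generic matrix. There is exactly one such \<open>D\<close>, since the result does not depend on
  the labelling, on \<open>n\<close> or on the matrix; \<open>\<Delta> K\<close> is that \<open>D\<close>.\<close>

definition is_shifting :: "'a set set \<Rightarrow> nat set set \<Rightarrow> bool" where
  "is_shifting K D \<longleftrightarrow>
     (\<exists>n \<alpha> \<phi>. generic_matrix n \<alpha> \<and> inj_on \<phi> (vertices K) \<and> \<phi> ` vertices K \<subseteq> {1..n} \<and>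
        D = shifting_wrt n \<alpha> (relabel \<phi> K))"

definition \<Delta> :: "'a set set \<Rightarrow> nat set set" where
  "\<Delta> K = (THE D. is_shifting K D)"


section \<open>Initial segments\<close>

definition init :: "nat \<Rightarrow> nat set \<Rightarrow> nat set" where
  "init j T = set (take j (sorted_list_of_set T))"

definition I1 :: "nat \<Rightarrow> nat set \<Rightarrow> nat set set" where
  "I1 n S = {T. T \<subseteq> {1..n} \<and> card T = card S + 1 \<and> init (card S) T = S}"

definition D_num :: "nat \<Rightarrow> nat set set \<Rightarrow> nat set \<Rightarrow> nat" where
  "D_num n H T = card (I1 n (init (card T - 1) T) \<inter> \<Delta> H)"

end

theory Submission
  imports Defs "HOL-Library.Function_Algebras"
begin

text \<open>
  Write \<open>f\<^sub>Q\<close> for the wedge of the generic rows indexed by \<open>Q\<close>. For a \<open>j\<close>-set \<open>S\<close>, let \<open>W\<close> be the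
  span of all \<open>v \<and> f\<^sub>Q\<close> with \<open>Q\<close> lexicographically smaller than \<open>S\<close>, and for a complex \<open>H\<close> let
  \<open>N\<^sub>H\<close> be the space of vectors \<open>v\<close> for which \<open>v \<and> f\<^sub>S\<close> agrees on \<open>H\<close> with an element of \<open>W\<close>.
  Walking through the rows \<open>f\<^sub>t\<close> in order, \<open>S \<union> {t}\<close> with \<open>t > max S\<close> belongs to \<open>\<Delta> H\<close> iff \<open>f\<^sub>t\<close> is
  not in \<open>N\<^sub>H + span {f\<^sub>i | i < t}\<close>, so the number \<open>D\<^sub>H\<close> of such \<open>t\<close> is the codimension of \<open>N\<^sub>H\<close>.
  Since exchanging two rows preserves genericity, these \<open>t\<close> form an initial segment above
  \<open>max S\<close>. For a gluing along \<open>\<sigma>\<close> one has \<open>N\<^bsub>K \<union> L\<^esub> = N\<^sub>K \<inter> N\<^sub>L\<close> and \<open>N\<^sub>\<sigma> = N\<^sub>K + N\<^sub>L\<close>, because an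
  element of degree \<open>j + 1\<close> of \<open>W\<close> that vanishes on \<open>\<sigma>\<close> can be written as a sum of \<open>u \<and> f\<^sub>Q\<close> with
  \<open>u\<close> vanishing on \<open>\<sigma>\<close>, and such a \<open>u\<close> splits into a part vanishing on the vertices of \<open>K\<close> and
  one vanishing on the vertices of \<open>L\<close>. Hence codimensions satisfy
  \<open>D\<^bsub>K \<union> L\<^esub> = D\<^sub>K + D\<^sub>L - D\<^sub>\<sigma>\<close>.
\<close>

section \<open>Linear algebra\<close>

text \<open>The formula compares the shifted complexes of K, L, the simplex and the union, whose
  vertex sets differ, while a codimension argument needs one ambient space and one matrix. So
  everything is computed with a single generic n x n matrix. This requires that
  \<open>\<Delta>\<close> depend neither on the labelling nor on n nor on the matrix, and that
  generic matrices exist. The spaces N_H consist of vectors rather than of forms of higher degree,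
  so K and L are separated simply by splitting a vector according to its support. Lexicographic
  order enters through one property: trading late rows for early ones makes an index set smaller, so
  that expanding a projected product stays inside a lexicographically initial family.\<close>

instantiation "fun" :: (type, real_vector) real_vector
begin

definition scaleR_fun_def: "scaleR r f = (\<lambda>x. r *\<^sub>R f x)"

instance
  by standard (auto simp: scaleR_fun_def plus_fun_def algebra_simps)

end

lemma scaleR_fun_apply: "(r *\<^sub>R f) x = r *\<^sub>R f x"
  by (simp add: scaleR_fun_def)

lemma sum_fun_apply: "(\<Sum>i\<in>A. f i) x = (\<Sum>i\<in>A. f i x)"
  for f :: "'i \<Rightarrow> 'a \<Rightarrow> 'b::comm_monoid_add"
  by (induction A rule: infinite_finite_induct) auto

lemma independent_card_ge_spans:
  fixes S T :: "'a::real_vector set"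
  assumes "finite T" "independent S" "S \<subseteq> span T" "card T \<le> card S"
  shows "T \<subseteq> span S"
proof
  fix x assume "x \<in> T"
  show "x \<in> span S"
  proof (rule ccontr)
    assume x: "x \<notin> span S"
    have "insert x S \<subseteq> span T" using span_base[OF \<open>x \<in> T\<close>] assms(3) by blast
    then have "finite (insert x S) \<and> card (insert x S) \<le> card T"
      by (rule independent_span_bound[OF assms(1) independent_insertI[OF x assms(2)]])
    moreover have "x \<notin> S" using x span_base by blast
    ultimately show False using assms(4) by auto
  qed
qed

text \<open>The function spaces used later are infinite-dimensional. The finite set \<open>W\<close>
  guarantees a finite basis of \<open>S\<close>, so that cardinality really counts the new
  vector.\<close>

lemma dim_insert_in_span:
  fixes S :: "'a::real_vector set"
  assumes "finite W" "S \<subseteq> span W"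
  shows "dim (insert x S) = (if x \<in> span S then dim S else Suc (dim S))"
proof -
  obtain B where B: "B \<subseteq> S" "independent B" "S \<subseteq> span B" "card B = dim S"
    using basis_exists by blast
  have "finite B"
    using independent_span_bound[OF assms(1) B(2)] B(1) assms(2) by blast
  have spB: "span B = span S"
    using B by (meson span_eq span_superset subset_trans)
  show ?thesis
  proof (cases "x \<in> span S")
    case True
    then have "span (insert x S) = span S" by (rule span_redundant)
    then show ?thesis using True span_eq_dim by metis
  next
    case False
    then have ind: "independent (insert x B)" and "x \<notin> B"
      using B spB by (auto simp: independent_insert intro: span_base)
    have "insert x S \<subseteq> span (insert x B)"
      using B(3) span_mono[of B "insert x B"] by (auto intro: span_base)
    moreover have "insert x B \<subseteq> insert x S" using B(1) by blast
    ultimately have "dim (insert x S) = card (insert x B)"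
      using basis_card_eq_dim ind by metis
    then show ?thesis
      using False \<open>finite B\<close> \<open>x \<notin> B\<close> B(4) by simp
  qed
qed

text \<open>Adding \<open>g 1\<close>, ..., \<open>g p\<close> one at a time raises the dimension by
  one exactly at the indices whose vector is outside the span reached so far.\<close>

lemma dim_Un_flag:
  fixes g :: "nat \<Rightarrow> 'a::real_vector"
  assumes "finite W" "N \<subseteq> span W"
  shows "dim (N \<union> g ` {1..p}) = dim N + card {i \<in> {1..p}. g i \<notin> span (N \<union> g ` {1..<i})}"
proof (induction p)
  case 0
  then show ?case by simp
next
  case (Suc p)
  let ?S = "N \<union> g ` {1..p}"
  have eq: "N \<union> g ` {1..Suc p} = insert (g (Suc p)) ?S"
    by (auto simp: atLeastAtMostSuc_conv)
  have fin: "finite (W \<union> g ` {1..p})" and sub: "?S \<subseteq> span (W \<union> g ` {1..p})"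
    using assms span_mono[of W "W \<union> g ` {1..p}"] by (auto intro: span_base)
  have "{i \<in> {1..Suc p}. g i \<notin> span (N \<union> g ` {1..<i})} =
    (if g (Suc p) \<in> span ?S then {} else {Suc p}) \<union> {i \<in> {1..p}. g i \<notin> span (N \<union> g ` {1..<i})}"
    by (auto simp: atLeastAtMostSuc_conv atLeastLessThanSuc_atLeastAtMost le_Suc_eq)
  then show ?case
    unfolding eq dim_insert_in_span[OF fin sub] Suc.IH by simp
qed

text \<open>Walking along a flag that starts in \<open>A\<close>, a vector depends on
  \<open>B\<close> and its predecessors iff it depends on \<open>A \<inter> B\<close> and its predecessors.\<close>

lemma dim_Un_Int:
  fixes A B :: "'a::real_vector set"
  assumes A: "subspace A" and B: "subspace B" and W: "finite W" "A \<union> B \<subseteq> span W"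
  shows "dim (A \<union> B) + dim (A \<inter> B) = dim A + dim B"
proof -
  obtain C where C: "C \<subseteq> A" "independent C" "A \<subseteq> span C" "card C = dim A"
    by (rule basis_exists)
  have "finite C"
    using independent_span_bound[OF W(1) C(2)] C(1) W(2) by blast
  then obtain g where g: "bij_betw g {1..card C} C"
    using ex_bij_betw_nat_finite_1 by blast
  let ?p = "card C"
  have gC: "g ` {1..?p} = C" using g by (simp add: bij_betw_def)
  have iff: "g i \<in> span (B \<union> g ` {1..<i}) \<longleftrightarrow> g i \<in> span (A \<inter> B \<union> g ` {1..<i})"
    if i: "i \<in> {1..?p}" for i
  proof
    assume "g i \<in> span (B \<union> g ` {1..<i})"
    then obtain b u where bu: "g i = b + u" "b \<in> span B" "u \<in> span (g ` {1..<i})"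
      unfolding span_Un by blast
    have gA: "g ` {1..<i} \<subseteq> A" "g i \<in> A" using i gC C(1) by auto
    then have "u \<in> A" using bu(3) A span_minimal by blast
    then have "b \<in> A" using bu(1) gA(2) A subspace_diff[of A "g i" u] by auto
    then have "b \<in> span (A \<inter> B)" using bu(2) B by (metis IntI span_base span_eq_iff)
    then show "g i \<in> span (A \<inter> B \<union> g ` {1..<i})"
      unfolding span_Un using bu by blast
  next
    assume "g i \<in> span (A \<inter> B \<union> g ` {1..<i})"
    then show "g i \<in> span (B \<union> g ` {1..<i})"
      using span_mono[of "A \<inter> B \<union> g ` {1..<i}" "B \<union> g ` {1..<i}"] by blast
  qed
  have "{i \<in> {1..?p}. g i \<notin> span (B \<union> g ` {1..<i})} =
      {i \<in> {1..?p}. g i \<notin> span (A \<inter> B \<union> g ` {1..<i})}"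
    using iff by blast
  moreover have "B \<subseteq> span W" "A \<inter> B \<subseteq> span W" using W(2) by auto
  ultimately have "dim (B \<union> C) + dim (A \<inter> B) = dim (A \<inter> B \<union> C) + dim B"
    using dim_Un_flag[of W B g ?p] dim_Un_flag[of W "A \<inter> B" g ?p] W(1) gC by simp
  moreover have "span (B \<union> C) = span (A \<union> B)"
  proof -
    have "span (B \<union> C) \<subseteq> span (A \<union> B)" using C(1) by (intro span_mono) auto
    moreover have "A \<union> B \<subseteq> span (B \<union> C)"
      using C(3) span_mono[of C "B \<union> C"] by (auto intro: span_base)
    ultimately show ?thesis
      by (meson span_minimal subset_antisym subspace_span)
  qed
  moreover have "span (A \<inter> B \<union> C) = span A"
  proof -
    have "span (A \<inter> B \<union> C) \<subseteq> span A" using C(1) by (intro span_mono) auto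
    moreover have "A \<subseteq> span (A \<inter> B \<union> C)"
      using C(3) span_mono[of C "A \<inter> B \<union> C"] by auto
    ultimately show ?thesis
      by (meson span_minimal subset_antisym subspace_span)
  qed
  ultimately show ?thesis
    using span_eq_dim[of "B \<union> C" "A \<union> B"] span_eq_dim[of "A \<inter> B \<union> C" A] by linarith
qed

text \<open>The vectors \<open>g i\<close> fill up the ambient span, so \<open>c N\<close> is the
  codimension of the span of \<open>N\<close> in it. Subtracting from the total dimension turns the
  modular law for dimensions into one for codimensions, with \<open>A \<union> B\<close> standing
  for the sum of the subspaces.\<close>

lemma card_flag_Un_Int:
  fixes g :: "nat \<Rightarrow> 'a::real_vector" and A B :: "'a set" and n :: nat
  defines "c \<equiv> \<lambda>N. card {i \<in> {1..n}. g i \<notin> span (N \<union> g ` {1..<i})}"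
  assumes "subspace A" "subspace B" "A \<union> B \<subseteq> span (g ` {1..n})"
  shows "c (A \<union> B) + c (A \<inter> B) = c A + c B"
proof -
  have eq: "dim (g ` {1..n}) = dim N + c N" if "N \<subseteq> span (g ` {1..n})" for N
  proof -
    have "span (N \<union> g ` {1..n}) = span (g ` {1..n})"
      unfolding span_eq using that span_superset by (auto intro: span_base)
    then have "dim (N \<union> g ` {1..n}) = dim (g ` {1..n})"
      by (rule span_eq_dim)
    then show ?thesis
      using dim_Un_flag[OF _ that, of g n] unfolding c_def by simp
  qed
  have "A \<subseteq> span (g ` {1..n})" "B \<subseteq> span (g ` {1..n})" "A \<inter> B \<subseteq> span (g ` {1..n})"
    using assms(4) by auto
  then have "dim (g ` {1..n}) = dim A + c A" "dim (g ` {1..n}) = dim B + c B"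
    "dim (g ` {1..n}) = dim (A \<union> B) + c (A \<union> B)" "dim (g ` {1..n}) = dim (A \<inter> B) + c (A \<inter> B)"
    using eq assms(4) by blast+
  then show ?thesis
    using dim_Un_Int[OF assms(2,3) finite_imageI[OF finite_atLeastAtMost] assms(4)] by linarith
qed

section \<open>Exterior products as functions on sets\<close>

text \<open>An element of the exterior algebra is represented by its coefficient function. Then \<open>lmul v\<close>
  is multiplication by the vector \<open>v\<close> from the left, and \<open>minor f S T\<close> is the coefficient of
  \<open>e\<^sub>T\<close> in \<open>f\<^sub>S\<close>, where \<open>f i\<close> is the \<open>i\<close>-th row.\<close>

definition lmul :: "(nat \<Rightarrow> real) \<Rightarrow> (nat set \<Rightarrow> real) \<Rightarrow> nat set \<Rightarrow> real" where
  "lmul v x T = (\<Sum>j\<in>T. (- 1) ^ card {t \<in> T. t < j} * v j * x (T - {j}))"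

definition wprod :: "(nat \<Rightarrow> real) list \<Rightarrow> nat set \<Rightarrow> real" where
  "wprod vs = foldr lmul vs (\<lambda>T. if T = {} then 1 else 0)"

definition minor :: "(nat \<Rightarrow> nat \<Rightarrow> real) \<Rightarrow> nat set \<Rightarrow> nat set \<Rightarrow> real" where
  "minor f S = wprod (map f (sorted_list_of_set S))"

lemma linear_lmul_right: "linear (lmul v)"
  by (rule linearI) (auto simp: lmul_def fun_eq_iff scaleR_fun_apply algebra_simps sum.distrib sum_distrib_left)

lemma linear_lmul_left: "linear (\<lambda>v. lmul v x)"
  by (rule linearI) (auto simp: lmul_def fun_eq_iff scaleR_fun_apply algebra_simps sum.distrib sum_distrib_left)

text \<open>Both sides are sums over ordered pairs of distinct elements of \<open>T\<close>.
  Removing a pair in the opposite order flips the sign, because only the removal of the smaller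
  element lowers the position of the other.\<close>

lemma lmul_anticommute: "lmul u (lmul v x) = - lmul v (lmul u x)"
proof
  fix T :: "nat set"
  show "lmul u (lmul v x) T = (- lmul v (lmul u x)) T"
  proof (cases "finite T")
    case False
    then show ?thesis by (simp add: lmul_def)
  next
    case True
    \<comment> \<open>The sign picked up when \<open>j\<close> is removed first and \<open>k\<close>
      second.\<close>
    define s where "s j k = (- 1 :: real) ^ (card {t \<in> T. t < j} + card {t \<in> T - {j}. t < k})" for j k
    have s: "s j k = - s k j" if "j \<in> T" "k \<in> T" "j < k" for j k
    proof -
      have "{t \<in> T. t < k} = insert j {t \<in> T - {j}. t < k}" using that by auto
      then have "card {t \<in> T. t < k} = Suc (card {t \<in> T - {j}. t < k})" using True by simp
      moreover have "{t \<in> T - {k}. t < j} = {t \<in> T. t < j}" using that by auto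
      ultimately show ?thesis unfolding s_def by (simp add: add.commute)
    qed
    have s': "s j k = - s k j" if "j \<in> T" "k \<in> T" "j \<noteq> k" for j k
      using s[of j k] s[of k j] that by (cases "j < k") auto
    have exp: "lmul u (lmul v x) T =
        (\<Sum>j\<in>T. \<Sum>k\<in>T. if j = k then 0 else s j k * u j * v k * x (T - {j} - {k}))" for u v
    proof -
      have "lmul u (lmul v x) T = (\<Sum>j\<in>T. \<Sum>k\<in>T - {j}. s j k * u j * v k * x (T - {j} - {k}))"
        by (simp add: lmul_def s_def sum_distrib_left power_add mult_ac cong: sum.cong)
      also have "\<dots> = (\<Sum>j\<in>T. \<Sum>k\<in>T. if j = k then 0 else s j k * u j * v k * x (T - {j} - {k}))"
        using True by (intro sum.cong refl sum.mono_neutral_cong_left) auto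
      finally show ?thesis .
    qed
    have "lmul u (lmul v x) T =
        (\<Sum>k\<in>T. \<Sum>j\<in>T. if j = k then 0 else s j k * u j * v k * x (T - {j} - {k}))"
      unfolding exp by (rule sum.swap)
    also have "\<dots> = (\<Sum>k\<in>T. \<Sum>j\<in>T. - (if k = j then 0 else s k j * v k * u j * x (T - {k} - {j})))"
    proof (intro sum.cong refl)
      fix k j assume "k \<in> T" "j \<in> T"
      then show "(if j = k then 0 else s j k * u j * v k * x (T - {j} - {k})) =
          - (if k = j then 0 else s k j * v k * u j * x (T - {k} - {j}))"
        using s'[of j k] by (simp add: Diff_insert2 [symmetric] insert_commute mult_ac)
    qed
    finally show ?thesis by (simp add: exp sum_negf)
  qed
qed

lemma lmul_self [simp]: "lmul v (lmul v x) = 0"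
proof -
  have "lmul v (lmul v x) = - lmul v (lmul v x)" by (rule lmul_anticommute)
  then show ?thesis by (auto simp: fun_eq_iff)
qed

lemma lmul_cong:
  assumes "\<And>j. j \<in> T \<Longrightarrow> v j = w j" "\<And>j. j \<in> T \<Longrightarrow> x (T - {j}) = y (T - {j})"
  shows "lmul v x T = lmul w y T"
  unfolding lmul_def by (intro sum.cong refl) (simp add: assms)

lemma wprod_Nil: "wprod [] T = (if T = {} then 1 else 0)"
  by (simp add: wprod_def)

lemma wprod_Cons [simp]: "wprod (v # vs) = lmul v (wprod vs)"
  by (simp add: wprod_def)

lemma wprod_append: "wprod (us @ vs) = foldr lmul us (wprod vs)"
  by (simp add: wprod_def)

text \<open>The coefficient at \<open>T\<close> sees only the columns in \<open>T\<close>, so rows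
  may be altered freely elsewhere. This is what allows a row to be replaced by a projection that
  agrees with it on the vertices of a complex.\<close>

lemma wprod_cong:
  assumes "length us = length vs" "\<And>i j. i < length vs \<Longrightarrow> j \<in> T \<Longrightarrow> (us ! i) j = (vs ! i) j"
  shows "wprod us T = wprod vs T"
  using assms
proof (induction us arbitrary: vs T)
  case Nil
  then show ?case by simp
next
  case (Cons u us)
  then obtain v vs' where vs: "vs = v # vs'" by (cases vs) auto
  have "wprod us (T - {j}) = wprod vs' (T - {j})" if "j \<in> T" for j
    using Cons.prems(1) Cons.prems(2)[of "Suc _"] vs by (intro Cons.IH) auto
  moreover have "u j = v j" if "j \<in> T" for j
    using Cons.prems(2)[of 0 j] vs that by auto
  ultimately show ?case unfolding vs wprod_Cons by (intro lmul_cong) auto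
qed

lemma linear_foldr_lmul: "linear (foldr lmul us)"
proof (induction us)
  case Nil
  then show ?case by (simp add: linear_id[unfolded id_def] id_def)
next
  case (Cons u us)
  then show ?case using linear_compose[OF Cons linear_lmul_right[of u]] by (simp add: comp_def)
qed

lemma wprod_move_to_front:
  "wprod (us @ v # vs) = (- 1) ^ length us *\<^sub>R wprod (v # us @ vs)"
proof (induction us)
  case Nil
  then show ?case by simp
next
  case (Cons u us)
  have "wprod ((u # us) @ v # vs) = lmul u ((- 1) ^ length us *\<^sub>R lmul v (wprod (us @ vs)))"
    using Cons by simp
  also have "\<dots> = (- 1) ^ length us *\<^sub>R lmul u (lmul v (wprod (us @ vs)))"
    by (rule linear_cmul[OF linear_lmul_right])
  also have "lmul u (lmul v (wprod (us @ vs))) = - lmul v (lmul u (wprod (us @ vs)))"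
    by (rule lmul_anticommute)
  finally show ?case by (simp del: uminus_apply)
qed

lemma minor_empty: "minor f {} T = (if T = {} then 1 else 0)"
  by (simp add: minor_def wprod_Nil)

lemma minor_insert_less:
  assumes "finite S" "\<And>s. s \<in> S \<Longrightarrow> k < s"
  shows "minor f (insert k S) = lmul (f k) (minor f S)"
proof -
  have "k \<notin> S" using assms(2) by blast
  have "sorted_list_of_set (insert k S) = k # sorted_list_of_set S"
    using assms by (subst sorted_list_of_set_insert)
      (auto simp: \<open>k \<notin> S\<close> intro!: insort_is_Cons less_imp_le)
  then show ?thesis by (simp add: minor_def)
qed

lemma lmul_minor_mem:
  assumes "finite S" "k \<in> S"
  shows "lmul (f k) (minor f S) = 0"
  using assms
proof (induction S rule: finite_linorder_min_induct)
  case empty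
  then show ?case by simp
next
  case (insert b A)
  have eq: "minor f (insert b A) = lmul (f b) (minor f A)"
    using insert by (intro minor_insert_less) auto
  show ?case
  proof (cases "k = b")
    case True
    then show ?thesis by (simp add: eq)
  next
    case False
    then have "lmul (f k) (minor f A) = 0" using insert by auto
    then show ?thesis
      by (simp add: eq lmul_anticommute[of "f k"] linear_0[OF linear_lmul_right])
  qed
qed

text \<open>Sorting row \<open>k\<close> into its place costs one sign for each smaller row. Only
  invertibility of the factor matters later, so the sign is left unspecified.\<close>

lemma lmul_minor_insert:
  assumes "finite S" "k \<notin> S"
  shows "\<exists>c\<in>{1, -1}. lmul (f k) (minor f S) = c *\<^sub>R minor f (insert k S)"
  using assms
proof (induction S rule: finite_linorder_min_induct)
  case empty
  have "minor f {k} = lmul (f k) (minor f {})" by (rule minor_insert_less) auto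
  then show ?case by (intro bexI[of _ 1]) auto
next
  case (insert b A)
  have eq: "minor f (insert b A) = lmul (f b) (minor f A)"
    using insert by (intro minor_insert_less) auto
  show ?case
  proof (cases "k < b")
    case True
    have "minor f (insert k (insert b A)) = lmul (f k) (minor f (insert b A))"
      using insert True by (intro minor_insert_less) auto
    then show ?thesis by (intro bexI[of _ 1]) auto
  next
    case False
    then have "b < k" using insert by auto
    obtain c :: real where c: "c \<in> {1, -1}" "lmul (f k) (minor f A) = c *\<^sub>R minor f (insert k A)"
      using insert.IH insert.prems by blast
    have "minor f (insert b (insert k A)) = lmul (f b) (minor f (insert k A))"
      using insert \<open>b < k\<close> by (intro minor_insert_less) auto
    then have "lmul (f k) (minor f (insert b A)) = (- c) *\<^sub>R minor f (insert k (insert b A))"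
      by (simp add: eq lmul_anticommute[of "f k"] c(2) linear_cmul[OF linear_lmul_right] insert_commute)
    then show ?thesis using c(1) by (intro bexI[of _ "- c"]) auto
  qed
qed

text \<open>A repeated row kills the product and sorting distinct rows costs a sign. The clause on
  \<open>c\<close> permits division by it when two rows have been exchanged.\<close>

lemma wprod_map_minor:
  "\<exists>c\<in>{0, 1, -1}. wprod (map f ks) = c *\<^sub>R minor f (set ks) \<and> (c \<noteq> 0 \<longleftrightarrow> distinct ks)"
proof (induction ks)
  case Nil
  then show ?case by (intro bexI[of _ 1]) (auto simp: minor_def)
next
  case (Cons k ks)
  then obtain c where c: "c \<in> {0, 1, -1}" "wprod (map f ks) = c *\<^sub>R minor f (set ks)" "c \<noteq> 0 \<longleftrightarrow> distinct ks"
    by blast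
  have eq: "wprod (map f (k # ks)) = c *\<^sub>R lmul (f k) (minor f (set ks))"
    by (simp add: c(2) linear_cmul[OF linear_lmul_right])
  show ?case
  proof (cases "k \<in> set ks")
    case True
    then show ?thesis using eq lmul_minor_mem[of "set ks" k f] by (intro bexI[of _ 0]) auto
  next
    case False
    then obtain d :: real where d: "d \<in> {1, -1}" "lmul (f k) (minor f (set ks)) = d *\<^sub>R minor f (insert k (set ks))"
      using lmul_minor_insert[of "set ks" k f] by blast
    show ?thesis
      using c d eq False by (intro bexI[of _ "c * d"]) auto
  qed
qed

text \<open>Multilinear expansion, one factor at a time. Every factor has its own spanning set,
  since later some factors are to stay fixed while others are expanded in the first rows.\<close>

lemma wprod_in_span:
  assumes "list_all2 (\<lambda>v X. v \<in> span X) vs Xs"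
  shows "wprod vs \<in> span {wprod us | us. list_all2 (\<in>) us Xs}"
  using assms
proof (induction vs Xs rule: list_all2_induct)
  case Nil
  then show ?case by (auto intro: span_base)
next
  case (Cons v vs X Xs)
  let ?B = "span {wprod us | us. list_all2 (\<in>) us (X # Xs)}"
  have *: "lmul u (wprod vs) \<in> ?B" if u: "u \<in> X" for u
  proof -
    have "lmul u (wprod vs) \<in> lmul u ` span {wprod us | us. list_all2 (\<in>) us Xs}"
      using Cons by blast
    also have "\<dots> = span (lmul u ` {wprod us | us. list_all2 (\<in>) us Xs})"
      by (rule linear_span_image[OF linear_lmul_right, symmetric])
    also have "\<dots> \<subseteq> ?B"
    proof (intro span_mono, clarify)
      fix us assume "list_all2 (\<in>) us Xs"
      then show "\<exists>us'. lmul u (wprod us) = wprod us' \<and> list_all2 (\<in>) us' (X # Xs)"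
        using u by (intro exI[of _ "u # us"]) auto
    qed
    finally show ?thesis .
  qed
  have "lmul v (wprod vs) \<in> (\<lambda>u. lmul u (wprod vs)) ` span X"
    using Cons by blast
  also have "\<dots> = span ((\<lambda>u. lmul u (wprod vs)) ` X)"
    by (rule linear_span_image[OF linear_lmul_left, symmetric])
  also have "\<dots> \<subseteq> ?B"
    using * by (intro span_minimal) auto
  finally show ?case by simp
qed

text \<open>Serves to read off coefficients: on subsets of \<open>A\<close>, products of dual
  vectors behave like the standard basis of the exterior algebra.\<close>

lemma minor_unit:
  assumes "finite A" "S \<subseteq> A" "T \<subseteq> A" "\<And>s t. s \<in> A \<Longrightarrow> t \<in> A \<Longrightarrow> e s t = (if s = t then 1 else 0)"
  shows "minor e S T = (if S = T then 1 else 0)"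
proof -
  have "finite S" using assms finite_subset by blast
  then show ?thesis using assms(2,3)
  proof (induction S arbitrary: T rule: finite_linorder_min_induct)
    case empty
    then show ?case by (auto simp: minor_empty)
  next
    case (insert b S)
    have fT: "finite T" using insert assms(1) finite_subset by blast
    have eq: "minor e (insert b S) = lmul (e b) (minor e S)"
      using insert by (intro minor_insert_less) auto
    have "lmul (e b) (minor e S) T =
       (\<Sum>j\<in>T. if j = b then (- 1) ^ card {t \<in> T. t < b} * minor e S (T - {b}) else 0)"
      unfolding lmul_def using insert.prems by (intro sum.cong refl) (auto simp: assms(4) subset_iff)
    also have "\<dots> = (if b \<in> T then (- 1) ^ card {t \<in> T. t < b} * minor e S (T - {b}) else 0)"
      using fT by (simp add: sum.delta)
    also have "\<dots> = (if insert b S = T then 1 else 0)"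
    proof (cases "b \<in> T")
      case True
      have *: "minor e S (T - {b}) = (if S = T - {b} then 1 else 0)"
        using insert.prems by (intro insert.IH) auto
      have "b \<notin> S" using insert.hyps(2) by blast
      have em: "{t \<in> T. t < b} = {}" if "S = T - {b}"
      proof -
        have "\<not> t < b" if "t \<in> T" for t
          using that insert.hyps(2)[rule_format, of t] \<open>S = T - {b}\<close> by (cases "t = b") auto
        then show ?thesis by blast
      qed
      have eqv: "insert b S = T \<longleftrightarrow> S = T - {b}" using True \<open>b \<notin> S\<close> by blast
      show ?thesis
        unfolding * eqv using True em by (cases "S = T - {b}") (simp_all only: if_True if_False card.empty, simp_all)
    qed auto
    finally show ?case by (simp add: eq)
  qed
qed

section \<open>Lexicographic order and frames\<close>

lemma lex_less_iff:
  assumes "finite S" "finite T"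
  shows "lex_less S T \<longleftrightarrow> card S = card T \<and> (\<exists>p\<in>S - T. \<forall>q<p. q \<in> S \<longleftrightarrow> q \<in> T)"
proof
  assume l: "lex_less S T"
  let ?D = "(S - T) \<union> (T - S)"
  have "finite ?D" "?D \<noteq> {}" using assms l by (auto simp: lex_less_def)
  then have m: "Min ?D \<in> ?D" "\<And>q. q < Min ?D \<Longrightarrow> q \<notin> ?D"
    by (rule Min_in) (meson Min_le \<open>finite ?D\<close> leD)
  moreover have "card S = card T" "Min ?D \<in> S" using l by (auto simp: lex_less_def)
  ultimately show "card S = card T \<and> (\<exists>p\<in>S - T. \<forall>q<p. q \<in> S \<longleftrightarrow> q \<in> T)"
    by (intro conjI bexI[of _ "Min ?D"]) blast+
next
  assume "card S = card T \<and> (\<exists>p\<in>S - T. \<forall>q<p. q \<in> S \<longleftrightarrow> q \<in> T)"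
  then obtain p where p: "card S = card T" "p \<in> S" "p \<notin> T" "\<And>q. q < p \<Longrightarrow> q \<in> S \<longleftrightarrow> q \<in> T"
    by blast
  have "Min ((S - T) \<union> (T - S)) = p"
  proof (rule Min_eqI)
    show "p \<le> y" if "y \<in> (S - T) \<union> (T - S)" for y
      using that p(4)[of y] by (meson DiffD1 DiffD2 UnE not_less)
  qed (use assms p in auto)
  then show "lex_less S T" using p by (auto simp: lex_less_def)
qed

lemma lex_less_trans:
  assumes "finite R" "finite S" "finite T" "lex_less R S" "lex_less S T"
  shows "lex_less R T"
proof -
  obtain p where p: "p \<in> R - S" "\<forall>q<p. q \<in> R \<longleftrightarrow> q \<in> S" using assms lex_less_iff by blast
  obtain p' where p': "p' \<in> S - T" "\<forall>q<p'. q \<in> S \<longleftrightarrow> q \<in> T" using assms lex_less_iff by blast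
  have "p \<noteq> p'" using p p' by blast
  then have "min p p' \<in> R - T" "\<forall>q<min p p'. q \<in> R \<longleftrightarrow> q \<in> T"
    using p p' by (cases "p < p'"; auto simp: min_def)+
  moreover have "card R = card T" using assms by (simp add: lex_less_def)
  ultimately show ?thesis using assms(1,3) lex_less_iff by blast
qed

text \<open>The shape in which comparisons arise below: some elements of \<open>Q\<close> are
  exchanged for smaller ones, so the first difference belongs to \<open>R\<close>.\<close>

lemma lex_lessI_replace:
  assumes "finite R" "finite Q" "card R = card Q" "R \<noteq> Q" "\<And>r q. r \<in> R - Q \<Longrightarrow> q \<in> Q - R \<Longrightarrow> r < q"
  shows "lex_less R Q"
proof -
  have "\<not> R \<subseteq> Q" using assms card_subset_eq by metis
  then have m: "Min (R - Q) \<in> R - Q" "\<And>r. r \<in> R - Q \<Longrightarrow> Min (R - Q) \<le> r"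
    using Min_in[of "R - Q"] assms(1) by auto
  then have "\<forall>q<Min (R - Q). q \<in> R \<longleftrightarrow> q \<in> Q" using assms(5) by (meson DiffI leD less_asym)
  then show ?thesis using m assms by (auto simp: lex_less_iff)
qed

text \<open>Restricted to the columns in \<open>U\<close>, the first \<open>card U\<close> rows form a basis.\<close>

definition frame :: "(nat \<Rightarrow> nat \<Rightarrow> real) \<Rightarrow> nat set \<Rightarrow> bool" where
  "frame f U \<longleftrightarrow> finite U \<and>
     (\<forall>t\<in>U. \<exists>v\<in>span (f ` {1..card U}). \<forall>t'\<in>U. v t' = (if t = t' then 1 else 0))"

text \<open>Expansion in rows, where lists with a repeated row drop out and the others are minors up
  to sign.\<close>

lemma wprod_in_span_minors:
  assumes "list_all2 (\<lambda>v A. v \<in> span (f ` A)) vs As"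
  shows "wprod vs \<in> span {minor f (set ks) | ks. distinct ks \<and> list_all2 (\<in>) ks As}"
proof -
  have "list_all2 (\<lambda>v X. v \<in> span X) vs (map (\<lambda>A. f ` A) As)"
    using assms by (simp add: list_all2_map2)
  then have "wprod vs \<in> span {wprod us | us. list_all2 (\<in>) us (map (\<lambda>A. f ` A) As)}"
    by (rule wprod_in_span)
  also have "\<dots> \<subseteq> span {minor f (set ks) | ks. distinct ks \<and> list_all2 (\<in>) ks As}"
  proof (intro span_minimal subspace_span, clarify)
    fix us assume us: "list_all2 (\<in>) us (map (\<lambda>A. f ` A) As)"
    then have "\<exists>ks. us = map f ks \<and> list_all2 (\<in>) ks As"
    proof (induction As arbitrary: us)
      case (Cons A As)
      then obtain u us' where u: "us = u # us'" "u \<in> f ` A" "list_all2 (\<in>) us' (map ((`) f) As)"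
        by (auto simp: list_all2_Cons2)
      obtain k where "k \<in> A" "u = f k" using u by blast
      moreover obtain ks where "us' = map f ks" "list_all2 (\<in>) ks As" using Cons.IH u by blast
      ultimately show ?case using u by (intro exI[of _ "k # ks"]) auto
    qed auto
    then obtain ks where ks: "us = map f ks" "list_all2 (\<in>) ks As" by blast
    obtain c where c: "wprod us = c *\<^sub>R minor f (set ks)" "c \<noteq> 0 \<longleftrightarrow> distinct ks"
      using wprod_map_minor[of f ks] ks by blast
    then show "wprod us \<in> span {minor f (set ks) | ks. distinct ks \<and> list_all2 (\<in>) ks As}"
    proof (cases "c = 0")
      case False
      then have "minor f (set ks) \<in> {minor f (set ks) | ks. distinct ks \<and> list_all2 (\<in>) ks As}"
        using ks c by blast
      then show ?thesis unfolding c(1) by (intro span_scale span_base)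
    qed (simp add: c span_zero)
  qed
  finally show ?thesis .
qed

text \<open>\<open>\<rho>\<close> replaces \<open>v\<close> by the combination of the dual vectors
  \<open>e t\<close> having the same values on \<open>U\<close>, so \<open>v - \<rho> v\<close>
  vanishes on \<open>U\<close>. The \<open>e t\<close> are \<open>card U\<close> independent vectors
  in a space spanned by at most \<open>card U\<close> rows, hence they span that space and
  \<open>\<rho>\<close> fixes it.\<close>

lemma frame_projection:
  assumes "frame f U"
  obtains \<rho> e where "linear \<rho>"
    "\<And>v. \<rho> v \<in> span (f ` {1..card U})" "\<And>v. \<rho> v \<in> span (e ` U)"
    "\<And>v t. t \<in> U \<Longrightarrow> \<rho> v t = v t" "\<And>v. v \<in> span (f ` {1..card U}) \<Longrightarrow> \<rho> v = v"
    "\<And>t t'. t \<in> U \<Longrightarrow> t' \<in> U \<Longrightarrow> e t t' = (if t = t' then 1 else 0)"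
proof -
  have U: "finite U" using assms by (simp add: frame_def)
  obtain e where e: "\<And>t. t \<in> U \<Longrightarrow> e t \<in> span (f ` {1..card U})"
    "\<And>t t'. t \<in> U \<Longrightarrow> t' \<in> U \<Longrightarrow> e t t' = (if t = t' then 1 else 0)"
    using assms unfolding frame_def by metis
  define \<rho> where "\<rho> v = (\<Sum>t\<in>U. v t *\<^sub>R e t)" for v :: "nat \<Rightarrow> real"
  have lin: "linear \<rho>"
    by (rule linearI) (auto simp: \<rho>_def scaleR_fun_apply algebra_simps sum.distrib scaleR_right.sum)
  have val: "\<rho> v t = v t" if "t \<in> U" for v t
  proof -
    have "\<rho> v t = (\<Sum>t'\<in>U. if t' = t then v t' else 0)"
      unfolding \<rho>_def sum_fun_apply scaleR_fun_apply using that e(2) by (intro sum.cong refl) auto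
    then show ?thesis using that U by simp
  qed
  have e_fix: "\<rho> (e t) = e t" if "t \<in> U" for t
  proof -
    have "\<rho> (e t) = (\<Sum>t'\<in>U. if t' = t then e t' else 0)"
      unfolding \<rho>_def using that e(2) by (intro sum.cong refl) auto
    then show ?thesis using that U by (simp add: sum.delta)
  qed
  have inj: "inj_on e U" using e(2) by (intro inj_onI) (metis zero_neq_one)
  have indep: "independent (e ` U)"
  proof (rule independent_if_scalars_zero)
    show "finite (e ` U)" using U by simp
  next
    fix g x assume g: "(\<Sum>x\<in>e ` U. g x *\<^sub>R x) = 0" and x: "x \<in> e ` U"
    then obtain t where t: "t \<in> U" "x = e t" by blast
    have "0 = (\<Sum>t'\<in>U. g (e t') *\<^sub>R e t') t" using g by (simp add: sum.reindex[OF inj])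
    also have "\<dots> = (\<Sum>t'\<in>U. if t' = t then g (e t') else 0)"
      unfolding sum_fun_apply scaleR_fun_apply using t e(2) by (intro sum.cong refl) auto
    finally show "g x = 0" using t U by simp
  qed
  have "f ` {1..card U} \<subseteq> span (e ` U)"
  proof (rule independent_card_ge_spans[OF _ indep])
    show "e ` U \<subseteq> span (f ` {1..card U})" using e(1) by blast
    show "card (f ` {1..card U}) \<le> card (e ` U)"
      using card_image_le[of "{1..card U}" f] by (simp add: card_image[OF inj])
  qed simp
  then have sub: "span (f ` {1..card U}) \<subseteq> span (e ` U)"
    by (intro span_minimal) auto
  have fixed: "\<rho> v = v" if "v \<in> span (e ` U)" for v
    using that
  proof (rule span_induct[where P = "\<lambda>v. \<rho> v = v"])
    show "subspace {v. \<rho> v = v}"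
      by (rule subspaceI) (auto simp: linear_0[OF lin] linear_add[OF lin] linear_cmul[OF lin])
  qed (use e_fix in blast)
  show thesis
  proof (rule that[OF lin])
    show "\<rho> v \<in> span (f ` {1..card U})" for v
      unfolding \<rho>_def using e(1) by (intro span_sum span_scale)
    show "\<rho> v \<in> span (e ` U)" for v
      unfolding \<rho>_def by (intro span_sum span_scale span_base) auto
  qed (use val fixed sub e(2) in blast)+
qed

text \<open>Membership in a span modulo functions that vanish on \<open>K\<close>. For coefficient
  functions and a complex \<open>K\<close> this is the span in the quotient by the face
  ideal.\<close>

definition span_on :: "'a set \<Rightarrow> ('a \<Rightarrow> real) set \<Rightarrow> ('a \<Rightarrow> real) set" where
  "span_on K B = {x. \<exists>w\<in>span B. \<forall>T\<in>K. x T = w T}"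

lemma subspace_span_on: "subspace (span_on K B)"
proof (rule subspaceI)
  show "0 \<in> span_on K B" unfolding span_on_def using span_zero by blast
next
  fix x y assume "x \<in> span_on K B" "y \<in> span_on K B"
  then obtain v w where "v \<in> span B" "w \<in> span B" "\<forall>T\<in>K. x T = v T" "\<forall>T\<in>K. y T = w T"
    unfolding span_on_def by blast
  then show "x + y \<in> span_on K B"
    unfolding span_on_def by (auto intro!: bexI[of _ "v + w"] span_add)
next
  fix c x assume "x \<in> span_on K B"
  then obtain v where "v \<in> span B" "\<forall>T\<in>K. x T = v T"
    unfolding span_on_def by blast
  then show "c *\<^sub>R x \<in> span_on K B"
    unfolding span_on_def by (auto intro!: bexI[of _ "c *\<^sub>R v"] span_scale simp: scaleR_fun_apply)
qed

lemma span_on_cong: "(\<And>T. T \<in> K \<Longrightarrow> x T = y T) \<Longrightarrow> x \<in> span_on K B \<longleftrightarrow> y \<in> span_on K B"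
  by (simp add: span_on_def)

lemma span_subset_span_on: "span B \<subseteq> span_on K B"
  unfolding span_on_def by blast

lemma span_on_base: "x \<in> B \<Longrightarrow> x \<in> span_on K B"
  using span_subset_span_on span_base by blast

lemma span_on_minimal:
  assumes "B \<subseteq> span_on K C"
  shows "span_on K B \<subseteq> span_on K C"
proof
  fix x assume "x \<in> span_on K B"
  then obtain w where w: "w \<in> span B" "\<forall>T\<in>K. x T = w T" unfolding span_on_def by blast
  have "w \<in> span_on K C" using w(1) span_minimal[OF assms subspace_span_on] by blast
  then show "x \<in> span_on K C" using span_on_cong[of K x w] w(2) by blast
qed

lemma span_on_mono: "B \<subseteq> C \<Longrightarrow> span_on K B \<subseteq> span_on K C"
  unfolding span_on_def using span_mono by blast

definition shifted_faces :: "nat \<Rightarrow> (nat \<Rightarrow> nat \<Rightarrow> real) \<Rightarrow> nat set set \<Rightarrow> nat set set" where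
  "shifted_faces n f K =
     {S. S \<subseteq> {1..n} \<and> minor f S \<notin> span_on K {minor f R | R. R \<subseteq> {1..n} \<and> lex_less R S}}"

section \<open>Reduction to the first rows\<close>

lemma minor_in_span_first_rows:
  assumes fr: "frame f U" and S: "finite S" "0 \<notin> S" "\<not> S \<subseteq> {1..card U}" and K: "K \<subseteq> Pow U"
  shows "minor f S \<in> span_on K {minor f R | R. R \<subseteq> {1..card U} \<and> lex_less R S}"
proof -
  let ?s = "card U"
  obtain e \<rho> where \<rho>: "linear \<rho>" "\<And>v. \<rho> v \<in> span (f ` {1..?s})" "\<And>v t. t \<in> U \<Longrightarrow> \<rho> v t = v t"
    using frame_projection[OF fr] by metis
  define L where "L = sorted_list_of_set S"
  have L: "set L = S" "distinct L" "length L = card S" using S by (auto simp: L_def)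
  \<comment> \<open>On \<open>U\<close> each late row agrees with its projection, which expands in
    the first rows. Early rows keep their own slot, so each index set in the expansion contains the
    small elements of \<open>S\<close> and replaces the large ones by smaller ones.\<close>
  define vs where "vs = map (\<lambda>q. if q \<le> ?s then f q else \<rho> (f q)) L"
  define As where "As = map (\<lambda>q. if q \<le> ?s then {q} else {1..?s}) L"
  have "list_all2 (\<lambda>v A. v \<in> span (f ` A)) vs As"
    unfolding vs_def As_def by (auto simp: list_all2_conv_all_nth \<rho>(2) simp del: One_nat_def intro: span_base)
  then have "wprod vs \<in> span {minor f (set ks) | ks. distinct ks \<and> list_all2 (\<in>) ks As}"
    by (rule wprod_in_span_minors)
  also have "\<dots> \<subseteq> span {minor f R | R. R \<subseteq> {1..?s} \<and> lex_less R S}"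
  proof (intro span_mono, clarify)
    fix ks assume ks: "distinct ks" "list_all2 (\<in>) ks As"
    have len: "length ks = length L" using ks(2) by (auto simp: As_def dest: list_all2_lengthD)
    have nth: "ks ! i \<in> (if L ! i \<le> ?s then {L ! i} else {1..?s})" if "i < length L" for i
      using list_all2_nthD2[OF ks(2), of i] that by (simp add: As_def)
    have sub: "set ks \<subseteq> {1..?s}"
    proof
      fix k assume "k \<in> set ks"
      then obtain i where i: "i < length L" "k = ks ! i" using len by (metis in_set_conv_nth)
      have "L ! i \<in> S" using i L(1) by auto
      then have "L ! i \<ge> 1" using S(2) by (metis One_nat_def Suc_leI gr0I)
      then show "k \<in> {1..?s}" using nth[OF i(1)] i(2) by (auto split: if_splits)
    qed
    have keep: "q \<in> set ks" if q: "q \<in> S" "q \<le> ?s" for q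
    proof -
      obtain i where i: "i < length L" "q = L ! i" using q(1) unfolding L(1) [symmetric] by (auto simp: in_set_conv_nth)
      then have "ks ! i = q" using nth[of i] q(2) by simp
      then show ?thesis using i len nth_mem[of i ks] by simp
    qed
    have "lex_less (set ks) S"
    proof (rule lex_lessI_replace)
      show "card (set ks) = card S" using ks(1) len L(3) by (simp add: distinct_card)
      show "set ks \<noteq> S" using sub S(3) by blast
      show "r < q" if "r \<in> set ks - S" "q \<in> S - set ks" for r q
        using that sub keep by (metis DiffD1 DiffD2 atLeastAtMost_iff not_less order_trans subsetD)
    qed (use S in auto)
    then show "\<exists>R. minor f (set ks) = minor f R \<and> R \<subseteq> {1..?s} \<and> lex_less R S"
      using sub by blast
  qed
  finally have "wprod vs \<in> span_on K {minor f R | R. R \<subseteq> {1..?s} \<and> lex_less R S}"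
    using span_subset_span_on by blast
  moreover have "minor f S T = wprod vs T" if "T \<in> K" for T
    unfolding minor_def vs_def L_def [symmetric]
    using that K by (intro wprod_cong) (auto simp: \<rho>(3) subset_iff)
  ultimately show ?thesis using span_on_cong by blast
qed

text \<open>A set that uses a row beyond \<open>card U\<close> depends on smaller sets of early
  rows, so it is never a shifted face. For the same reason such sets can be removed from the family
  of predecessors of any \<open>S\<close>, by transitivity of the order.\<close>

lemma shifted_faces_restrict_rows:
  assumes fr: "frame f U" and "card U \<le> n" and K: "K \<subseteq> Pow U"
  shows "shifted_faces n f K = shifted_faces (card U) f K"
proof -
  let ?s = "card U"
  let ?B = "\<lambda>n S. {minor f R | R. R \<subseteq> {1..n} \<and> lex_less R S}"
  have mono: "?B ?s S \<subseteq> ?B n S" for S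
    using \<open>card U \<le> n\<close> by force
  have red: "minor f S \<in> span_on K (?B ?s S)" if "S \<subseteq> {1..n}" "\<not> S \<subseteq> {1..?s}" for S
    using that by (intro minor_in_span_first_rows[OF fr _ _ _ K]) (auto intro: finite_subset)
  have eq: "span_on K (?B n S) = span_on K (?B ?s S)" if S: "S \<subseteq> {1..?s}" for S
  proof
    show "span_on K (?B ?s S) \<subseteq> span_on K (?B n S)" by (rule span_on_mono[OF mono])
    show "span_on K (?B n S) \<subseteq> span_on K (?B ?s S)"
    proof (rule span_on_minimal, clarify)
      fix R assume R: "R \<subseteq> {1..n}" "lex_less R S"
      show "minor f R \<in> span_on K (?B ?s S)"
      proof (cases "R \<subseteq> {1..?s}")
        case True
        then show ?thesis using R by (intro span_on_base) blast
      next
        case False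
        have "?B ?s R \<subseteq> ?B ?s S"
          using R S lex_less_trans by (blast intro: finite_subset[OF _ finite_atLeastAtMost])
        then show ?thesis using red[OF R(1) False] span_on_mono by blast
      qed
    qed
  qed
  have sub: "S \<subseteq> {1..?s}" if "S \<in> shifted_faces n f K" for S
    using that red[of S] span_on_mono[OF mono, of K S] unfolding shifted_faces_def by blast
  have "S \<in> shifted_faces n f K \<longleftrightarrow> S \<in> shifted_faces ?s f K" for S
  proof (cases "S \<subseteq> {1..?s}")
    case True
    then have "S \<subseteq> {1..n}" using \<open>card U \<le> n\<close> by force
    then show ?thesis
      using True eq[OF True] by (simp add: shifted_faces_def)
  next
    case False
    then have "S \<notin> shifted_faces ?s f K" by (simp add: shifted_faces_def)
    then show ?thesis using False sub by blast
  qed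
  then show ?thesis by blast
qed

text \<open>As simp rules, the pointwise definitions would rewrite unapplied sums of functions to
  abstractions.\<close>

lemmas fun_arith_apply = plus_fun_apply minus_apply uminus_apply zero_fun_apply scaleR_fun_apply sum_fun_apply
declare plus_fun_apply [simp del] minus_apply [simp del] uminus_apply [simp del] zero_fun_apply [simp del]

lemma lmul_vanish:
  assumes "\<And>j. j \<in> T \<Longrightarrow> u j = 0"
  shows "lmul u x T = 0"
  using assms by (simp add: lmul_def)

lemma linear_wprod_slot: "linear (\<lambda>v. wprod (us @ v # vs))"
  using linear_compose[OF linear_lmul_left[of "wprod vs"] linear_foldr_lmul[of us]]
  by (simp add: wprod_append comp_def)

text \<open>Modulo the elements in the conclusion, all rows may be projected onto the span of the first \<open>card \<sigma>\<close> rows,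
  where restriction to \<open>\<sigma>\<close> is injective; lexicographic initiality makes the correction terms
  stay inside the family.\<close>

lemma lmul_minors_vanishing_on_simplex:
  assumes fr: "frame f \<sigma>" and sn: "card \<sigma> \<le> n"
    and V: "subspace V" "\<And>i. i \<in> {1..n} \<Longrightarrow> f i \<in> V"
    and \<Q>: "\<And>Q. Q \<in> \<Q> \<Longrightarrow> Q \<subseteq> {1..n}"
      "\<And>Q R. Q \<in> \<Q> \<Longrightarrow> R \<subseteq> {1..n} \<Longrightarrow> lex_less R Q \<Longrightarrow> R \<in> \<Q>"
    and w: "w \<in> span {lmul v (minor f Q) | v Q. v \<in> V \<and> Q \<in> \<Q>}"
    and w0: "\<And>T. T \<subseteq> \<sigma> \<Longrightarrow> w T = 0"
  shows "w \<in> span {lmul u (minor f Q) | u Q. u \<in> V \<and> (\<forall>t\<in>\<sigma>. u t = 0) \<and> Q \<in> \<Q>}"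
proof -
  let ?s = "card \<sigma>"
  have fin: "finite \<sigma>" using fr by (simp add: frame_def)
  obtain \<rho> e where lin: "linear \<rho>" and \<rho>f: "\<And>v. \<rho> v \<in> span (f ` {1..?s})" and \<rho>e: "\<And>v. \<rho> v \<in> span (e ` \<sigma>)"
    and \<rho>val: "\<And>v t. t \<in> \<sigma> \<Longrightarrow> \<rho> v t = v t" and \<rho>fix: "\<And>v. v \<in> span (f ` {1..?s}) \<Longrightarrow> \<rho> v = v"
    and e: "\<And>t t'. t \<in> \<sigma> \<Longrightarrow> t' \<in> \<sigma> \<Longrightarrow> e t t' = (if t = t' then 1 else 0)"
  proof (rule frame_projection[OF fr], goal_cases)
    case (1 \<rho> e)
    show ?case by (rule 1(1)[OF 1(2-7)])
  qed
  define A where "A = span {lmul u (minor f Q) | u Q. u \<in> V \<and> (\<forall>t\<in>\<sigma>. u t = 0) \<and> Q \<in> \<Q>}"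
  have sA: "subspace A" by (simp add: A_def)
  have A_base: "lmul u (minor f Q) \<in> A" if "u \<in> V" "\<And>t. t \<in> \<sigma> \<Longrightarrow> u t = 0" "Q \<in> \<Q>" for u Q
    unfolding A_def using that by (intro span_base) blast
  have \<rho>V: "\<rho> v \<in> V" for v
  proof -
    have "span (f ` {1..?s}) \<subseteq> V" using V sn by (intro span_minimal) auto
    then show ?thesis using \<rho>f by blast
  qed
  have \<rho>row: "\<rho> (f k) = f k" if "k \<in> {1..?s}" for k
    using that by (intro \<rho>fix span_base imageI)
  have lm0: "lmul u 0 = 0" for u by (rule linear_0[OF linear_lmul_right])

  \<comment> \<open>The rows of \<open>minor f Q\<close> are projected from left to right;
    \<open>xs\<close> has already been treated. The error of one replacement contains the factor
    \<open>f q - \<rho> (f q)\<close>, which vanishes on \<open>\<sigma>\<close>. Moved to the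
    front, it plays the role of \<open>u\<close>, and \<open>i\<close> takes the place of
    \<open>q\<close> among the remaining factors.\<close>
  have swap: "lmul (f i) (wprod (us @ map f (q # ys))) - lmul (f i) (wprod (us @ \<rho> (f q) # map f ys)) \<in> A"
    if Q: "Q \<in> \<Q>" and i: "i \<in> {1..?s}" and L: "sorted_list_of_set Q = xs @ q # ys"
      and us: "us = map (\<lambda>x. \<rho> (f x)) xs" for i Q xs q ys us
  proof -
    have finQ: "finite Q" and Qn: "Q \<subseteq> {1..n}" using \<Q>(1)[OF Q] by (auto intro: finite_subset)
    have setQ: "Q = insert q (set xs \<union> set ys)" and dist: "distinct (xs @ q # ys)"
      using L finQ set_sorted_list_of_set[of Q] distinct_sorted_list_of_set[of Q] by auto
    have cardQ: "card Q = length xs + length ys + 1"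
      using dist setQ distinct_card[OF dist] by simp
    have q1: "q \<in> {1..n}" using setQ Qn by auto
    let ?u = "f q - \<rho> (f q)"
    have "lmul (f i) (wprod (us @ map f (q # ys))) - lmul (f i) (wprod (us @ \<rho> (f q) # map f ys))
      = lmul (f i) (wprod (us @ ?u # map f ys))"
      by (simp add: linear_diff[OF linear_wprod_slot] linear_diff[OF linear_lmul_right])
    also have "\<dots> \<in> A"
    proof (cases "q \<le> ?s")
      case True
      then have "?u = 0" using \<rho>row[of q] q1 by simp
      then show ?thesis
        by (simp add: linear_0[OF linear_wprod_slot] lm0 subspace_0[OF sA])
    next
      case False
      have uV: "?u \<in> V" using subspace_diff[OF V(1) V(2)[OF q1] \<rho>V] .
      have "lmul (f i) (wprod (us @ ?u # map f ys)) = (- 1) ^ Suc (length us) *\<^sub>R lmul ?u (wprod (f i # us @ map f ys))"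
        using wprod_move_to_front[of "f i # us" ?u "map f ys"] by simp
      moreover have "lmul ?u (wprod (f i # us @ map f ys)) \<in> A"
      proof -
        define As where "As = {i} # map (\<lambda>x. if x \<le> ?s then {x} else {1..?s}) xs @ map (\<lambda>y. {y}) ys"
        have "list_all2 (\<lambda>v A. v \<in> span (f ` A)) (f i # us @ map f ys) As"
          unfolding As_def us
        proof (intro list_all2_Cons[THEN iffD2] conjI list_all2_appendI)
          show "list_all2 (\<lambda>v A. v \<in> span (f ` A)) (map (\<lambda>x. \<rho> (f x)) xs)
              (map (\<lambda>x. if x \<le> ?s then {x} else {1..?s}) xs)"
            unfolding list_all2_conv_all_nth
          proof (intro conjI allI impI)
            fix k assume k: "k < length (map (\<lambda>x. \<rho> (f x)) xs)"
            have "xs ! k \<in> Q" using k setQ by auto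
            then have "\<rho> (f (xs ! k)) = f (xs ! k)" if "xs ! k \<le> ?s"
              using that Qn \<rho>row[of "xs ! k"] by auto
            then show "map (\<lambda>x. \<rho> (f x)) xs ! k \<in> span (f ` map (\<lambda>x. if x \<le> ?s then {x} else {1..?s}) xs ! k)"
              using k \<rho>f[of "f (xs ! k)"] by (auto intro: span_base simp del: One_nat_def)
          qed simp
        qed (auto simp: list_all2_conv_all_nth intro: span_base)
        then have "wprod (f i # us @ map f ys) \<in> span {minor f (set ks) | ks. distinct ks \<and> list_all2 (\<in>) ks As}"
          by (rule wprod_in_span_minors)
        then have "lmul ?u (wprod (f i # us @ map f ys)) \<in>
            span (lmul ?u ` {minor f (set ks) | ks. distinct ks \<and> list_all2 (\<in>) ks As})"
          unfolding linear_span_image[OF linear_lmul_right] by (rule imageI)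
        also have "\<dots> \<subseteq> A"
        proof (intro span_minimal sA, clarify)
          fix ks assume ks: "distinct ks" "list_all2 (\<in>) ks As"
          obtain ks1 ks2 where ks12: "ks = i # ks1 @ ks2"
            "list_all2 (\<in>) ks1 (map (\<lambda>x. if x \<le> ?s then {x} else {1..?s}) xs)"
            "list_all2 (\<in>) ks2 (map (\<lambda>y. {y}) ys)"
            using ks(2) unfolding As_def by (auto simp: list_all2_Cons2 list_all2_append2)
          have ks2: "ks2 = ys"
            using ks12(3) by (auto simp: list_all2_conv_all_nth intro: nth_equalityI)
          have len1: "length ks1 = length xs" using list_all2_lengthD[OF ks12(2)] by simp
          have nth1: "ks1 ! k \<in> (if xs ! k \<le> ?s then {xs ! k} else {1..?s})" if "k < length xs" for k
            using list_all2_nthD2[OF ks12(2), of k] that by simp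
          have keep: "x \<in> set ks1" if x: "x \<in> set xs" "x \<le> ?s" for x
          proof -
            obtain k where k: "k < length xs" "x = xs ! k" using x(1) by (auto simp: in_set_conv_nth)
            then have "ks1 ! k = x" using nth1[of k] x(2) by simp
            then show ?thesis using k len1 nth_mem[of k ks1] by simp
          qed
          have small: "x \<in> {1..?s}" if x: "x \<in> set ks1" for x
          proof -
            obtain k where k: "k < length xs" "x = ks1 ! k" using x len1 by (auto simp: in_set_conv_nth)
            have "xs ! k \<in> {1..n}" using k(1) setQ Qn by (auto simp: subset_iff)
            then show ?thesis using nth1[OF k(1)] k(2) by (auto split: if_splits)
          qed
          \<comment> \<open>If \<open>i\<close> were in \<open>Q\<close>, it would occur in
            \<open>xs\<close> or \<open>ys\<close>, because
            \<open>i \<le> card \<sigma> < q\<close>. Both small elements of \<open>xs\<close> and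
            all of \<open>ys\<close> survive in \<open>ks\<close>, so row \<open>i\<close> would be
            repeated.\<close>
          have iQ: "i \<notin> Q"
            using ks(1) i False keep setQ unfolding ks12(1) ks2 by auto
          have "lex_less (set ks) Q"
          proof (rule lex_lessI_replace)
            show "card (set ks) = card Q"
              using distinct_card[OF ks(1)] len1 cardQ unfolding ks12(1) ks2 by simp
            show "set ks \<noteq> Q" using iQ unfolding ks12(1) by auto
            \<comment> \<open>Every element gained is at most \<open>card \<sigma>\<close>; every
              element lost is \<open>q\<close> or a member of \<open>xs\<close> beyond
              \<open>card \<sigma>\<close>.\<close>
            show "r < p" if r: "r \<in> set ks - Q" and p: "p \<in> Q - set ks" for r p
            proof -
              have "r \<le> ?s" using r i small setQ unfolding ks12(1) ks2 by auto
              moreover have "p > ?s" using p False keep[of p] setQ unfolding ks12(1) ks2 by (auto simp: not_le [symmetric])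
              ultimately show ?thesis by simp
            qed
          qed (use finQ in auto)
          moreover have "set ks \<subseteq> {1..n}"
            using i small sn setQ Qn unfolding ks12(1) ks2 by force
          ultimately have "set ks \<in> \<Q>" using \<Q>(2)[OF Q] by blast
          then show "lmul ?u (minor f (set ks)) \<in> A"
            using uV \<rho>val by (intro A_base) (auto simp: fun_arith_apply)
        qed
        finally show ?thesis .
      qed
      ultimately show ?thesis by (metis subspace_scale[OF sA])
    qed
    finally show ?thesis .
  qed

  have project_minor: "lmul (f i) (minor f Q) - lmul (f i) (wprod (map (\<lambda>q. \<rho> (f q)) (sorted_list_of_set Q))) \<in> A"
    if Q: "Q \<in> \<Q>" and i: "i \<in> {1..?s}" for i Q
  proof -
    have "lmul (f i) (wprod (map (\<lambda>x. \<rho> (f x)) xs @ map f ys)) -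
        lmul (f i) (wprod (map (\<lambda>q. \<rho> (f q)) (xs @ ys))) \<in> A"
      if "sorted_list_of_set Q = xs @ ys" for xs ys
      using that
    proof (induction ys arbitrary: xs)
      case Nil
      then show ?case using subspace_0[OF sA] by simp
    next
      case (Cons q ys)
      let ?us = "map (\<lambda>x. \<rho> (f x)) xs"
      have "lmul (f i) (wprod (?us @ map f (q # ys))) - lmul (f i) (wprod (?us @ \<rho> (f q) # map f ys)) \<in> A"
        using swap[OF Q i Cons.prems refl] .
      moreover have "lmul (f i) (wprod (?us @ \<rho> (f q) # map f ys)) -
          lmul (f i) (wprod (map (\<lambda>q. \<rho> (f q)) (xs @ q # ys))) \<in> A"
        using Cons.IH[of "xs @ [q]"] Cons.prems by simp
      ultimately show ?case
        by (drule_tac subspace_add[OF sA]) (assumption, simp)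
    qed
    from this[of "[]"] show ?thesis by (simp add: minor_def)
  qed

  \<comment> \<open>The fully projected products lie in \<open>Y\<close>, and an element of
    \<open>Y\<close> is determined by its values on subsets of \<open>\<sigma>\<close>.\<close>
  define Y where "Y = span {minor e R | R. R \<subseteq> \<sigma>}"
  \<comment> \<open>First the factor \<open>v\<close> is projected, then the rows of
    \<open>minor f Q\<close>. After the first step the multiplier is a combination of the first
    rows, which is why \<open>project_minor\<close> treats only those.\<close>
  have split: "\<exists>a\<in>A. \<exists>y\<in>Y. lmul v (minor f Q) = a + y" if v: "v \<in> V" and Q: "Q \<in> \<Q>" for v Q
  proof -
    let ?W = "wprod (map (\<lambda>q. \<rho> (f q)) (sorted_list_of_set Q))"
    have "lmul (v - \<rho> v) (minor f Q) \<in> A"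
      using v Q \<rho>V V(1) \<rho>val by (intro A_base subspace_diff) (auto simp: fun_arith_apply)
    then have 1: "lmul v (minor f Q) - lmul (\<rho> v) (minor f Q) \<in> A"
      by (simp only: linear_diff[OF linear_lmul_left])
    have 2: "lmul x (minor f Q) - lmul x ?W \<in> A" if "x \<in> span (f ` {1..?s})" for x
      using that
    proof (rule span_induct[where P = "\<lambda>x. lmul x (minor f Q) - lmul x ?W \<in> A"])
      have "linear (\<lambda>x. lmul x (minor f Q) - lmul x ?W)"
        by (intro linear_compose_sub linear_lmul_left)
      from linear_subspace_vimage[OF this sA]
      show "subspace {x. lmul x (minor f Q) - lmul x ?W \<in> A}" by (simp add: vimage_def)
    qed (use project_minor[OF Q] in blast)
    have 3: "lmul (\<rho> v) ?W \<in> Y"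
    proof -
      let ?vs = "\<rho> v # map (\<lambda>q. \<rho> (f q)) (sorted_list_of_set Q)"
      have "wprod ?vs \<in> span {minor e (set ks) | ks. distinct ks \<and> list_all2 (\<in>) ks (map (\<lambda>_. \<sigma>) ?vs)}"
        by (intro wprod_in_span_minors) (auto simp: list_all2_conv_all_nth nth_Cons \<rho>e split: nat.split)
      also have "\<dots> \<subseteq> Y"
        unfolding Y_def
      proof (intro span_mono, clarify)
        fix ks assume "list_all2 (\<in>) ks (map (\<lambda>_. \<sigma>) ?vs)"
        then have "set ks \<subseteq> \<sigma>" by (auto simp: list_all2_conv_all_nth in_set_conv_nth simp del: list.map)
        then show "\<exists>R. minor e (set ks) = minor e R \<and> R \<subseteq> \<sigma>" by blast
      qed
      finally show ?thesis by simp
    qed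
    have "lmul v (minor f Q) - lmul (\<rho> v) ?W \<in> A"
      using subspace_add[OF sA 1 2[OF \<rho>f[of v]]] by simp
    then show ?thesis using 3 by (intro bexI[of _ "lmul v (minor f Q) - lmul (\<rho> v) ?W"] bexI[of _ "lmul (\<rho> v) ?W"]) auto
  qed
  have "{lmul v (minor f Q) | v Q. v \<in> V \<and> Q \<in> \<Q>} \<subseteq> {a + y | a y. a \<in> A \<and> y \<in> Y}"
    using split by blast
  then have "w \<in> {a + y | a y. a \<in> A \<and> y \<in> Y}"
    using w span_minimal[OF _ subspace_sums[OF sA, of Y]] unfolding Y_def by blast
  then obtain a y where ay: "w = a + y" "a \<in> A" "y \<in> Y" by blast
  \<comment> \<open>Elements of \<open>A\<close> have a factor vanishing on \<open>\<sigma>\<close>.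
    Hence \<open>y\<close> inherits the vanishing of \<open>w\<close>, and its expansion in the
    products of the \<open>e t\<close> has only zero coefficients.\<close>
  have "a T = 0" if "T \<subseteq> \<sigma>" for T
    using ay(2) unfolding A_def
  proof (rule span_induct[where P = "\<lambda>a. a T = 0"])
    show "subspace {a. a T = (0::real)}"
      by (rule subspaceI) (auto simp: fun_arith_apply)
  qed (use that in \<open>auto intro!: lmul_vanish\<close>)
  then have y0: "y T = 0" if "T \<subseteq> \<sigma>" for T using w0[OF that] ay(1) that by (simp add: fun_arith_apply)
  have "y = (\<Sum>R\<in>Pow \<sigma>. y R *\<^sub>R minor e R)"
    using ay(3) unfolding Y_def
  proof (rule span_induct[where P = "\<lambda>y. y = (\<Sum>R\<in>Pow \<sigma>. y R *\<^sub>R minor e R)"])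
    have "linear (\<lambda>y. y - (\<Sum>R\<in>Pow \<sigma>. y R *\<^sub>R minor e R))"
      by (rule linearI) (auto simp: fun_eq_iff fun_arith_apply algebra_simps sum.distrib scaleR_right.sum)
    from linear_subspace_kernel[OF this]
    show "subspace {y. y = (\<Sum>R\<in>Pow \<sigma>. y R *\<^sub>R minor e R)}" by simp
  next
    fix x assume "x \<in> {minor e R | R. R \<subseteq> \<sigma>}"
    then obtain R where R: "R \<subseteq> \<sigma>" "x = minor e R" by blast
    have "(\<Sum>R'\<in>Pow \<sigma>. x R' *\<^sub>R minor e R') = (\<Sum>R'\<in>Pow \<sigma>. if R' = R then minor e R' else 0)"
      unfolding R(2) using R(1) fin by (intro sum.cong refl) (auto simp: minor_unit[OF fin R(1) _ e])
    then show "x = (\<Sum>R\<in>Pow \<sigma>. x R *\<^sub>R minor e R)" using R fin by simp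
  qed
  also have "\<dots> = 0" using y0 by (intro sum.neutral) simp
  finally have "y = 0" .
  then show ?thesis using ay unfolding A_def by simp
qed

section \<open>The gluing formula\<close>

definition vecs :: "nat \<Rightarrow> (nat \<Rightarrow> real) set" where
  "vecs n = {v. \<forall>j. j \<notin> {1..n} \<longrightarrow> v j = 0}"

lemma subspace_vecs: "subspace (vecs n)"
  by (rule subspaceI) (auto simp: vecs_def fun_arith_apply)

text \<open>The generators of the space W of the overview. The multiplier ranges over the whole
  space, and the index sets are collected in a set, to fit
  \<open>lmul_minors_vanishing_on_simplex\<close>.\<close>

definition lower_products :: "nat \<Rightarrow> (nat \<Rightarrow> nat \<Rightarrow> real) \<Rightarrow> nat set \<Rightarrow> (nat set \<Rightarrow> real) set" where
  "lower_products n f S = {lmul v (minor f Q) | v Q. v \<in> vecs n \<and> Q \<in> {Q. Q \<subseteq> {1..n} \<and> lex_less Q S}}"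

text \<open>The space \<open>N\<^sub>K\<close> of the introduction.\<close>

definition annih :: "nat \<Rightarrow> (nat \<Rightarrow> nat \<Rightarrow> real) \<Rightarrow> nat set set \<Rightarrow> nat set \<Rightarrow> (nat \<Rightarrow> real) set" where
  "annih n f K S = {v \<in> vecs n. lmul v (minor f S) \<in> span_on K (lower_products n f S)}"

lemma subspace_annih: "subspace (annih n f K S)"
proof -
  have "annih n f K S = vecs n \<inter> (\<lambda>v. lmul v (minor f S)) -` span_on K (lower_products n f S)"
    by (auto simp: annih_def)
  then show ?thesis
    using subspace_inter subspace_vecs linear_subspace_vimage[OF linear_lmul_left subspace_span_on]
    by metis
qed

definition extensions :: "nat \<Rightarrow> (nat \<Rightarrow> nat \<Rightarrow> real) \<Rightarrow> nat set set \<Rightarrow> nat set \<Rightarrow> nat set" where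
  "extensions n f K S = {t \<in> {1..n}. (\<forall>s\<in>S. s < t) \<and> insert t S \<in> shifted_faces n f K}"

section \<open>Extensions of a set as a codimension\<close>

context
  fixes n :: nat and f :: "nat \<Rightarrow> nat \<Rightarrow> real"
  assumes rows: "\<And>i. i \<in> {1..n} \<Longrightarrow> f i \<in> vecs n"
    and frame_all: "frame f {1..n}"
begin

lemma vecs_eq_span: "vecs n = span (f ` {1..n})"
proof
  show "span (f ` {1..n}) \<subseteq> vecs n"
    using rows by (intro span_minimal subspace_vecs) auto
  show "vecs n \<subseteq> span (f ` {1..n})"
  proof
    fix v assume v: "v \<in> vecs n"
    obtain \<rho> where \<rho>: "\<And>v. \<rho> v \<in> span (f ` {1..n})" "\<And>v t. t \<in> {1..n} \<Longrightarrow> \<rho> v t = v t"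
      using frame_projection[OF frame_all] by (metis card_atLeastAtMost diff_Suc_1)
    have "\<rho> v \<in> vecs n" using \<rho>(1) \<open>span (f ` {1..n}) \<subseteq> vecs n\<close> by blast
    then have "\<rho> v j = v j" for j
      using v \<rho>(2)[of j v] by (cases "j \<in> {1..n}") (auto simp: vecs_def)
    then have "\<rho> v = v" by blast
    then show "v \<in> span (f ` {1..n})" using \<rho>(1) by metis
  qed
qed

text \<open>Take the maximum away from a set preceding \<open>insert t S\<close>: what remains
  either precedes \<open>S\<close>, or is \<open>S\<close> itself and the maximum is below
  \<open>t\<close>. Conversely, adding any new index to a set preceding \<open>S\<close> gives a set
  preceding \<open>insert t S\<close>, as \<open>t\<close> lies above \<open>S\<close>. The two
  generating families thus match up to signs, zeros and expansion of the multiplier in rows.\<close>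

lemma span_on_lower_minors:
  assumes S: "S \<subseteq> {1..n}" and t: "t \<in> {1..n}" "\<forall>s\<in>S. s < t"
  shows "span_on K {minor f R | R. R \<subseteq> {1..n} \<and> lex_less R (insert t S)} =
    span_on K (lower_products n f S \<union> (\<lambda>i. lmul (f i) (minor f S)) ` {1..<t})"
    (is "span_on K ?B = span_on K ?C")
proof
  have finS: "finite S" and tS: "t \<notin> S" using S t finite_subset by auto
  have sgn: "c *\<^sub>R x \<in> span_on K B" if "x \<in> span_on K B" for c x and B :: "(nat set \<Rightarrow> real) set"
    using that subspace_scale[OF subspace_span_on] by blast
  show "span_on K ?B \<subseteq> span_on K ?C"
  proof (rule span_on_minimal, clarify)
    fix R assume R: "R \<subseteq> {1..n}" and less: "lex_less R (insert t S)"
    have finR: "finite R" using R finite_subset by blast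
    obtain p where p: "p \<in> R" "p \<notin> insert t S" "\<And>q. q < p \<Longrightarrow> q \<in> R \<longleftrightarrow> q \<in> insert t S"
      and cardR: "card R = Suc (card S)"
      using less finR finS tS by (auto simp: lex_less_iff)
    define m where "m = Max R"
    define Q where "Q = R - {m}"
    have "R \<noteq> {}" using p(1) by blast
    then have m: "m \<in> R" "\<And>r. r \<in> R \<Longrightarrow> r \<le> m"
      using Max_in[OF finR] Max_ge[OF finR] unfolding m_def by blast+
    have RQ: "R = insert m Q" "m \<notin> Q" "finite Q" "Q \<subseteq> {1..n}" "card Q = card S"
      using m(1) finR R cardR unfolding Q_def by auto
    have Qm: "q < m" if "q \<in> Q" for q using that m(2)[of q] unfolding Q_def by auto
    obtain c :: real where c: "c \<in> {1, -1}" "lmul (f m) (minor f Q) = c *\<^sub>R minor f R"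
      using lmul_minor_insert[OF RQ(3,2)] RQ(1) by metis
    then have eq: "minor f R = c *\<^sub>R lmul (f m) (minor f Q)" by auto
    have "lmul (f m) (minor f Q) \<in> ?C"
    proof (cases "Q = S")
      case True
      then have "m = p" using p RQ by auto
      have "p < t"
      proof (rule ccontr)
        assume "\<not> p < t"
        then have "t \<in> R" using p by (metis insertI1 linorder_neqE_nat)
        then show False using True RQ(1) tS \<open>m = p\<close> p(2) by auto
      qed
      then show ?thesis using True \<open>m = p\<close> m(1) R by (intro UnI2) auto
    next
      case False
      \<comment> \<open>If \<open>p\<close> were the maximum of \<open>R\<close>, then
        \<open>Q\<close> would be contained in \<open>insert t S\<close>. Being different from
        \<open>S\<close>, it would contain \<open>t\<close>, so \<open>t < p\<close>; this forces
        all of \<open>S\<close> into \<open>Q\<close> as well, contradicting its size.\<close>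
      have pQ: "p \<in> Q"
      proof (rule ccontr)
        assume "p \<notin> Q"
        then have "p = m" using p(1) RQ(1) by auto
        then have "Q \<subseteq> insert t S" using Qm p(3) RQ(1) by auto
        have "Q \<noteq> S" by (fact False)
        then have "t \<in> Q" using \<open>Q \<subseteq> insert t S\<close> RQ(5) finS card_subset_eq by (metis subset_insert)
        then have "t < p" using Qm \<open>p = m\<close> by auto
        then have "insert t S \<subseteq> R" using p(3) t(2) by (auto dest: less_trans)
        then have "S \<subseteq> Q" using RQ(1) t(2) \<open>t < p\<close> \<open>p = m\<close> by (metis insertE insert_subset less_asym subsetD subsetI)
        then show False using False RQ(3,5) card_subset_eq by metis
      qed
      have "p < t"
      proof (rule ccontr)
        assume "\<not> p < t"
        then have "t < p" using p(2) by auto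
        then have "insert t S \<subseteq> R" using p(3) t(2) by (auto dest: less_trans)
        then have "insert t S = R" using cardR finS finR tS by (intro card_subset_eq) auto
        then show False using p by blast
      qed
      then have "lex_less Q S"
        using pQ p RQ(3,5) finS Qm RQ(1)
        by (subst lex_less_iff) (auto intro!: bexI[of _ p] dest: less_trans)
      then show ?thesis
        using rows[of m] m(1) R RQ(4) unfolding lower_products_def by blast
    qed
    then show "minor f R \<in> span_on K ?C"
      unfolding eq by (intro sgn span_on_base)
  qed
  have insert_less: "minor f (insert i Q) \<in> span_on K ?B"
    if "Q \<subseteq> {1..n}" "i \<in> {1..n}" "i \<notin> Q" "lex_less Q S \<or> Q = S \<and> i < t" for Q i
  proof -
    have finQ: "finite Q" using that finite_subset by auto
    have "lex_less (insert i Q) (insert t S)"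
      using that(4)
    proof
      assume "lex_less Q S"
      then obtain p where p: "p \<in> Q" "p \<notin> S" "\<And>q. q < p \<Longrightarrow> q \<in> Q \<longleftrightarrow> q \<in> S" and cQ: "card Q = card S"
        using finQ finS by (auto simp: lex_less_iff)
      have "\<not> S \<subseteq> Q" using card_subset_eq[OF finQ] cQ p by metis
      then obtain s where s: "s \<in> S" "s \<notin> Q" by blast
      \<comment> \<open>Some \<open>s\<close> in \<open>S\<close> is missing from \<open>Q\<close>,
        so it is not below the first difference \<open>p\<close>; and \<open>s < t\<close>.\<close>
      have "p < t" using s p(3)[of s] t(2) by (cases "s < p") auto
      have "i \<noteq> p" using p(1) that(3) by blast
      then have "\<exists>p\<in>insert i Q - insert t S. \<forall>q<p. q \<in> insert i Q \<longleftrightarrow> q \<in> insert t S"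
      proof (cases "i < p")
        case True
        then have "i \<notin> S" using p(3) that(3) by blast
        then show ?thesis using p(3) True \<open>p < t\<close> by (intro bexI[of _ i]) auto
      next
        case False
        then show ?thesis using p \<open>p < t\<close> \<open>i \<noteq> p\<close> by (intro bexI[of _ p]) auto
      qed
      then show ?thesis
        using that(3) cQ finQ finS tS by (simp add: lex_less_iff)
    next
      assume "Q = S \<and> i < t"
      then show ?thesis
        using that(3) finS tS by (subst lex_less_iff) (auto intro!: bexI[of _ i])
    qed
    then show ?thesis using that(1,2) by (intro span_on_base) blast
  qed
  have lmul_mem: "lmul (f i) (minor f Q) \<in> span_on K ?B"
    if "Q \<subseteq> {1..n}" "i \<in> {1..n}" "lex_less Q S \<or> Q = S \<and> i < t" for Q i
  proof (cases "i \<in> Q")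
    case True
    have "finite Q" using that(1) finite_subset by blast
    then show ?thesis
      unfolding lmul_minor_mem[OF \<open>finite Q\<close> True] by (intro subspace_0 subspace_span_on)
  next
    case False
    have "finite Q" using that(1) finite_subset by blast
    then obtain c :: real where c: "lmul (f i) (minor f Q) = c *\<^sub>R minor f (insert i Q)"
      using lmul_minor_insert[OF _ False] by blast
    show ?thesis unfolding c by (rule sgn[OF insert_less[OF that(1,2) False that(3)]])
  qed
  show "span_on K ?C \<subseteq> span_on K ?B"
  proof (intro span_on_minimal Un_least)
    show "lower_products n f S \<subseteq> span_on K ?B"
      unfolding lower_products_def
    proof clarify
      fix v Q assume v: "v \<in> vecs n" and Q: "Q \<subseteq> {1..n}" "lex_less Q S"
      have "v \<in> span (f ` {1..n})" using v vecs_eq_span by blast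
      then show "lmul v (minor f Q) \<in> span_on K ?B"
      proof (rule span_induct[where P = "\<lambda>v. lmul v (minor f Q) \<in> span_on K ?B"])
        show "subspace {v. lmul v (minor f Q) \<in> span_on K ?B}"
          using linear_subspace_vimage[OF linear_lmul_left subspace_span_on] by (simp add: vimage_def)
      qed (use lmul_mem Q in blast)
    qed
    show "(\<lambda>i. lmul (f i) (minor f S)) ` {1..<t} \<subseteq> span_on K ?B"
      using lmul_mem[OF S] t(1) by force
  qed
qed

text \<open>Pull the dependence back along multiplication by the minor of \<open>S\<close>. The
  preimage of the span of lower products on \<open>K\<close> is \<open>annih\<close>, and the
  remaining generators are images of the rows before \<open>t\<close>.\<close>

lemma insert_mem_shifted_faces_iff:
  assumes S: "S \<subseteq> {1..n}" and t: "t \<in> {1..n}" "\<forall>s\<in>S. s < t"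
  shows "insert t S \<in> shifted_faces n f K \<longleftrightarrow> f t \<notin> span (annih n f K S \<union> f ` {1..<t})"
proof -
  let ?W = "lower_products n f S" and ?m = "minor f S"
  let ?G = "(\<lambda>i. lmul (f i) ?m) ` {1..<t}"
  have "finite S" "t \<notin> S" using S t finite_subset by auto
  then obtain c :: real where c: "c \<in> {1, -1}" "lmul (f t) ?m = c *\<^sub>R minor f (insert t S)"
    using lmul_minor_insert by blast
  have G: "span ?G = (\<lambda>v. lmul v ?m) ` span (f ` {1..<t})"
    using linear_span_image[OF linear_lmul_left, of ?m "f ` {1..<t}"] by (simp add: image_image)
  have "minor f (insert t S) = c *\<^sub>R lmul (f t) ?m" using c by auto
  then have "minor f (insert t S) \<in> span_on K (?W \<union> ?G) \<longleftrightarrow> lmul (f t) ?m \<in> span_on K (?W \<union> ?G)"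
    using c subspace_scale[OF subspace_span_on] by metis
  also have "\<dots> \<longleftrightarrow> f t \<in> span (annih n f K S \<union> f ` {1..<t})"
  proof
    assume "lmul (f t) ?m \<in> span_on K (?W \<union> ?G)"
    then obtain w g where w: "w \<in> span ?W" "g \<in> span ?G" "\<And>T. T \<in> K \<Longrightarrow> lmul (f t) ?m T = (w + g) T"
      unfolding span_on_def span_Un by blast
    then obtain u where u: "u \<in> span (f ` {1..<t})" "g = lmul u ?m" unfolding G by blast
    have "span (f ` {1..<t}) \<subseteq> vecs n"
      using rows t(1) by (intro span_minimal subspace_vecs) auto
    then have "f t - u \<in> vecs n" using u(1) rows[OF t(1)] subspace_diff[OF subspace_vecs] by blast
    moreover have "lmul (f t - u) ?m \<in> span_on K ?W"
      unfolding span_on_def linear_diff[OF linear_lmul_left]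
      using w u by (auto intro!: bexI[of _ w] simp: fun_arith_apply)
    ultimately have "f t - u \<in> span (annih n f K S)" by (auto simp: annih_def intro: span_base)
    then have "(f t - u) + u \<in> span (annih n f K S \<union> f ` {1..<t})"
      unfolding span_Un using u(1) by blast
    then show "f t \<in> span (annih n f K S \<union> f ` {1..<t})" by simp
  next
    assume "f t \<in> span (annih n f K S \<union> f ` {1..<t})"
    then obtain a u where au: "f t = a + u" "a \<in> span (annih n f K S)" "u \<in> span (f ` {1..<t})"
      unfolding span_Un by blast
    have "a \<in> annih n f K S" using au(2) span_eq_iff subspace_annih by blast
    then have "lmul a ?m \<in> span_on K (?W \<union> ?G)"
      using span_on_mono[of ?W "?W \<union> ?G" K] by (auto simp: annih_def)
    moreover have "lmul u ?m \<in> span_on K (?W \<union> ?G)"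
      using au(3) G span_subset_span_on[of "?W \<union> ?G" K] span_mono[of ?G "?W \<union> ?G"] by blast
    ultimately show "lmul (f t) ?m \<in> span_on K (?W \<union> ?G)"
      unfolding au(1) linear_add[OF linear_lmul_left] by (rule subspace_add[OF subspace_span_on])
  qed
  finally have "minor f (insert t S) \<in> span_on K {minor f R | R. R \<subseteq> {1..n} \<and> lex_less R (insert t S)} \<longleftrightarrow>
      f t \<in> span (annih n f K S \<union> f ` {1..<t})"
    unfolding span_on_lower_minors[OF S t] .
  moreover have "insert t S \<subseteq> {1..n}" using S t(1) by blast
  ultimately show ?thesis unfolding shifted_faces_def by (simp del: One_nat_def)
qed

text \<open>If \<open>t\<close> is in \<open>S\<close>, the product is zero. Otherwise exchanging
  the maximum \<open>m\<close> of \<open>S\<close> for \<open>t\<close> gives a smaller set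
  \<open>Q\<close>, and multiplying row \<open>t\<close> into \<open>S\<close> is, up to sign,
  multiplying row \<open>m\<close> into \<open>Q\<close>.\<close>

lemma row_mem_annih:
  assumes S: "S \<subseteq> {1..n}" and t: "t \<in> {1..n}" "s \<in> S" "t \<le> s"
  shows "f t \<in> annih n f K S"
proof -
  have finS: "finite S" using S finite_subset by blast
  have "lmul (f t) (minor f S) \<in> span (lower_products n f S)"
  proof (cases "t \<in> S")
    case True
    then show ?thesis using lmul_minor_mem[OF finS True, of f] span_zero by metis
  next
    case False
    define m where "m = Max S"
    have m: "m \<in> S" "t < m"
      using t finS False Max_ge[OF finS t(2)] unfolding m_def
      by (auto simp: le_less intro: Max_in)
    define Q where "Q = insert t (S - {m})"
    have Q: "m \<notin> Q" "finite Q" "Q \<subseteq> {1..n}" "insert m Q = insert t S"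
      using m S t finS unfolding Q_def by auto
    obtain c where c: "lmul (f t) (minor f S) = c *\<^sub>R minor f (insert t S)"
      using lmul_minor_insert[OF finS False] by blast
    obtain d where d: "d \<in> {1, -1}" "lmul (f m) (minor f Q) = d *\<^sub>R minor f (insert t S)"
      using lmul_minor_insert[OF Q(2,1)] Q(4) by metis
    have "lex_less Q S"
    proof (rule lex_lessI_replace)
      show "card Q = card S" using False card_Suc_Diff1[OF finS m(1)] finS unfolding Q_def by simp
    qed (use Q m False finS in \<open>auto simp: Q_def\<close>)
    then have "lmul (f m) (minor f Q) \<in> span (lower_products n f S)"
      using rows[of m] Q(3) S m(1) unfolding lower_products_def by (intro span_base) blast
    moreover have "lmul (f t) (minor f S) = (c * d) *\<^sub>R lmul (f m) (minor f Q)"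
      using c d by auto
    ultimately show ?thesis by (metis span_scale)
  qed
  then show ?thesis
    using rows[OF t(1)] span_subset_span_on unfolding annih_def by blast
qed

lemma extensions_eq:
  assumes S: "S \<subseteq> {1..n}"
  shows "extensions n f K S = {t \<in> {1..n}. f t \<notin> span (annih n f K S \<union> f ` {1..<t})}"
proof -
  have "(\<forall>s\<in>S. s < t) \<and> insert t S \<in> shifted_faces n f K \<longleftrightarrow> f t \<notin> span (annih n f K S \<union> f ` {1..<t})"
    if t: "t \<in> {1..n}" for t
  proof (cases "\<forall>s\<in>S. s < t")
    case True
    then show ?thesis using insert_mem_shifted_faces_iff[OF S t True] by blast
  next
    case False
    then obtain s where "s \<in> S" "t \<le> s" by (auto simp: not_less)
    then have "f t \<in> span (annih n f K S \<union> f ` {1..<t})"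
      using row_mem_annih[OF S t] by (intro span_base) blast
    then show ?thesis using False by blast
  qed
  then show ?thesis unfolding extensions_def by blast
qed

section \<open>Annihilators of a gluing along a simplex\<close>

context
  fixes K L :: "nat set set" and \<sigma> A B S :: "nat set"
  assumes fr: "frame f \<sigma>" and cardn: "card \<sigma> \<le> n"
    and KA: "K \<subseteq> Pow A" and LB: "L \<subseteq> Pow B" and AB: "A \<inter> B \<subseteq> \<sigma>" and KL: "K \<inter> L = Pow \<sigma>"
    and S: "S \<subseteq> {1..n}"
begin

lemma lower_closed:
  assumes "Q \<in> {Q. Q \<subseteq> {1..n} \<and> lex_less Q S}" "R \<subseteq> {1..n}" "lex_less R Q"
  shows "R \<in> {Q. Q \<subseteq> {1..n} \<and> lex_less Q S}"
proof -
  have "finite R" "finite Q" "finite S"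
    using assms S by (auto intro: finite_subset[OF _ finite_atLeastAtMost])
  then show ?thesis using assms lex_less_trans[of R Q S] by blast
qed

text \<open>Coordinates in \<open>A\<close> go to \<open>b\<close> and the others to
  \<open>a\<close>. A coordinate in both \<open>A\<close> and \<open>B\<close> lies in
  \<open>\<sigma>\<close>, where \<open>u\<close> is zero.\<close>

lemma split_vanishing:
  assumes "u \<in> vecs n" "\<forall>t\<in>\<sigma>. u t = 0"
  shows "\<exists>a\<in>vecs n. \<exists>b\<in>vecs n. u = a + b \<and> (\<forall>t\<in>A. a t = 0) \<and> (\<forall>t\<in>B. b t = 0)"
proof -
  define a where "a = (\<lambda>j. if j \<in> A then 0 else u j)"
  have a: "a \<in> vecs n" using assms by (auto simp: a_def vecs_def)
  then have "u - a \<in> vecs n" using assms(1) subspace_diff[OF subspace_vecs] by blast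
  moreover have "(u - a) t = 0" if "t \<in> B" for t
    using that AB assms(2) by (auto simp: a_def fun_arith_apply)
  ultimately show ?thesis
    using a by (intro bexI[of _ a] bexI[of _ "u - a"]) (auto simp: a_def)
qed

text \<open>Split the first factor of each generator by \<open>split_vanishing\<close>; a product
  whose factor vanishes on \<open>A\<close> vanishes on all of \<open>K\<close>, and likewise for
  \<open>B\<close> and \<open>L\<close>.\<close>

lemma vanishing_products_split:
  assumes "x \<in> span {lmul u (minor f Q) | u Q. u \<in> vecs n \<and> (\<forall>t\<in>\<sigma>. u t = 0) \<and> Q \<in> {Q. Q \<subseteq> {1..n} \<and> lex_less Q S}}"
  shows "\<exists>a\<in>span (lower_products n f S). \<exists>b\<in>span (lower_products n f S).
    x = a + b \<and> (\<forall>T\<in>K. a T = 0) \<and> (\<forall>T\<in>L. b T = 0)"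
proof -
  let ?P = "\<lambda>H. {x \<in> span (lower_products n f S). \<forall>T\<in>H. x T = 0}"
  have sub: "subspace (?P H)" for H
    by (rule subspaceI) (auto simp: fun_arith_apply span_zero span_add span_scale)
  have "x \<in> {a + b | a b. a \<in> ?P K \<and> b \<in> ?P L}"
  proof (rule subsetD[OF span_minimal[OF _ subspace_sums[OF sub sub]] assms], clarify)
    fix u Q assume u: "u \<in> vecs n" "\<forall>t\<in>\<sigma>. u t = 0" and Q: "Q \<subseteq> {1..n}" "lex_less Q S"
    obtain a b where ab: "u = a + b" "a \<in> vecs n" "b \<in> vecs n" "\<forall>t\<in>A. a t = 0" "\<forall>t\<in>B. b t = 0"
      using split_vanishing[OF u] by blast
    have "lmul a (minor f Q) T = 0" if "T \<in> K" for T
      using that KA ab(4) by (intro lmul_vanish) blast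
    moreover have "lmul b (minor f Q) T = 0" if "T \<in> L" for T
      using that LB ab(5) by (intro lmul_vanish) blast
    moreover have "lmul a (minor f Q) \<in> span (lower_products n f S)" "lmul b (minor f Q) \<in> span (lower_products n f S)"
      unfolding lower_products_def using ab(2,3) Q by (intro span_base; blast)+
    ultimately have "lmul a (minor f Q) \<in> ?P K" "lmul b (minor f Q) \<in> ?P L" by blast+
    then show "\<exists>a b. lmul u (minor f Q) = a + b \<and> a \<in> ?P K \<and> b \<in> ?P L"
      unfolding ab(1) linear_add[OF linear_lmul_left] by blast
  qed
  then show ?thesis by blast
qed

text \<open>Let \<open>w\<close> and \<open>w'\<close> represent the product on \<open>K\<close> and
  on \<open>L\<close>. They agree on \<open>\<sigma>\<close>, so \<open>w - w' = a + b\<close> with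
  \<open>a\<close> vanishing on \<open>K\<close> and \<open>b\<close> on \<open>L\<close>. Then
  \<open>w - a = w' + b\<close> represents the product on both complexes at once.\<close>

lemma annih_Un: "annih n f (K \<union> L) S = annih n f K S \<inter> annih n f L S"
proof
  show "annih n f (K \<union> L) S \<subseteq> annih n f K S \<inter> annih n f L S"
    by (auto simp: annih_def span_on_def)
  show "annih n f K S \<inter> annih n f L S \<subseteq> annih n f (K \<union> L) S"
  proof
    fix v assume v: "v \<in> annih n f K S \<inter> annih n f L S"
    then obtain w w' where w: "w \<in> span (lower_products n f S)" "\<And>T. T \<in> K \<Longrightarrow> lmul v (minor f S) T = w T"
      and w': "w' \<in> span (lower_products n f S)" "\<And>T. T \<in> L \<Longrightarrow> lmul v (minor f S) T = w' T"
      by (auto simp: annih_def span_on_def)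
    have "w - w' \<in> span (lower_products n f S)" using w w' by (intro span_diff)
    moreover have "(w - w') T = 0" if "T \<subseteq> \<sigma>" for T
    proof -
      have "T \<in> K" "T \<in> L" using that KL by blast+
      then show ?thesis using w(2)[of T] w'(2)[of T] by (simp add: fun_arith_apply)
    qed
    ultimately have "w - w' \<in> span {lmul u (minor f Q) | u Q. u \<in> vecs n \<and> (\<forall>t\<in>\<sigma>. u t = 0) \<and> Q \<in> {Q. Q \<subseteq> {1..n} \<and> lex_less Q S}}"
      unfolding lower_products_def
      by (intro lmul_minors_vanishing_on_simplex[OF fr cardn subspace_vecs rows _ lower_closed]) auto
    from vanishing_products_split[OF this]
    obtain a b where ab: "w - w' = a + b" "a \<in> span (lower_products n f S)"
      "\<forall>T\<in>K. a T = 0" "\<forall>T\<in>L. b T = 0"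
      by blast
    have "lmul v (minor f S) T = (w - a) T" if "T \<in> K \<union> L" for T
      using that w(2)[of T] w'(2)[of T] ab(3,4) fun_cong[OF ab(1), of T] by (auto simp: fun_arith_apply)
    moreover have "w - a \<in> span (lower_products n f S)" using w(1) ab(2) by (rule span_diff)
    ultimately show "v \<in> annih n f (K \<union> L) S" using v by (auto simp: annih_def span_on_def)
  qed
qed

text \<open>A product by \<open>v\<close> that agrees with \<open>w\<close> on
  \<open>\<sigma>\<close> differs from it by lower products plus a product by some \<open>u\<close>
  vanishing on \<open>\<sigma>\<close>. Then \<open>v - u\<close> annihilates \<open>S\<close>
  modulo lower products, while \<open>u\<close> splits into a vector vanishing on \<open>A\<close>
  and one vanishing on \<open>B\<close>.\<close>

lemma span_annih_Un: "span (annih n f K S \<union> annih n f L S) = annih n f (Pow \<sigma>) S"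
proof
  have "annih n f K S \<subseteq> annih n f (Pow \<sigma>) S" "annih n f L S \<subseteq> annih n f (Pow \<sigma>) S"
    using KL unfolding annih_def span_on_def by blast+
  then show "span (annih n f K S \<union> annih n f L S) \<subseteq> annih n f (Pow \<sigma>) S"
    by (intro span_minimal subspace_annih) auto
  show "annih n f (Pow \<sigma>) S \<subseteq> span (annih n f K S \<union> annih n f L S)"
  proof
    fix v assume v: "v \<in> annih n f (Pow \<sigma>) S"
    let ?\<Q> = "{Q. Q \<subseteq> {1..n} \<and> lex_less Q S}"
    let ?m = "minor f S"
    let ?X = "\<lambda>\<Q>. {lmul u (minor f Q) | u Q. u \<in> vecs n \<and> (\<forall>t\<in>\<sigma>. u t = 0) \<and> Q \<in> \<Q>}"
    obtain w where w: "w \<in> span (lower_products n f S)" "\<And>T. T \<subseteq> \<sigma> \<Longrightarrow> lmul v ?m T = w T"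
      and vn: "v \<in> vecs n"
      using v by (auto simp: annih_def span_on_def)
    \<comment> \<open>Admitting \<open>S\<close> itself as an index set keeps the family
      lexicographically initial, since everything below \<open>S\<close> is already present.\<close>
    have "lmul v ?m - w \<in> span {lmul v (minor f Q) | v Q. v \<in> vecs n \<and> Q \<in> insert S ?\<Q>}"
    proof (rule span_diff)
      show "lmul v ?m \<in> span {lmul v (minor f Q) | v Q. v \<in> vecs n \<and> Q \<in> insert S ?\<Q>}"
        using vn by (intro span_base) blast
      show "w \<in> span {lmul v (minor f Q) | v Q. v \<in> vecs n \<and> Q \<in> insert S ?\<Q>}"
        using w(1) unfolding lower_products_def by (rule subsetD[OF span_mono, rotated]) blast
    qed
    then have "lmul v ?m - w \<in> span (?X (insert S ?\<Q>))"
      using w(2) S lower_closed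
      by (intro lmul_minors_vanishing_on_simplex[OF fr cardn subspace_vecs rows]) (auto simp: fun_arith_apply)
    also have "?X (insert S ?\<Q>) = ?X ?\<Q> \<union> (\<lambda>u. lmul u ?m) ` {u \<in> vecs n. \<forall>t\<in>\<sigma>. u t = 0}"
      by blast
    finally obtain x y where xy: "lmul v ?m - w = x + y" "x \<in> span (?X ?\<Q>)"
      "y \<in> span ((\<lambda>u. lmul u ?m) ` {u \<in> vecs n. \<forall>t\<in>\<sigma>. u t = 0})"
      unfolding span_Un by blast
    have "subspace {u \<in> vecs n. \<forall>t\<in>\<sigma>. u t = 0}"
      using subspace_vecs by (auto simp: subspace_def fun_arith_apply)
    then have sp: "span {u \<in> vecs n. \<forall>t\<in>\<sigma>. u t = 0} = {u \<in> vecs n. \<forall>t\<in>\<sigma>. u t = 0}"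
      by (simp only: span_eq_iff)
    then obtain u where u: "u \<in> vecs n" "\<forall>t\<in>\<sigma>. u t = 0" "y = lmul u ?m"
      using xy(3) unfolding linear_span_image[OF linear_lmul_left] sp by blast
    obtain a b where ab: "u = a + b" "a \<in> vecs n" "b \<in> vecs n" "\<forall>t\<in>A. a t = 0" "\<forall>t\<in>B. b t = 0"
      using split_vanishing[OF u(1,2)] by blast
    have "x \<in> span (lower_products n f S)"
      using xy(2) unfolding lower_products_def by (rule subsetD[OF span_mono, rotated]) blast
    then have "x + w \<in> span (lower_products n f S)" using w(1) by (rule span_add)
    moreover have "lmul (v - u) ?m = x + w"
      using xy(1) unfolding u(3) linear_diff[OF linear_lmul_left] by (simp add: algebra_simps)
    moreover have "v - u \<in> vecs n" using vn u(1) subspace_diff[OF subspace_vecs] by blast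
    \<comment> \<open>The product by \<open>v - u\<close> is a combination of lower products at
      every set, not just on a complex; \<open>L\<close> would serve equally well here.\<close>
    ultimately have vu: "v - u \<in> annih n f K S"
      using span_subset_span_on unfolding annih_def by auto
    have "a \<in> annih n f K S"
    proof -
      have "lmul a ?m T = 0 T" if "T \<in> K" for T
        unfolding zero_fun_apply using that KA ab(4) by (intro lmul_vanish) blast
      then show ?thesis
        using ab(2) span_zero unfolding annih_def span_on_def by blast
    qed
    moreover have "b \<in> annih n f L S"
    proof -
      have "lmul b ?m T = 0 T" if "T \<in> L" for T
        unfolding zero_fun_apply using that LB ab(5) by (intro lmul_vanish) blast
      then show ?thesis
        using ab(3) span_zero unfolding annih_def span_on_def by blast
    qed
    ultimately have "(v - u) + (a + b) \<in> span (annih n f K S \<union> annih n f L S)"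
      using vu by (intro span_add span_base) auto
    then show "v \<in> span (annih n f K S \<union> annih n f L S)" using ab(1) by simp
  qed
qed

lemma card_extensions_gluing:
  "card (extensions n f (K \<union> L) S) + card (extensions n f (Pow \<sigma>) S) =
    card (extensions n f K S) + card (extensions n f L S)"
proof -
  have "annih n f H S \<subseteq> span (f ` {1..n})" for H
    unfolding vecs_eq_span [symmetric] by (auto simp: annih_def)
  moreover have "span (span N \<union> X) = span (N \<union> X)" for N X :: "(nat \<Rightarrow> real) set"
    by (simp only: span_Un span_span)
  ultimately show ?thesis
    unfolding extensions_eq[OF S] annih_Un span_annih_Un [symmetric]
    using card_flag_Un_Int[OF subspace_annih subspace_annih, of n f K S n f L S f n] by simp
qed

end

end

text \<open>Such a \<open>D\<close> is the interval from \<open>m + 1\<close> to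
  \<open>m + card D\<close>. This turns membership into the inequality of the gluing
  formula.\<close>

lemma mem_down_closed_iff:
  fixes D :: "nat set"
  assumes D: "finite D" "D \<subseteq> {m<..}" "\<And>t t'. t' \<in> D \<Longrightarrow> m < t \<Longrightarrow> t < t' \<Longrightarrow> t \<in> D" and t: "m < t"
  shows "t \<in> D \<longleftrightarrow> t - m \<le> card D"
proof
  assume "t \<in> D"
  then have "{m<..t} \<subseteq> D" using D(3) by (auto simp: le_less)
  from card_mono[OF D(1) this] show "t - m \<le> card D" by simp
next
  assume le: "t - m \<le> card D"
  show "t \<in> D"
  proof (rule ccontr)
    assume "t \<notin> D"
    have "D \<subseteq> {m<..<t}"
    proof
      fix x assume "x \<in> D"
      then have "x \<noteq> t" "\<not> t < x" using \<open>t \<notin> D\<close> D(3)[of x t] t by blast+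
      then show "x \<in> {m<..<t}" using \<open>x \<in> D\<close> D(2) by auto
    qed
    then have "card D \<le> t - Suc m" using card_mono[of "{m<..<t}" D] by simp
    then show False using le t by simp
  qed
qed

section \<open>Genericity\<close>

text \<open>Rational polynomials in the variables from \<open>I\<close>, taken as functions, so that
  substitution and elimination are composition and arithmetic of functions.\<close>

inductive_set polyfun :: "'i set \<Rightarrow> (('i \<Rightarrow> real) \<Rightarrow> real) set" for I where
  const: "(\<lambda>x. of_rat c) \<in> polyfun I"
| var: "i \<in> I \<Longrightarrow> (\<lambda>x. x i) \<in> polyfun I"
| add: "p \<in> polyfun I \<Longrightarrow> q \<in> polyfun I \<Longrightarrow> (\<lambda>x. p x + q x) \<in> polyfun I"
| mult: "p \<in> polyfun I \<Longrightarrow> q \<in> polyfun I \<Longrightarrow> (\<lambda>x. p x * q x) \<in> polyfun I"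

lemma polyfun_of_int: "(\<lambda>x. of_int c) \<in> polyfun I"
  using polyfun.const[of "of_int c" I] by simp

lemma polyfun_diff:
  assumes "p \<in> polyfun I" "q \<in> polyfun I"
  shows "(\<lambda>x. p x - q x) \<in> polyfun I"
proof -
  have "(\<lambda>x. p x + (\<lambda>x. of_int (-1)) x * q x) \<in> polyfun I"
    by (intro polyfun.add polyfun.mult polyfun_of_int assms)
  then show ?thesis by simp
qed

lemma polyfun_sum:
  "(\<And>a. a \<in> A \<Longrightarrow> p a \<in> polyfun I) \<Longrightarrow> (\<lambda>x. \<Sum>a\<in>A. p a x) \<in> polyfun I"
proof (induction A rule: infinite_finite_induct)
  case (insert a A)
  then have "(\<lambda>x. p a x + (\<Sum>a\<in>A. p a x)) \<in> polyfun I" by (intro polyfun.add) auto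
  then show ?case using insert by simp
qed (use polyfun_of_int[of 0 I] in simp_all)

lemma polyfun_mono:
  assumes "p \<in> polyfun I" "I \<subseteq> J"
  shows "p \<in> polyfun J"
  using assms(1) by induction (use assms(2) in \<open>auto intro: polyfun.intros\<close>)

lemma polyfun_cong:
  assumes "p \<in> polyfun I" "\<And>i. i \<in> I \<Longrightarrow> x i = y i"
  shows "p x = p y"
  using assms(1) by induction (use assms(2) in auto)

lemma polyfun_subst:
  assumes "p \<in> polyfun I" "\<And>i. i \<in> I \<Longrightarrow> (\<lambda>z. s z i) \<in> polyfun J"
  shows "(\<lambda>z. p (s z)) \<in> polyfun J"
  using assms(1) by induction (use assms(2) in \<open>auto intro: polyfun.intros\<close>)

text \<open>A consequence of algebraic independence in the form used throughout: a rational
  polynomial relation at a generic point is an identity, hence holds at every other point.\<close>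

definition generic :: "'i set \<Rightarrow> ('i \<Rightarrow> real) \<Rightarrow> bool" where
  "generic I x \<longleftrightarrow> (\<forall>p\<in>polyfun I. p x = 0 \<longrightarrow> (\<forall>y. p y = 0))"

lemma genericD: "generic I x \<Longrightarrow> p \<in> polyfun I \<Longrightarrow> p x = 0 \<Longrightarrow> p y = 0"
  unfolding generic_def by blast

lemma generic_mono: "generic J x \<Longrightarrow> I \<subseteq> J \<Longrightarrow> generic I x"
  unfolding generic_def using polyfun_mono by blast

lemma generic_cong:
  assumes "generic I x" "\<And>i. i \<in> I \<Longrightarrow> x i = y i"
  shows "generic I y"
  unfolding generic_def
proof (intro ballI impI)
  fix p assume p: "p \<in> polyfun I" "p y = 0"
  have "p x = p y" by (rule polyfun_cong[OF p(1) assms(2)])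
  then have "p x = 0" using p(2) by (rule trans)
  from genericD[OF assms(1) p(1) this] show "\<forall>y. p y = 0" ..
qed

text \<open>A polynomial vanishing at \<open>s x\<close> gives one vanishing at \<open>x\<close>,
  hence everywhere; as \<open>s\<close> reaches all values on \<open>I\<close>, the original
  polynomial vanishes everywhere too.\<close>

lemma generic_subst:
  assumes "generic J x" "\<And>i. i \<in> I \<Longrightarrow> (\<lambda>z. s z i) \<in> polyfun J" "\<And>y. \<exists>z. \<forall>i\<in>I. s z i = y i"
  shows "generic I (s x)"
  unfolding generic_def
proof (intro ballI impI allI)
  fix p y assume p: "p \<in> polyfun I" "p (s x) = 0"
  obtain z where z: "\<forall>i\<in>I. s z i = y i" using assms(3) by blast
  have "p y = p (s z)" by (rule polyfun_cong[OF p(1)]) (use z in simp)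
  also have "\<dots> = 0"
    by (rule genericD[OF assms(1) polyfun_subst[OF p(1) assms(2)]], assumption, rule p(2))
  finally show "p y = 0" .
qed

lemma generic_reindex:
  assumes "generic J x" "inj_on h I" "h ` I \<subseteq> J"
  shows "generic I (\<lambda>i. x (h i))"
proof (rule generic_subst[OF assms(1), of I "\<lambda>z i. z (h i)"])
  show "(\<lambda>z. z (h i)) \<in> polyfun J" if "i \<in> I" for i
    using that assms(3) by (intro polyfun.var) auto
  show "\<exists>z. \<forall>i\<in>I. z (h i) = y i" for y
    by (intro exI[of _ "\<lambda>j. y (inv_into I h j)"]) (simp add: assms(2))
qed

text \<open>Perturbs a single matrix entry without leaving the generic points; this replaces
  determinants in the proof of \<open>generic_frame\<close>.\<close>

lemma generic_translate:
  fixes x :: "'i \<Rightarrow> real"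
  assumes "generic I x"
  shows "generic I (x(k := x k + 1))"
proof (rule generic_subst[OF assms, of I "\<lambda>z. z(k := z k + 1)"])
  show "(\<lambda>z. (z(k := z k + 1)) i) \<in> polyfun I" if "i \<in> I" for i
    using that polyfun.add[OF polyfun.var[OF that] polyfun_of_int[of 1]]
    by (cases "i = k") (auto intro: polyfun.var)
  show "\<exists>z. \<forall>i\<in>I. (z(k := z k + 1)) i = y i" for y :: "'i \<Rightarrow> real"
    by (intro exI[of _ "y(k := y k - 1)"]) auto
qed

text \<open>Gaussian elimination without divisions, so that all entries remain polynomial.\<close>

lemma linear_dependence_generic:
  fixes v :: "'k \<Rightarrow> 'c \<Rightarrow> ('i \<Rightarrow> real) \<Rightarrow> real"
  assumes x: "generic I x" and y: "generic I y" and A: "finite A"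
    and "\<And>c. c \<in> C \<Longrightarrow> w c \<in> polyfun I" "\<And>k c. k \<in> A \<Longrightarrow> c \<in> C \<Longrightarrow> v k c \<in> polyfun I"
    and "\<exists>a. \<forall>c\<in>C. w c x = (\<Sum>k\<in>A. a k * v k c x)"
  shows "\<exists>a. \<forall>c\<in>C. w c y = (\<Sum>k\<in>A. a k * v k c y)"
  using A assms(4-6)
proof (induction A arbitrary: w v rule: finite_induct)
  case empty
  have "w c y = 0" if "c \<in> C" for c
    by (rule genericD[OF x empty.prems(1)]) (use that empty.prems in auto)
  then show ?case by simp
next
  case (insert k A)
  obtain a where a: "\<And>c. c \<in> C \<Longrightarrow> w c x = a k * v k c x + (\<Sum>l\<in>A. a l * v l c x)"
    using insert.prems(3) insert.hyps by auto
  show ?case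
  proof (cases "\<forall>c\<in>C. v k c x = 0")
    case True
    have "\<exists>b. \<forall>c\<in>C. w c y = (\<Sum>l\<in>A. b l * v l c y)"
    proof (rule insert.IH)
      show "w c \<in> polyfun I" if "c \<in> C" for c using insert.prems(1) that .
      show "v l c \<in> polyfun I" if "l \<in> A" "c \<in> C" for l c using insert.prems(2)[of l c] that by simp
      show "\<exists>a. \<forall>c\<in>C. w c x = (\<Sum>l\<in>A. a l * v l c x)" using True a by auto
    qed
    moreover have "v k c y = 0" if "c \<in> C" for c
      by (rule genericD[OF x insert.prems(2)]) (use True that in auto)
    ultimately show ?thesis using insert.hyps by simp
  next
    case False
    then obtain d where d: "d \<in> C" "v k d x \<noteq> 0" by blast
    then have dy: "v k d y \<noteq> 0"
      using genericD[OF y insert.prems(2), of k d x] by blast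
    \<comment> \<open>Cross-multiplied elimination of the vector \<open>k\<close>, with the
      coordinate \<open>d\<close> as pivot. The pivot is nonzero at \<open>y\<close> because
      \<open>y\<close> is generic as well.\<close>
    let ?e = "\<lambda>u c z. v k d z * u c z - u d z * v k c z"
    have "\<exists>b. \<forall>c\<in>C. ?e w c y = (\<Sum>l\<in>A. b l * ?e (v l) c y)"
    proof (rule insert.IH)
      show "?e w c \<in> polyfun I" if "c \<in> C" for c
        using that d insert.prems by (intro polyfun_diff polyfun.mult) auto
      show "?e (v l) c \<in> polyfun I" if "l \<in> A" "c \<in> C" for l c
        using that d insert.prems by (intro polyfun_diff polyfun.mult) auto
      have "?e w c x = (\<Sum>l\<in>A. a l * ?e (v l) c x)" if "c \<in> C" for c
        unfolding a[OF that] a[OF d(1)]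
        by (simp add: algebra_simps sum_distrib_left sum_distrib_right sum_subtractf)
      then show "\<exists>a. \<forall>c\<in>C. ?e w c x = (\<Sum>l\<in>A. a l * ?e (v l) c x)" by blast
    qed
    then obtain b where b: "\<And>c. c \<in> C \<Longrightarrow> ?e w c y = (\<Sum>l\<in>A. b l * ?e (v l) c y)" by blast
    \<comment> \<open>The coefficient of the eliminated vector, solved from the equation in the
      pivot coordinate.\<close>
    define r where "r = (w d y - (\<Sum>l\<in>A. b l * v l d y)) / v k d y"
    have "w c y = (\<Sum>l\<in>insert k A. (b(k := r)) l * v l c y)" if "c \<in> C" for c
    proof -
      have "(\<Sum>l\<in>insert k A. (b(k := r)) l * v l c y) = r * v k c y + (\<Sum>l\<in>A. b l * v l c y)"
        using insert.hyps by (auto intro!: sum.cong)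
      moreover have "w d y = v k d y * r + (\<Sum>l\<in>A. b l * v l d y)"
        using dy by (simp add: r_def)
      moreover have "v k d y * w c y - w d y * v k c y =
          v k d y * (\<Sum>l\<in>A. b l * v l c y) - (\<Sum>l\<in>A. b l * v l d y) * v k c y"
        using b[OF that] by (simp add: algebra_simps sum_distrib_left sum_distrib_right sum_subtractf)
      ultimately have "v k d y * w c y = v k d y * (\<Sum>l\<in>insert k A. (b(k := r)) l * v l c y)"
        by algebra
      then show ?thesis using dy by simp
    qed
    then show ?thesis by blast
  qed
qed

lemma span_image_finite:
  fixes g :: "'k \<Rightarrow> 'a::real_vector"
  assumes "finite A"
  shows "span (g ` A) = range (\<lambda>a. \<Sum>k\<in>A. a k *\<^sub>R g k)"
  using assms
proof (induction A rule: finite_induct)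
  case empty
  then show ?case by auto
next
  case (insert k A)
  show ?case
  proof (intro equalityI subsetI)
    fix x assume "x \<in> span (g ` insert k A)"
    then obtain r where "x - r *\<^sub>R g k \<in> span (g ` A)" by (auto simp: span_insert)
    then obtain a where "x - r *\<^sub>R g k = (\<Sum>l\<in>A. a l *\<^sub>R g l)" unfolding insert.IH by blast
    then have "x = r *\<^sub>R g k + (\<Sum>l\<in>A. a l *\<^sub>R g l)" by (simp add: algebra_simps)
    also have "\<dots> = (\<Sum>l\<in>insert k A. (a(k := r)) l *\<^sub>R g l)"
      using insert.hyps by (auto intro!: sum.cong)
    finally show "x \<in> range (\<lambda>a. \<Sum>k\<in>insert k A. a k *\<^sub>R g k)" by blast
  next
    fix x assume "x \<in> range (\<lambda>a. \<Sum>k\<in>insert k A. a k *\<^sub>R g k)"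
    then obtain a where x: "x = (\<Sum>l\<in>insert k A. a l *\<^sub>R g l)" by blast
    show "x \<in> span (g ` insert k A)"
      unfolding x by (intro span_sum span_scale span_base imageI)
  qed
qed

lemma mem_span_on_image:
  assumes "finite A"
  shows "x \<in> span_on K (g ` A) \<longleftrightarrow> (\<exists>a. \<forall>T\<in>K. x T = (\<Sum>k\<in>A. a k * g k T))"
  unfolding span_on_def span_image_finite[OF assms] by (auto simp: fun_arith_apply)

lemma wprod_polyfun:
  "set ls \<times> T \<subseteq> I \<Longrightarrow>
    (\<lambda>z. wprod (map (\<lambda>i j. z (i, j)) ls) T) \<in> polyfun I"
proof (induction ls arbitrary: T)
  case Nil
  then show ?case using polyfun_of_int[of 1 I] polyfun_of_int[of 0 I] by (simp add: wprod_Nil)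
next
  case (Cons l ls)
  have "(\<lambda>z. of_int ((- 1) ^ card {t \<in> T. t < j}) * z (l, j) * wprod (map (\<lambda>i j. z (i, j)) ls) (T - {j})) \<in> polyfun I"
    if "j \<in> T" for j
    using that Cons.prems by (intro polyfun.mult polyfun_of_int polyfun.var Cons.IH) auto
  then show ?case by (auto simp: lmul_def intro!: polyfun_sum)
qed

lemma minor_polyfun:
  assumes "finite S" "S \<times> T \<subseteq> I"
  shows "(\<lambda>z. minor (\<lambda>i j. z (i, j)) S T) \<in> polyfun I"
  unfolding minor_def using assms by (intro wprod_polyfun) auto

lemma minor_span_on_generic:
  assumes "generic ({1..n} \<times> U) (case_prod f)" "generic ({1..n} \<times> U) (case_prod g)"
    and S: "S \<subseteq> {1..n}" and \<R>: "\<And>R. R \<in> \<R> \<Longrightarrow> R \<subseteq> {1..n}" and K: "K \<subseteq> Pow U"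
    and "minor f S \<in> span_on K (minor f ` \<R>)"
  shows "minor g S \<in> span_on K (minor g ` \<R>)"
proof -
  have fin: "finite \<R>" using \<R> finite_subset[of \<R> "Pow {1..n}"] by blast
  have poly: "(\<lambda>z. minor (\<lambda>i j. z (i, j)) R T) \<in> polyfun ({1..n} \<times> U)" if "R \<subseteq> {1..n}" "T \<in> K" for R T
    using that K by (intro minor_polyfun) (auto intro: finite_subset)
  show ?thesis
    using linear_dependence_generic[OF assms(1,2) fin, of K "\<lambda>T z. minor (\<lambda>i j. z (i, j)) S T"
        "\<lambda>R T z. minor (\<lambda>i j. z (i, j)) R T"] poly S \<R> assms(6)
    unfolding mem_span_on_image[OF fin] by simp
qed

lemma shifted_faces_generic:
  assumes "generic ({1..n} \<times> U) (case_prod f)" "generic ({1..n} \<times> U) (case_prod g)" "K \<subseteq> Pow U"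
  shows "shifted_faces n f K = shifted_faces n g K"
proof -
  have eq: "{minor h R | R. R \<subseteq> {1..n} \<and> lex_less R S} = minor h ` {R. R \<subseteq> {1..n} \<and> lex_less R S}" for h S
    by blast
  have "minor f S \<in> span_on K (minor f ` {R. R \<subseteq> {1..n} \<and> lex_less R S}) \<longleftrightarrow>
        minor g S \<in> span_on K (minor g ` {R. R \<subseteq> {1..n} \<and> lex_less R S})" if "S \<subseteq> {1..n}" for S
    using minor_span_on_generic[OF assms(1,2) that _ assms(3), of "{R. R \<subseteq> {1..n} \<and> lex_less R S}"]
      minor_span_on_generic[OF assms(2,1) that _ assms(3), of "{R. R \<subseteq> {1..n} \<and> lex_less R S}"]
    by auto
  then show ?thesis unfolding shifted_faces_def eq by (intro Collect_cong) (simp cong: conj_cong)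
qed

text \<open>If row \<open>t\<close>, restricted to \<open>U\<close>, depended on its predecessors,
  it would still do so after any one of its entries is increased by one. Subtracting the dependences
  puts every unit vector of \<open>U\<close> into the span of \<open>t - 1\<close> rows, which is
  impossible for \<open>t \<le> card U\<close>. So the first \<open>card U\<close> restricted rows
  form a basis.\<close>

lemma generic_frame:
  assumes gen: "generic ({1..n} \<times> U) (case_prod f)" and U: "finite U" "card U \<le> n"
  shows "frame f U"
proof -
  define G where "G i j = (if j \<in> U then f i j else 0)" for i j
  define \<delta> :: "nat \<Rightarrow> nat \<Rightarrow> real" where "\<delta> c j = (if j = c then 1 else 0)" for c j
  have inj: "inj \<delta>" unfolding inj_def \<delta>_def fun_eq_iff by (metis zero_neq_one)
  have indep\<delta>: "independent (\<delta> ` U)"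
  proof (rule independent_if_scalars_zero)
    fix h x assume h: "(\<Sum>x\<in>\<delta> ` U. h x *\<^sub>R x) = 0" and "x \<in> \<delta> ` U"
    then obtain c where c: "c \<in> U" "x = \<delta> c" by blast
    have "0 = (\<Sum>d\<in>U. h (\<delta> d) *\<^sub>R \<delta> d) c"
      using h by (simp add: sum.reindex[OF inj_on_subset[OF inj subset_UNIV]] fun_arith_apply)
    also have "\<dots> = (\<Sum>d\<in>U. if d = c then h (\<delta> d) else 0)"
      unfolding sum_fun_apply scaleR_fun_apply by (intro sum.cong) (auto simp: \<delta>_def)
    finally show "h x = 0" using c U by simp
  qed (use U in simp)
  have card\<delta>: "card (\<delta> ` U) = card U" using inj by (simp add: card_image inj_on_subset)
  have G\<delta>: "G i \<in> span (\<delta> ` U)" for i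
  proof -
    have "G i = (\<Sum>c\<in>U. f i c *\<^sub>R \<delta> c)"
    proof
      fix j
      have "(\<Sum>c\<in>U. f i c *\<^sub>R \<delta> c) j = (\<Sum>c\<in>U. if c = j then f i c else 0)"
        unfolding sum_fun_apply scaleR_fun_apply by (intro sum.cong) (auto simp: \<delta>_def)
      then show "G i j = (\<Sum>c\<in>U. f i c *\<^sub>R \<delta> c) j" using U by (simp add: G_def)
    qed
    also have "\<dots> \<in> span (\<delta> ` U)" by (intro span_sum span_scale span_base imageI)
    finally show ?thesis .
  qed
  have mem: "x \<in> span (h ` {1..<t}) \<longleftrightarrow> (\<exists>a. x = (\<Sum>i = 1..<t. a i *\<^sub>R h i))"
    for x and h :: "nat \<Rightarrow> nat \<Rightarrow> real" and t
    by (subst span_image_finite) auto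
  have new: "G t \<notin> span (G ` {1..<t})" if t: "t \<in> {1..card U}" for t
  proof
    assume "G t \<in> span (G ` {1..<t})"
    then obtain a where a: "G t = (\<Sum>i = 1..<t. a i *\<^sub>R G i)" unfolding mem by blast
    have dep: "\<exists>a. \<forall>c\<in>U. case_prod f (t, c) = (\<Sum>i = 1..<t. a i * case_prod f (i, c))"
    proof (intro exI[of _ a] ballI)
      fix c assume "c \<in> U"
      then show "case_prod f (t, c) = (\<Sum>i = 1..<t. a i * case_prod f (i, c))"
        using fun_cong[OF a, of c] by (simp add: fun_arith_apply G_def)
    qed
    have "\<delta> d \<in> span (G ` {1..<t})" if d: "d \<in> U" for d
    proof -
      \<comment> \<open>Only row \<open>t\<close> changes, so both dependences use the same earlier
        rows and their difference is the unit vector at \<open>d\<close>.\<close>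
      let ?y = "(case_prod f)((t, d) := f t d + 1)"
      have geny: "generic ({1..n} \<times> U) ?y" using generic_translate[OF gen, of "(t, d)"] by simp
      have "(\<lambda>z. z (i, c)) \<in> polyfun ({1..n} \<times> U)" if "i \<in> {1..t}" "c \<in> U" for i c
        using that t U(2) by (intro polyfun.var) auto
      then have "\<exists>b. \<forall>c\<in>U. ?y (t, c) = (\<Sum>i = 1..<t. b i * ?y (i, c))"
        using t by (intro linear_dependence_generic[where w = "\<lambda>c z. z (t, c)" and v = "\<lambda>i c z. z (i, c)",
              OF gen geny finite_atLeastLessThan _ _ dep]) auto
      then obtain b where b: "\<And>c. c \<in> U \<Longrightarrow> ?y (t, c) = (\<Sum>i = 1..<t. b i * ?y (i, c))" by blast
      have "\<delta> d = (\<Sum>i = 1..<t. b i *\<^sub>R G i) - G t"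
      proof
        fix c
        have "(\<Sum>i = 1..<t. b i * ?y (i, c)) = (\<Sum>i = 1..<t. b i * f i c)"
          by (intro sum.cong) auto
        then show "\<delta> d c = ((\<Sum>i = 1..<t. b i *\<^sub>R G i) - G t) c"
          using b[of c] d by (cases "c \<in> U") (auto simp: fun_arith_apply G_def \<delta>_def)
      qed
      also have "\<dots> = (\<Sum>i = 1..<t. (b i - a i) *\<^sub>R G i)"
        by (simp add: a scaleR_diff_left sum_subtractf)
      also have "\<dots> \<in> span (G ` {1..<t})" by (intro span_sum span_scale span_base imageI)
      finally show ?thesis .
    qed
    then have "\<delta> ` U \<subseteq> span (G ` {1..<t})" by blast
    from independent_span_bound[OF _ indep\<delta> this]
    have "card (\<delta> ` U) \<le> card (G ` {1..<t})" by simp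
    also have "\<dots> \<le> t - 1" using card_image_le[of "{1..<t}" G] by simp
    finally show False using t card\<delta> by auto
  qed
  have "independent (G ` {1..s}) \<and> card (G ` {1..s}) = s" if "s \<le> card U" for s
    using that
  proof (induction s)
    case 0
    then show ?case by (simp add: independent_empty)
  next
    case (Suc s)
    have eq: "G ` {1..Suc s} = insert (G (Suc s)) (G ` {1..s})" by (auto simp: atLeastAtMostSuc_conv)
    have n: "G (Suc s) \<notin> span (G ` {1..s})"
      using new[of "Suc s"] Suc.prems by (simp add: atLeastLessThanSuc_atLeastAtMost)
    have IH: "independent (G ` {1..s})" "card (G ` {1..s}) = s" using Suc by simp_all
    have "G (Suc s) \<notin> G ` {1..s}" using n span_base[of "G (Suc s)" "G ` {1..s}"] by blast
    then have "card (insert (G (Suc s)) (G ` {1..s})) = Suc s"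
      by (subst card_insert_disjoint) (simp_all add: IH(2) del: One_nat_def)
    then show ?case
      unfolding eq using independent_insertI[OF n IH(1)] by blast
  qed
  then have G: "independent (G ` {1..card U})" "card (G ` {1..card U}) = card U" by auto
  have "\<delta> ` U \<subseteq> span (G ` {1..card U})"
    using G\<delta> card\<delta> U by (intro independent_card_ge_spans[OF _ G(1)]) (auto simp del: One_nat_def simp: G(2))
  moreover have "span (G ` {1..card U}) = (\<lambda>v j. if j \<in> U then v j else 0) ` span (f ` {1..card U})"
  proof -
    have "linear (\<lambda>v j. if j \<in> U then v j else (0::real))"
      by (rule linearI) (auto simp: fun_eq_iff fun_arith_apply)
    from linear_span_image[OF this, of "f ` {1..card U}"]
    show ?thesis by (simp add: image_image G_def [abs_def])
  qed
  ultimately have sub: "\<delta> ` U \<subseteq> (\<lambda>v j. if j \<in> U then v j else 0) ` span (f ` {1..card U})"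
    by simp
  have "\<exists>v\<in>span (f ` {1..card U}). \<forall>t'\<in>U. v t' = (if t = t' then 1 else 0)" if "t \<in> U" for t
  proof -
    obtain v where v: "v \<in> span (f ` {1..card U})" "\<delta> t = (\<lambda>j. if j \<in> U then v j else 0)"
      using subsetD[OF sub imageI[OF \<open>t \<in> U\<close>]] by blast
    have "v t' = (if t = t' then 1 else 0)" if "t' \<in> U" for t'
      using fun_cong[OF v(2), of t'] that by (simp add: \<delta>_def split: if_splits)
    then show ?thesis using v(1) by blast
  qed
  then show ?thesis unfolding frame_def using U by blast
qed

text \<open>Exchanging the rows \<open>t\<close> and \<open>t'\<close> preserves genericity.\<close>

lemma extensions_down_closed:
  assumes gen: "generic ({1..n} \<times> U) (case_prod f)" and K: "K \<subseteq> Pow U" and S: "S \<subseteq> {1..n}"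
    and t': "t' \<in> extensions n f K S" and t: "t \<in> {1..n}" "\<forall>s\<in>S. s < t" "t < t'"
  shows "t \<in> extensions n f K S"
proof (rule ccontr)
  assume "t \<notin> extensions n f K S"
  then have nt: "insert t S \<notin> shifted_faces n f K" using t by (auto simp: extensions_def)
  have t'n: "t' \<in> {1..n}" and in': "insert t' S \<in> shifted_faces n f K"
    using t' by (auto simp: extensions_def)
  have finS: "finite S" using S finite_subset by blast
  have nin: "t \<notin> S" "t' \<notin> S" using t by auto
  define \<tau> where "\<tau> = (\<lambda>i. if i = t then t' else if i = t' then t else i)"
  have inj: "inj \<tau>" unfolding inj_def \<tau>_def using t(3) by auto
  have injR: "inj_on \<tau> R" for R by (rule inj_on_subset[OF inj subset_UNIV])
  have img: "\<tau> ` R \<subseteq> {1..n}" if "R \<subseteq> {1..n}" for R using that t(1) t'n unfolding \<tau>_def by auto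
  define g where "g i = f (\<tau> i)" for i
  have "generic ({1..n} \<times> U) (\<lambda>x. case_prod f (map_prod \<tau> id x))"
  proof (rule generic_reindex[OF gen])
    show "inj_on (map_prod \<tau> id) ({1..n} \<times> U)"
      using inj by (intro map_prod_inj_on inj_on_subset[OF inj]) auto
    show "map_prod \<tau> id ` ({1..n} \<times> U) \<subseteq> {1..n} \<times> U"
      using img[of "{1..n}"] by auto
  qed
  then have geng: "generic ({1..n} \<times> U) (case_prod g)"
    by (rule generic_cong) (auto simp: g_def)
  \<comment> \<open>The exchanged matrix is generic too, so it has the same shifted faces. The
    resulting dependence for \<open>insert t S\<close> in the rows \<open>g\<close> is then read as
    one for \<open>insert t' S\<close> in the rows \<open>f\<close>.\<close>
  have "insert t S \<notin> shifted_faces n g K" using nt shifted_faces_generic[OF gen geng K] by simp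
  then have mem: "minor g (insert t S) \<in> span_on K {minor g R | R. R \<subseteq> {1..n} \<and> lex_less R (insert t S)}"
    using S t(1) by (auto simp: shifted_faces_def)
  let ?B = "{minor f R | R. R \<subseteq> {1..n} \<and> lex_less R (insert t' S)}"
  have minor_g: "\<exists>c::real. c \<noteq> 0 \<and> minor g R = c *\<^sub>R minor f (\<tau> ` R)" if "finite R" for R
  proof -
    let ?L = "map \<tau> (sorted_list_of_set R)"
    have "distinct ?L" by (simp add: distinct_map injR)
    moreover have "minor g R = wprod (map f ?L)" by (simp add: minor_def g_def [abs_def] comp_def)
    moreover have "set ?L = \<tau> ` R" using that by simp
    ultimately show ?thesis using wprod_map_minor[of f ?L] by metis
  qed
  have "minor g (insert t S) \<in> span_on K ?B"
  proof (rule subsetD[OF span_on_minimal mem], clarify)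
    fix R assume R: "R \<subseteq> {1..n}" "lex_less R (insert t S)"
    have finR: "finite R" using R finite_subset by blast
    obtain p where p: "p \<in> R" "p \<notin> insert t S" "\<And>q. q < p \<Longrightarrow> q \<in> R \<longleftrightarrow> q \<in> insert t S"
      and cardR: "card R = Suc (card S)"
      using R(2) finR finS nin by (auto simp: lex_less_iff)
    have "p < t"
    proof (rule ccontr)
      assume "\<not> p < t"
      then have "t < p" using p(2) by auto
      then have "insert t S \<subseteq> R" using p(3) t(2) by (auto dest: less_trans)
      then have "insert t S = R" using cardR finS finR nin by (intro card_subset_eq) auto
      then show False using p by blast
    qed
    \<comment> \<open>Exchanging \<open>t\<close> and \<open>t'\<close> does not touch indices below
      \<open>t\<close>, so the first difference \<open>p < t\<close> stays where it is.\<close>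
    have \<tau>small: "q \<in> \<tau> ` R \<longleftrightarrow> q \<in> R" if "q < t" for q
    proof -
      have "\<tau> q = q" using that t(3) by (simp add: \<tau>_def)
      then show ?thesis using inj by (metis inj_image_mem_iff)
    qed
    have "lex_less (\<tau> ` R) (insert t' S)"
    proof -
      have "card (\<tau> ` R) = card R" by (simp add: card_image injR)
      moreover have "p \<in> \<tau> ` R - insert t' S" using p \<tau>small \<open>p < t\<close> t(3) by auto
      moreover have "\<forall>q<p. q \<in> \<tau> ` R \<longleftrightarrow> q \<in> insert t' S"
        using p(3) \<tau>small \<open>p < t\<close> t(3) by auto
      ultimately show ?thesis
        using cardR finS finR nin by (subst lex_less_iff) auto
    qed
    then have "minor f (\<tau> ` R) \<in> span_on K ?B" using img[OF R(1)] by (intro span_on_base) blast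
    moreover obtain c :: real where "minor g R = c *\<^sub>R minor f (\<tau> ` R)"
      using minor_g[OF finR] by blast
    ultimately show "minor g R \<in> span_on K ?B"
      by (simp only: subspace_scale[OF subspace_span_on])
  qed
  moreover have "\<tau> ` insert t S = insert t' S"
  proof -
    have "\<tau> s = s" if "s \<in> S" for s using that nin by (auto simp: \<tau>_def)
    then have "\<tau> ` S = S" by auto
    moreover have "\<tau> t = t'" by (simp add: \<tau>_def)
    ultimately show ?thesis by (simp only: image_insert)
  qed
  moreover obtain c :: real where "c \<noteq> 0" "minor g (insert t S) = c *\<^sub>R minor f (\<tau> ` insert t S)"
    using minor_g[OF finite.insertI[OF finS], of t] by blast
  ultimately have c: "c \<noteq> 0" "c *\<^sub>R minor f (insert t' S) \<in> span_on K ?B"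
    by simp_all
  have "minor f (insert t' S) \<in> span_on K ?B"
    using subspace_scale[OF subspace_span_on c(2), of "1 / c"] c(1) by simp
  then show False using in' by (simp add: shifted_faces_def)
qed

section \<open>Rational polynomials and the existence of generic reals\<close>

lemma monomial_superset:
  fixes m :: "'i \<Rightarrow>\<^sub>0 nat" and x :: "'i \<Rightarrow> real"
  assumes "finite A" "Poly_Mapping.keys m \<subseteq> A"
  shows "(\<Prod>i\<in>Poly_Mapping.keys m. x i ^ Poly_Mapping.lookup m i) = (\<Prod>i\<in>A. x i ^ Poly_Mapping.lookup m i)"
  using assms by (intro prod.mono_neutral_left) (auto simp: in_keys_iff)

lemma monomial_add:
  fixes m m' :: "'i \<Rightarrow>\<^sub>0 nat" and x :: "'i \<Rightarrow> real"
  shows "(\<Prod>i\<in>Poly_Mapping.keys (m + m'). x i ^ Poly_Mapping.lookup (m + m') i) =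
    (\<Prod>i\<in>Poly_Mapping.keys m. x i ^ Poly_Mapping.lookup m i) *
    (\<Prod>i\<in>Poly_Mapping.keys m'. x i ^ Poly_Mapping.lookup m' i)"
proof -
  let ?A = "Poly_Mapping.keys m \<union> Poly_Mapping.keys m'"
  have fin: "finite ?A" by simp
  show ?thesis
    unfolding monomial_superset[OF fin keys_add] monomial_superset[OF fin Un_upper1]
      monomial_superset[OF fin Un_upper2]
    by (simp add: lookup_add power_add prod.distrib)
qed

lemma eval_rat_poly_superset:
  assumes "finite A" "Poly_Mapping.keys p \<subseteq> A"
  shows "eval_rat_poly x p = (\<Sum>m\<in>A. of_rat (Poly_Mapping.lookup p m) *
        (\<Prod>i\<in>Poly_Mapping.keys m. x i ^ Poly_Mapping.lookup m i))"
  unfolding eval_rat_poly_def using assms by (intro sum.mono_neutral_left) (auto simp: in_keys_iff)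

lemma eval_rat_poly_add: "eval_rat_poly x (p + q) = eval_rat_poly x p + eval_rat_poly x q"
proof -
  let ?A = "Poly_Mapping.keys p \<union> Poly_Mapping.keys q"
  have fin: "finite ?A" by simp
  show ?thesis
    unfolding eval_rat_poly_superset[OF fin keys_add] eval_rat_poly_superset[OF fin Un_upper1]
      eval_rat_poly_superset[OF fin Un_upper2]
    by (simp add: lookup_add of_rat_add distrib_right sum.distrib)
qed

lemma eval_rat_poly_sum: "eval_rat_poly x (\<Sum>a\<in>A. p a) = (\<Sum>a\<in>A. eval_rat_poly x (p a))"
  by (induction A rule: infinite_finite_induct) (auto simp: eval_rat_poly_add, auto simp: eval_rat_poly_def)

lemma eval_rat_poly_single:
  "eval_rat_poly x (Poly_Mapping.single m c) =
    of_rat c * (\<Prod>i\<in>Poly_Mapping.keys m. x i ^ Poly_Mapping.lookup m i)"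
  by (subst eval_rat_poly_superset[of "{m}"]) auto

lemma poly_mapping_sum_single:
  "p = (\<Sum>m\<in>Poly_Mapping.keys p. Poly_Mapping.single m (Poly_Mapping.lookup p m))"
  by (rule poly_mapping_eqI) (auto simp: lookup_sum lookup_single when_def in_keys_iff sum.delta)

lemma eval_rat_poly_mult: "eval_rat_poly x (p * q) = eval_rat_poly x p * eval_rat_poly x q"
proof -
  let ?s = "\<lambda>p m. Poly_Mapping.single m (Poly_Mapping.lookup p m)"
  have "p * q = (\<Sum>m\<in>Poly_Mapping.keys p. ?s p m) * (\<Sum>m\<in>Poly_Mapping.keys q. ?s q m)"
    using poly_mapping_sum_single[of p] poly_mapping_sum_single[of q] by metis
  then have "p * q = (\<Sum>m\<in>Poly_Mapping.keys p. \<Sum>m'\<in>Poly_Mapping.keys q. ?s p m * ?s q m')"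
    by (simp only: sum_product)
  then show ?thesis
    unfolding eval_rat_poly_def[of x p] eval_rat_poly_def[of x q]
    by (simp add: eval_rat_poly_sum mult_single eval_rat_poly_single monomial_add sum_product of_rat_mult mult_ac)
qed

lemma polyfun_eval_rat_poly:
  assumes "p \<in> polyfun I"
  shows "\<exists>q. (\<forall>m\<in>Poly_Mapping.keys q. Poly_Mapping.keys m \<subseteq> I) \<and> (\<forall>x. eval_rat_poly x q = p x)"
  using assms
proof induction
  case (const c)
  show ?case
    by (rule exI[of _ "Poly_Mapping.single 0 c"]) (auto simp: eval_rat_poly_single)
next
  case (var i)
  then show ?case
    by (intro exI[of _ "Poly_Mapping.single (Poly_Mapping.single i 1) 1"]) (auto simp: eval_rat_poly_single)
next
  case (add p q)
  then obtain p' q' where pq: "\<forall>m\<in>Poly_Mapping.keys p'. Poly_Mapping.keys m \<subseteq> I" "\<forall>x. eval_rat_poly x p' = p x"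
    "\<forall>m\<in>Poly_Mapping.keys q'. Poly_Mapping.keys m \<subseteq> I" "\<forall>x. eval_rat_poly x q' = q x"
    by blast
  have "Poly_Mapping.keys m \<subseteq> I" if "m \<in> Poly_Mapping.keys (p' + q')" for m
    using keys_add[of p' q'] that pq(1,3) by blast
  then show ?case
    using pq by (intro exI[of _ "p' + q'"]) (simp add: eval_rat_poly_add)
next
  case (mult p q)
  then obtain p' q' where pq: "\<forall>m\<in>Poly_Mapping.keys p'. Poly_Mapping.keys m \<subseteq> I" "\<forall>x. eval_rat_poly x p' = p x"
    "\<forall>m\<in>Poly_Mapping.keys q'. Poly_Mapping.keys m \<subseteq> I" "\<forall>x. eval_rat_poly x q' = q x"
    by blast
  have "Poly_Mapping.keys m \<subseteq> I" if m: "m \<in> Poly_Mapping.keys (p' * q')" for m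
  proof -
    obtain a b where "m = a + b" "a \<in> Poly_Mapping.keys p'" "b \<in> Poly_Mapping.keys q'"
      using keys_mult[of p' q'] m by blast
    then show ?thesis using keys_add[of a b] pq by blast
  qed
  then show ?case
    using pq by (intro exI[of _ "p' * q'"]) (simp add: eval_rat_poly_mult)
qed

lemma algebraically_independent_generic:
  assumes "algebraically_independent I x"
  shows "generic I x"
  unfolding generic_def
proof (intro ballI impI allI)
  fix p y assume "p \<in> polyfun I" "p x = 0"
  then obtain q where q: "\<forall>m\<in>Poly_Mapping.keys q. Poly_Mapping.keys m \<subseteq> I" "\<forall>x. eval_rat_poly x q = p x"
    using polyfun_eval_rat_poly by blast
  have "eval_rat_poly x q = 0" using q(2) \<open>p x = 0\<close> by simp
  then have "q = 0" using assms q(1) unfolding algebraically_independent_def by blast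
  then show "p y = 0" using q(2)[rule_format, of y] by (simp add: eval_rat_poly_def)
qed

text \<open>A finitely supported map is determined by its graph over the support, a finite subset of
  a countable set.\<close>

lemma countable_poly_mapping:
  "countable (UNIV :: ('a::countable \<Rightarrow>\<^sub>0 'b::{zero, countable}) set)"
proof -
  let ?g = "\<lambda>p :: 'a \<Rightarrow>\<^sub>0 'b. {(k, Poly_Mapping.lookup p k) | k. k \<in> Poly_Mapping.keys p}"
  have "inj ?g"
  proof (rule injI, rule poly_mapping_eqI)
    fix p q :: "'a \<Rightarrow>\<^sub>0 'b" and k assume eq: "?g p = ?g q"
    have mem: "(k, c) \<in> ?g r \<longleftrightarrow> c = Poly_Mapping.lookup r k \<and> c \<noteq> 0" for r c
      by (auto simp: in_keys_iff)
    have "(k, c) \<in> ?g p \<longleftrightarrow> (k, c) \<in> ?g q" for c unfolding eq ..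
    then show "Poly_Mapping.lookup p k = Poly_Mapping.lookup q k" unfolding mem by metis
  qed
  moreover have "countable (range ?g)"
    by (rule countable_subset[OF _ countable_Collect_finite]) auto
  ultimately show ?thesis using countable_image_inj_on by blast
qed

instance poly_mapping :: (countable, "{zero, countable}") countable
  by standard (use countable_poly_mapping in \<open>auto simp: countable_def\<close>)

text \<open>With the other variables fixed at \<open>x\<close>, the value is a univariate polynomial
  in \<open>r\<close>. One of its coefficients is a nonzero rational polynomial in the variables of
  \<open>I\<close>, evaluated at \<open>x\<close>, and is therefore nonzero.\<close>

lemma finite_roots_eval_rat_poly:
  assumes x: "algebraically_independent I x" and i: "i \<notin> I"
    and p: "p \<noteq> 0" "\<forall>m\<in>Poly_Mapping.keys p. Poly_Mapping.keys m \<subseteq> insert i I"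
  shows "finite {r. eval_rat_poly (x(i := r)) p = 0}"
proof -
  \<comment> \<open>The monomial \<open>m\<close> with the variable \<open>i\<close>
    deleted.\<close>
  define dr where "dr m = m - Poly_Mapping.single i (Poly_Mapping.lookup m i)" for m :: "'a \<Rightarrow>\<^sub>0 nat"
  define mon where "mon m = (\<Prod>j\<in>Poly_Mapping.keys m. x j ^ Poly_Mapping.lookup m j)" for m :: "'a \<Rightarrow>\<^sub>0 nat"
  have dr: "Poly_Mapping.lookup (dr m) j = (if j = i then 0 else Poly_Mapping.lookup m j)" for m j
    by (simp add: dr_def lookup_minus lookup_single when_def)
  have keys_dr: "Poly_Mapping.keys (dr m) = Poly_Mapping.keys m - {i}" for m
    by (auto simp: in_keys_iff dr split: if_splits)
  have mon_upd: "(\<Prod>j\<in>Poly_Mapping.keys m. (x(i := r)) j ^ Poly_Mapping.lookup m j) = r ^ Poly_Mapping.lookup m i * mon (dr m)" for m r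
  proof -
    have "(\<Prod>j\<in>Poly_Mapping.keys m. (x(i := r)) j ^ Poly_Mapping.lookup m j) =
        (\<Prod>j\<in>insert i (Poly_Mapping.keys m). (x(i := r)) j ^ Poly_Mapping.lookup m j)"
      by (rule monomial_superset) auto
    also have "\<dots> = r ^ Poly_Mapping.lookup m i * (\<Prod>j\<in>Poly_Mapping.keys m - {i}. (x(i := r)) j ^ Poly_Mapping.lookup m j)"
      by (subst prod.insert_remove) auto
    also have "(\<Prod>j\<in>Poly_Mapping.keys m - {i}. (x(i := r)) j ^ Poly_Mapping.lookup m j) = mon (dr m)"
      unfolding mon_def keys_dr by (intro prod.cong) (auto simp: dr)
    finally show ?thesis .
  qed
  define Q where "Q = (\<Sum>m\<in>Poly_Mapping.keys p. monom (of_rat (Poly_Mapping.lookup p m) * mon (dr m)) (Poly_Mapping.lookup m i))"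
  have "eval_rat_poly (x(i := r)) p = poly Q r" for r
    unfolding eval_rat_poly_def Q_def mon_upd by (simp add: poly_sum poly_monom mult_ac)
  moreover have "Q \<noteq> 0"
  proof -
    obtain m0 where m0: "m0 \<in> Poly_Mapping.keys p" using p(1) by (metis all_not_in_conv keys_eq_empty)
    \<comment> \<open>The monomials with the same power of \<open>i\<close> as \<open>m0\<close>. On
      these \<open>dr\<close> identifies no monomial with \<open>m0\<close>, so the term of
      \<open>m0\<close> cannot cancel in \<open>q\<close>.\<close>
    define M where "M = {m \<in> Poly_Mapping.keys p. Poly_Mapping.lookup m i = Poly_Mapping.lookup m0 i}"
    define q where "q = (\<Sum>m\<in>M. Poly_Mapping.single (dr m) (Poly_Mapping.lookup p m))"
    have fin: "finite M" by (simp add: M_def)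
    have dr_eq: "dr m = dr m0 \<longleftrightarrow> m = m0" if "m \<in> M" for m
    proof
      assume eq: "dr m = dr m0"
      show "m = m0"
      proof (rule poly_mapping_eqI)
        show "Poly_Mapping.lookup m j = Poly_Mapping.lookup m0 j" for j
          using that dr[of m j] dr[of m0 j] eq by (cases "j = i") (auto simp: M_def)
      qed
    qed simp
    have "Poly_Mapping.lookup q (dr m0) = (\<Sum>m\<in>M. if m = m0 then Poly_Mapping.lookup p m else 0)"
      unfolding q_def lookup_sum by (intro sum.cong) (auto simp: lookup_single when_def dr_eq)
    also have "\<dots> \<noteq> 0" using m0 fin by (simp add: M_def in_keys_iff)
    finally have "q \<noteq> 0" by auto
    moreover have "Poly_Mapping.keys m \<subseteq> I" if "m \<in> Poly_Mapping.keys q" for m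
    proof -
      have "(\<Sum>m'\<in>M. Poly_Mapping.lookup (Poly_Mapping.single (dr m') (Poly_Mapping.lookup p m')) m) \<noteq> 0"
        using that by (simp add: q_def lookup_sum in_keys_iff)
      then obtain m' where "m' \<in> M" "Poly_Mapping.lookup (Poly_Mapping.single (dr m') (Poly_Mapping.lookup p m')) m \<noteq> 0"
        by (meson sum.neutral)
      then have "m = dr m'" "m' \<in> Poly_Mapping.keys p" by (auto simp: M_def lookup_single when_def split: if_splits)
      then show ?thesis using p(2) by (auto simp: keys_dr)
    qed
    ultimately have "eval_rat_poly x q \<noteq> 0" using x unfolding algebraically_independent_def by blast
    also have "eval_rat_poly x q = (\<Sum>m\<in>M. of_rat (Poly_Mapping.lookup p m) * mon (dr m))"
      unfolding q_def by (simp add: eval_rat_poly_sum eval_rat_poly_single mon_def)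
    also have "\<dots> = coeff Q (Poly_Mapping.lookup m0 i)"
      unfolding Q_def coeff_sum coeff_monom M_def by (simp add: sum.inter_filter)
    finally show ?thesis by auto
  qed
  ultimately show ?thesis using poly_roots_finite[of Q] by simp
qed

text \<open>Variables are adjoined one at a time. Countably many nonzero polynomials each exclude
  finitely many values, while the reals are uncountable.\<close>

lemma exists_algebraically_independent:
  assumes "finite (I :: 'i::countable set)"
  shows "\<exists>x. algebraically_independent I x"
  using assms
proof (induction I rule: finite_induct)
  case empty
  have "p = 0" if "\<forall>m\<in>Poly_Mapping.keys p. Poly_Mapping.keys m \<subseteq> {}" "eval_rat_poly x p = 0"
    for x and p :: "('i \<Rightarrow>\<^sub>0 nat) \<Rightarrow>\<^sub>0 rat"
  proof (rule poly_mapping_eqI)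
    fix m
    have sub: "Poly_Mapping.keys p \<subseteq> {0}" using that(1) by auto
    then have "Poly_Mapping.lookup p 0 = 0"
      using that(2) eval_rat_poly_superset[of "{0}" p x] by simp
    then show "Poly_Mapping.lookup p m = Poly_Mapping.lookup 0 m"
      using sub by (cases "m = 0") (auto simp: in_keys_iff)
  qed
  then show ?case unfolding algebraically_independent_def by blast
next
  case (insert i I)
  then obtain x where x: "algebraically_independent I x" by blast
  let ?P = "{p :: ('i \<Rightarrow>\<^sub>0 nat) \<Rightarrow>\<^sub>0 rat. p \<noteq> 0 \<and> (\<forall>m\<in>Poly_Mapping.keys p. Poly_Mapping.keys m \<subseteq> insert i I)}"
  have "countable ?P" by (rule countable_subset[OF subset_UNIV countable_poly_mapping])
  then have cnt: "countable (\<Union>p\<in>?P. {r. eval_rat_poly (x(i := r)) p = 0})"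
    using finite_roots_eval_rat_poly[OF x insert.hyps(2)]
    by (intro countable_UN) (auto intro: countable_finite)
  have "(\<Union>p\<in>?P. {r. eval_rat_poly (x(i := r)) p = 0}) \<noteq> UNIV"
  proof
    assume "(\<Union>p\<in>?P. {r. eval_rat_poly (x(i := r)) p = 0}) = UNIV"
    from cnt[unfolded this] show False using uncountable_UNIV_real by blast
  qed
  then obtain r where r: "r \<notin> (\<Union>p\<in>?P. {r. eval_rat_poly (x(i := r)) p = 0})"
    by blast
  then have "algebraically_independent (insert i I) (x(i := r))"
    unfolding algebraically_independent_def by blast
  then show ?case by blast
qed

section \<open>Coordinates of the exterior algebra\<close>

lemma lookup_scaleR: "Poly_Mapping.lookup (r *\<^sub>R x) S = r * Poly_Mapping.lookup x S"
  for x :: "'a \<Rightarrow>\<^sub>0 real"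
proof -
  have "finite {i. r *\<^sub>R Poly_Mapping.lookup x i \<noteq> 0}"
    by (rule finite_subset[OF _ finite_keys[of x]]) (auto simp: in_keys_iff)
  then show ?thesis by (simp add: scaleR_poly_mapping_def)
qed

lemma lookup_ext_basis: "Poly_Mapping.lookup (ext_basis S) T = (if S = T then 1 else 0)"
  by (simp add: ext_basis_def lookup_single when_def)

lemma lookup_wedge_basis:
  "Poly_Mapping.lookup (wedge_basis S T) F =
    (if S \<inter> T = {} \<and> S \<union> T = F then (- 1) ^ card {(s, t). s \<in> S \<and> t \<in> T \<and> t < s} else 0)"
  by (simp add: wedge_basis_def lookup_scaleR lookup_ext_basis)

lemma lookup_wedge:
  "Poly_Mapping.lookup (wedge x y) F =
    (\<Sum>S\<in>Poly_Mapping.keys x. \<Sum>T\<in>Poly_Mapping.keys y.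
      Poly_Mapping.lookup x S * Poly_Mapping.lookup y T * Poly_Mapping.lookup (wedge_basis S T) F)"
  by (simp add: wedge_def lookup_sum lookup_scaleR)

lemma keys_wedge:
  assumes "F \<in> Poly_Mapping.keys (wedge x y)"
  obtains S T where "S \<in> Poly_Mapping.keys x" "T \<in> Poly_Mapping.keys y" "F = S \<union> T"
proof -
  have "Poly_Mapping.lookup (wedge x y) F \<noteq> 0" using assms by (simp add: in_keys_iff)
  then obtain S T where "S \<in> Poly_Mapping.keys x" "T \<in> Poly_Mapping.keys y"
      "Poly_Mapping.lookup x S * Poly_Mapping.lookup y T * Poly_Mapping.lookup (wedge_basis S T) F \<noteq> 0"
    unfolding lookup_wedge by (meson sum.neutral)
  moreover from this have "F = S \<union> T" by (auto simp: lookup_wedge_basis split: if_splits)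
  ultimately show thesis using that by blast
qed

lemma wedge_superset:
  assumes "finite A" "Poly_Mapping.keys x \<subseteq> A"
  shows "Poly_Mapping.lookup (wedge x y) F =
    (\<Sum>S\<in>A. \<Sum>T\<in>Poly_Mapping.keys y.
      Poly_Mapping.lookup x S * Poly_Mapping.lookup y T * Poly_Mapping.lookup (wedge_basis S T) F)"
  unfolding lookup_wedge using assms by (intro sum.mono_neutral_left) (auto simp: in_keys_iff)

text \<open>Entries outside column range 1 to n are set to zero, as in \<open>gen_vec\<close>, so
  minors are right at sets outside that range too.\<close>

definition rows_of :: "nat \<Rightarrow> (nat \<Rightarrow> nat \<Rightarrow> real) \<Rightarrow> nat \<Rightarrow> nat \<Rightarrow> real" where
  "rows_of n \<alpha> i j = (if j \<in> {1..n} then \<alpha> i j else 0)"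

lemma lookup_gen_vec:
  "Poly_Mapping.lookup (gen_vec n \<alpha> i) S = (\<Sum>j = 1..n. if S = {j} then \<alpha> i j else 0)"
  unfolding gen_vec_def lookup_sum by (intro sum.cong) (auto simp: lookup_scaleR lookup_ext_basis)

lemma lookup_gen_vec_singleton:
  "Poly_Mapping.lookup (gen_vec n \<alpha> i) {j} = rows_of n \<alpha> i j"
  unfolding lookup_gen_vec rows_of_def by (simp add: sum.delta)

lemma keys_gen_vec: "Poly_Mapping.keys (gen_vec n \<alpha> i) \<subseteq> (\<lambda>j. {j}) ` {1..n}"
  by (auto simp: in_keys_iff lookup_gen_vec elim!: sum.not_neutral_contains_not_neutral split: if_splits)

text \<open>For a singleton first factor the sign in \<open>wedge_basis\<close> counts the elements
  of \<open>F\<close> below \<open>j\<close>, which is the sign in \<open>lmul\<close>.\<close>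

lemma lookup_wedge_gen_vec:
  assumes F: "finite F"
  shows "Poly_Mapping.lookup (wedge (gen_vec n \<alpha> i) x) F = lmul (rows_of n \<alpha> i) (Poly_Mapping.lookup x) F"
proof -
  have inner: "(\<Sum>T\<in>Poly_Mapping.keys x. rows_of n \<alpha> i j * Poly_Mapping.lookup x T * Poly_Mapping.lookup (wedge_basis {j} T) F)
     = (if j \<in> F then (- 1) ^ card {t \<in> F. t < j} * rows_of n \<alpha> i j * Poly_Mapping.lookup x (F - {j}) else 0)" for j
  proof -
    have card: "card {(s, t). s \<in> {j} \<and> t \<in> F - {j} \<and> t < s} = card {t \<in> F. t < j}"
    proof -
      have "{(s, t). s \<in> {j} \<and> t \<in> F - {j} \<and> t < s} = Pair j ` {t \<in> F. t < j}" by auto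
      then show ?thesis by (simp add: card_image inj_on_def)
    qed
    have "(\<Sum>T\<in>Poly_Mapping.keys x. rows_of n \<alpha> i j * Poly_Mapping.lookup x T * Poly_Mapping.lookup (wedge_basis {j} T) F)
      = (\<Sum>T\<in>Poly_Mapping.keys x. if T = F - {j} then
          (if j \<in> F then (- 1) ^ card {t \<in> F. t < j} * rows_of n \<alpha> i j * Poly_Mapping.lookup x T else 0) else 0)"
    proof (intro sum.cong refl)
      fix T
      show "rows_of n \<alpha> i j * Poly_Mapping.lookup x T * Poly_Mapping.lookup (wedge_basis {j} T) F =
        (if T = F - {j} then (if j \<in> F then (- 1) ^ card {t \<in> F. t < j} * rows_of n \<alpha> i j * Poly_Mapping.lookup x T else 0) else 0)"
      proof (cases "T = F - {j} \<and> j \<in> F")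
        case True
        then have e: "{j} \<inter> T = {} \<and> {j} \<union> T = F" by auto
        have c: "card {(s, t). s \<in> {j} \<and> t \<in> T \<and> t < s} = card {t \<in> F. t < j}"
          using True card by simp
        show ?thesis unfolding lookup_wedge_basis if_P[OF e] c using True by simp
      next
        case False
        then have e: "\<not> ({j} \<inter> T = {} \<and> {j} \<union> T = F)" by auto
        show ?thesis
          unfolding lookup_wedge_basis if_not_P[OF e]
          by (cases "j \<in> F") (use False in \<open>simp_all only: simp_thms if_True if_False mult_zero_right if_cancel\<close>)
      qed
    qed
    then show ?thesis by (simp add: sum.delta in_keys_iff)
  qed
  have "Poly_Mapping.lookup (wedge (gen_vec n \<alpha> i) x) F =
      (\<Sum>S\<in>(\<lambda>j. {j}) ` {1..n}. \<Sum>T\<in>Poly_Mapping.keys x.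
      Poly_Mapping.lookup (gen_vec n \<alpha> i) S * Poly_Mapping.lookup x T * Poly_Mapping.lookup (wedge_basis S T) F)"
    by (rule wedge_superset[OF _ keys_gen_vec]) simp
  also have "\<dots> = (\<Sum>j = 1..n. \<Sum>T\<in>Poly_Mapping.keys x.
      rows_of n \<alpha> i j * Poly_Mapping.lookup x T * Poly_Mapping.lookup (wedge_basis {j} T) F)"
    by (subst sum.reindex) (auto simp: inj_on_def lookup_gen_vec_singleton)
  also have "\<dots> = (\<Sum>j = 1..n. if j \<in> F then (- 1) ^ card {t \<in> F. t < j} * rows_of n \<alpha> i j * Poly_Mapping.lookup x (F - {j}) else 0)"
    by (simp only: inner)
  also have "\<dots> = (\<Sum>j\<in>{1..n} \<inter> F. (- 1) ^ card {t \<in> F. t < j} * rows_of n \<alpha> i j * Poly_Mapping.lookup x (F - {j}))"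
    by (simp add: sum.inter_restrict)
  also have "\<dots> = lmul (rows_of n \<alpha> i) (Poly_Mapping.lookup x) F"
    unfolding lmul_def using F by (intro sum.mono_neutral_left) (auto simp: rows_of_def)
  finally show ?thesis .
qed

lemma lookup_gen_ext:
  assumes "finite F"
  shows "Poly_Mapping.lookup (gen_ext n \<alpha> S) F = minor (rows_of n \<alpha>) S F"
proof -
  have "Poly_Mapping.lookup (foldr wedge (map (gen_vec n \<alpha>) ls) (ext_basis {})) F = wprod (map (rows_of n \<alpha>) ls) F"
    for ls
    using assms
  proof (induction ls arbitrary: F)
    case Nil
    then show ?case by (simp add: lookup_ext_basis wprod_Nil)
  next
    case (Cons l ls)
    then show ?case by (simp add: lookup_wedge_gen_vec) (intro lmul_cong, auto)
  qed
  then show ?thesis by (simp add: gen_ext_def minor_def)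
qed

lemma keys_gen_ext: "Poly_Mapping.keys (gen_ext n \<alpha> S) \<subseteq> Pow {1..n}"
proof -
  have "Poly_Mapping.keys (foldr wedge (map (gen_vec n \<alpha>) ls) (ext_basis {})) \<subseteq> Pow {1..n}" for ls
  proof (induction ls)
    case Nil
    then show ?case by (auto simp: in_keys_iff lookup_ext_basis split: if_splits)
  next
    case (Cons l ls)
    show ?case
    proof
      fix F assume "F \<in> Poly_Mapping.keys (foldr wedge (map (gen_vec n \<alpha>) (l # ls)) (ext_basis {}))"
      then have "F \<in> Poly_Mapping.keys (wedge (gen_vec n \<alpha> l) (foldr wedge (map (gen_vec n \<alpha>) ls) (ext_basis {})))"
        by simp
      then obtain S T where "S \<in> Poly_Mapping.keys (gen_vec n \<alpha> l)"
        "T \<in> Poly_Mapping.keys (foldr wedge (map (gen_vec n \<alpha>) ls) (ext_basis {}))" "F = S \<union> T"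
        by (rule keys_wedge)
      then show "F \<in> Pow {1..n}" using keys_gen_vec[of n \<alpha> l] Cons.IH by blast
    qed
  qed
  then show ?thesis by (simp add: gen_ext_def)
qed

lemma subspace_keys: "subspace {x :: 'a \<Rightarrow>\<^sub>0 real. Poly_Mapping.keys x \<subseteq> A}"
proof (rule subspaceI)
  show "x + y \<in> {x. Poly_Mapping.keys x \<subseteq> A}" if "x \<in> {x. Poly_Mapping.keys x \<subseteq> A}" "y \<in> {x. Poly_Mapping.keys x \<subseteq> A}"
    for x y :: "'a \<Rightarrow>\<^sub>0 real"
    using that keys_add[of x y] by blast
  show "c *\<^sub>R x \<in> {x. Poly_Mapping.keys x \<subseteq> A}" if "x \<in> {x. Poly_Mapping.keys x \<subseteq> A}" for c and x :: "'a \<Rightarrow>\<^sub>0 real"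
    using that by (auto simp: in_keys_iff lookup_scaleR)
qed simp

lemma wedge_unit: "wedge (ext_basis {}) x = x" "wedge x (ext_basis {}) = x"
proof -
  have k: "Poly_Mapping.keys (ext_basis {}) = {{}}"
    by (auto simp: in_keys_iff lookup_ext_basis split: if_splits)
  have b: "wedge_basis {} S = ext_basis S" "wedge_basis S {} = ext_basis S" for S
    by (simp_all add: wedge_basis_def)
  have "x = (\<Sum>S\<in>Poly_Mapping.keys x. Poly_Mapping.lookup x S *\<^sub>R ext_basis S)"
    by (rule poly_mapping_eqI) (simp add: lookup_sum lookup_scaleR lookup_ext_basis in_keys_iff if_distrib sum.delta cong: if_cong)
  then show "wedge (ext_basis {}) x = x" "wedge x (ext_basis {}) = x"
    by (simp_all add: wedge_def k b lookup_ext_basis)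
qed

text \<open>Every basis set in a multiple of a nonface generator contains that nonface, so it is no
  face of the downward closed \<open>K\<close>. Conversely each nonface generator lies in the ideal,
  with the unit \<open>ext_basis {}\<close> on both sides.\<close>

lemma mem_face_ideal:
  assumes K: "abstract_complex K" and x: "Poly_Mapping.keys x \<subseteq> Pow {1..n}"
  shows "x \<in> face_ideal n K \<longleftrightarrow> (\<forall>T\<in>K. Poly_Mapping.lookup x T = 0)"
proof
  assume "x \<in> face_ideal n K"
  then have "x \<in> {x. Poly_Mapping.keys x \<subseteq> - K}"
    unfolding face_ideal_def
  proof (rule subsetD[OF span_minimal[OF _ subspace_keys], rotated], clarify)
    fix a b T F assume T: "T \<notin> K" and F: "F \<in> Poly_Mapping.keys (wedge a (wedge (ext_basis T) b))" "F \<in> K"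
    obtain S G where "G \<in> Poly_Mapping.keys (wedge (ext_basis T) b)" "F = S \<union> G"
      using keys_wedge[OF F(1)] by metis
    moreover from this obtain S' G' where "S' \<in> Poly_Mapping.keys (ext_basis T)" "G = S' \<union> G'"
      using keys_wedge by metis
    moreover from this have "S' = T" by (auto simp: in_keys_iff lookup_ext_basis split: if_splits)
    ultimately have "T \<subseteq> F" by blast
    then show False using K F(2) T unfolding abstract_complex_def by blast
  qed
  then show "\<forall>T\<in>K. Poly_Mapping.lookup x T = 0" by (auto simp: in_keys_iff subset_iff)
next
  assume 0: "\<forall>T\<in>K. Poly_Mapping.lookup x T = 0"
  have "x = (\<Sum>S\<in>Poly_Mapping.keys x. Poly_Mapping.lookup x S *\<^sub>R ext_basis S)"
    by (rule poly_mapping_eqI) (simp add: lookup_sum lookup_scaleR lookup_ext_basis in_keys_iff if_distrib sum.delta cong: if_cong)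
  also have "\<dots> \<in> face_ideal n K"
    unfolding face_ideal_def
  proof (intro span_sum span_scale span_base)
    fix S assume S: "S \<in> Poly_Mapping.keys x"
    have "ext_basis S = wedge (ext_basis {}) (wedge (ext_basis S) (ext_basis {}))" by (simp add: wedge_unit)
    moreover have "ext_basis {} \<in> ext_algebra n" unfolding ext_algebra_def by (intro span_base) blast
    moreover have "S \<subseteq> {1..n}" "S \<notin> K" using S x 0 by (auto simp: in_keys_iff)
    ultimately show "ext_basis S \<in> {wedge a (wedge (ext_basis T) b) | a T b.
             a \<in> ext_algebra n \<and> b \<in> ext_algebra n \<and> T \<subseteq> {1..n} \<and> T \<notin> K}" by blast
  qed
  finally show "x \<in> face_ideal n K" .
qed

lemma shifting_wrt_eq:
  assumes K: "abstract_complex K"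
  shows "shifting_wrt n \<alpha> K = shifted_faces n (rows_of n \<alpha>) K"
proof -
  have fin: "finite T" if "T \<in> K" for T using K that by (simp add: abstract_complex_def)
  have "(\<exists>v\<in>span {gen_ext n \<alpha> S' | S'. S' \<subseteq> {1..n} \<and> lex_less S' S}. gen_ext n \<alpha> S - v \<in> face_ideal n K) \<longleftrightarrow>
      minor (rows_of n \<alpha>) S \<in> span_on K {minor (rows_of n \<alpha>) R | R. R \<subseteq> {1..n} \<and> lex_less R S}" for S
  proof -
    let ?A = "{R. R \<subseteq> {1..n} \<and> lex_less R S}"
    have finA: "finite ?A" by simp
    have img: "{g R | R. R \<subseteq> {1..n} \<and> lex_less R S} = g ` ?A" for g :: "nat set \<Rightarrow> 'z" by blast
    have iff: "gen_ext n \<alpha> S - (\<Sum>R\<in>?A. a R *\<^sub>R gen_ext n \<alpha> R) \<in> face_ideal n K \<longleftrightarrow>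
        (\<forall>T\<in>K. minor (rows_of n \<alpha>) S T = (\<Sum>R\<in>?A. a R * minor (rows_of n \<alpha>) R T))" for a
    proof -
      have "gen_ext n \<alpha> S - (\<Sum>R\<in>?A. a R *\<^sub>R gen_ext n \<alpha> R) \<in> {x. Poly_Mapping.keys x \<subseteq> Pow {1..n}}"
        using keys_gen_ext by (intro subspace_diff subspace_sum subspace_scale subspace_keys) auto
      then show ?thesis
        by (simp add: mem_face_ideal[OF K] lookup_minus lookup_sum lookup_scaleR lookup_gen_ext fin)
    qed
    show ?thesis
      unfolding img span_image_finite[OF finA] mem_span_on_image[OF finA] using iff by simp
  qed
  then show ?thesis unfolding shifting_wrt_def shifted_faces_def by blast
qed

text \<open>Renaming the columns by \<open>\<theta>\<close> multiplies the coefficient at \<open>T\<close> by a sign that depends on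
  \<open>T\<close> only, which does not affect linear dependence.\<close>

definition inversions :: "(nat \<Rightarrow> nat) \<Rightarrow> nat set \<Rightarrow> nat" where
  "inversions \<theta> T = card {(a, b). a \<in> T \<and> b \<in> T \<and> a < b \<and> \<theta> b < \<theta> a}"

text \<open>\<open>Q\<close> and \<open>R\<close> collect the elements whose order relative to
  \<open>i\<close> is reversed by \<open>\<theta>\<close>. The positions of \<open>i\<close> after
  and before relabelling are \<open>P\<close> plus \<open>Q\<close> and \<open>P\<close> plus
  \<open>R\<close>, and removing \<open>i\<close> destroys exactly \<open>card Q + card R\<close>
  inversions, so the parities agree.\<close>

lemma inversions_remove:
  assumes "finite T" "i \<in> T" "inj_on \<theta> T"
  shows "(- 1 :: real) ^ card {t \<in> T. \<theta> t < \<theta> i} * (- 1) ^ inversions \<theta> T =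
    (- 1) ^ card {t \<in> T. t < i} * (- 1) ^ inversions \<theta> (T - {i})"
proof -
  define P where "P = {t \<in> T. t < i \<and> \<theta> t < \<theta> i}"
  define Q where "Q = {t \<in> T. i < t \<and> \<theta> t < \<theta> i}"
  define R where "R = {t \<in> T. t < i \<and> \<theta> i < \<theta> t}"
  have fin: "finite P" "finite Q" "finite R" using assms(1) by (auto simp: P_def Q_def R_def)
  have neq: "\<theta> t \<noteq> \<theta> i" if "t \<in> T" "t \<noteq> i" for t using that assms by (auto simp: inj_on_def)
  have "{t \<in> T. \<theta> t < \<theta> i} = P \<union> Q" by (auto simp: P_def Q_def) (metis less_irrefl linorder_neqE_nat)
  then have 1: "card {t \<in> T. \<theta> t < \<theta> i} = card P + card Q"
    using fin by (simp add: card_Un_disjoint P_def Q_def disjoint_iff)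
  have "{t \<in> T. t < i} = P \<union> R" using neq by (auto simp: P_def R_def) (metis less_irrefl linorder_neqE_nat)
  then have 2: "card {t \<in> T. t < i} = card P + card R"
    using fin by (simp add: card_Un_disjoint P_def R_def disjoint_iff)
  let ?I = "\<lambda>T. {(a, b). a \<in> T \<and> b \<in> T \<and> a < b \<and> \<theta> b < \<theta> a}"
  have finI: "finite (?I A)" if "finite A" for A
    by (rule finite_subset[of _ "A \<times> A"]) (use that in auto)
  let ?R = "(\<lambda>a. (a, i)) ` R" and ?Q = "Pair i ` Q"
  have I: "?I T = ?I (T - {i}) \<union> (?R \<union> ?Q)"
    using assms(2) by (auto simp: Q_def R_def)
  have d: "?I (T - {i}) \<inter> (?R \<union> ?Q) = {}" by auto
  have f1: "finite (?I (T - {i}))" by (rule finI) (simp add: assms(1))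
  have f2: "finite (?R \<union> ?Q)" using fin by simp
  have "card (?I T) = card (?I (T - {i})) + card (?R \<union> ?Q)"
    unfolding I by (rule card_Un_disjoint[OF f1 f2 d])
  also have "card (?R \<union> ?Q) = card ?R + card ?Q"
    using fin by (intro card_Un_disjoint) (auto simp: R_def)
  also have "\<dots> = card R + card Q"
    by (simp add: card_image inj_on_def)
  finally have 3: "inversions \<theta> T = inversions \<theta> (T - {i}) + (card R + card Q)"
    by (simp add: inversions_def)
  show ?thesis unfolding 1 2 3
    by (simp add: power_add minus_one_power_iff)
qed

lemma minor_relabel:
  assumes "finite T" "inj_on \<theta> T"
  shows "(- 1) ^ inversions \<theta> T * minor g S (\<theta> ` T) = minor (\<lambda>i j. g i (\<theta> j)) S T"
proof -
  have "(- 1) ^ inversions \<theta> T * wprod (map g ls) (\<theta> ` T) = wprod (map (\<lambda>i j. g i (\<theta> j)) ls) T" for ls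
    using assms
  proof (induction ls arbitrary: T)
    case Nil
    then show ?case by (simp add: wprod_Nil inversions_def)
  next
    case (Cons l ls)
    have "lmul (g l) (wprod (map g ls)) (\<theta> ` T) =
      (\<Sum>i\<in>T. (- 1) ^ card {t \<in> \<theta> ` T. t < \<theta> i} * g l (\<theta> i) * wprod (map g ls) (\<theta> ` T - {\<theta> i}))"
      unfolding lmul_def by (subst sum.reindex) (use Cons.prems in auto)
    then have "(- 1) ^ inversions \<theta> T * lmul (g l) (wprod (map g ls)) (\<theta> ` T) =
      (\<Sum>i\<in>T. (- 1) ^ card {t \<in> \<theta> ` T. t < \<theta> i} * (- 1) ^ inversions \<theta> T * g l (\<theta> i) * wprod (map g ls) (\<theta> ` T - {\<theta> i}))"
      by (simp add: sum_distrib_left mult_ac)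
    also have "\<dots> = (\<Sum>i\<in>T. (- 1) ^ card {t \<in> T. t < i} * g l (\<theta> i) * wprod (map (\<lambda>i j. g i (\<theta> j)) ls) (T - {i}))"
    proof (intro sum.cong refl)
      fix i assume i: "i \<in> T"
      have "{t \<in> \<theta> ` T. t < \<theta> i} = \<theta> ` {t \<in> T. \<theta> t < \<theta> i}" by auto
      then have c: "card {t \<in> \<theta> ` T. t < \<theta> i} = card {t \<in> T. \<theta> t < \<theta> i}"
        using card_image[OF inj_on_subset[OF Cons.prems(2)]] by (metis (no_types, lifting) mem_Collect_eq subsetI)
      have img: "\<theta> ` T - {\<theta> i} = \<theta> ` (T - {i})" using Cons.prems(2) i by (auto simp: inj_on_def)
      have IH: "(- 1) ^ inversions \<theta> (T - {i}) * wprod (map g ls) (\<theta> ` (T - {i})) =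
          wprod (map (\<lambda>i j. g i (\<theta> j)) ls) (T - {i})"
        using Cons.prems by (intro Cons.IH) (auto intro: inj_on_subset)
      show "(- 1) ^ card {t \<in> \<theta> ` T. t < \<theta> i} * (- 1) ^ inversions \<theta> T * g l (\<theta> i) * wprod (map g ls) (\<theta> ` T - {\<theta> i}) =
        (- 1) ^ card {t \<in> T. t < i} * g l (\<theta> i) * wprod (map (\<lambda>i j. g i (\<theta> j)) ls) (T - {i})"
        unfolding c img inversions_remove[OF Cons.prems(1) i Cons.prems(2)] IH [symmetric] by (simp add: mult_ac)
    qed
    finally show ?case by (simp add: lmul_def)
  qed
  then show ?thesis by (simp add: minor_def)
qed

lemma shifted_faces_relabel:
  assumes "inj_on \<theta> U" "finite U" "H \<subseteq> Pow U"
  shows "shifted_faces n g (relabel \<theta> H) = shifted_faces n (\<lambda>i j. g i (\<theta> j)) H"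
proof -
  have rel: "(- 1) ^ inversions \<theta> T * minor g S (\<theta> ` T) = minor (\<lambda>i j. g i (\<theta> j)) S T" if "T \<in> H" for S T
    using that assms by (intro minor_relabel) (auto intro: inj_on_subset finite_subset)
  have "minor g S \<in> span_on (relabel \<theta> H) {minor g R | R. R \<subseteq> {1..n} \<and> lex_less R S} \<longleftrightarrow>
      minor (\<lambda>i j. g i (\<theta> j)) S \<in> span_on H {minor (\<lambda>i j. g i (\<theta> j)) R | R. R \<subseteq> {1..n} \<and> lex_less R S}" for S
  proof -
    let ?A = "{R. R \<subseteq> {1..n} \<and> lex_less R S}"
    have finA: "finite ?A" by simp
    have img: "{h R | R. R \<subseteq> {1..n} \<and> lex_less R S} = h ` ?A" for h :: "nat set \<Rightarrow> 'z" by blast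
    have "minor g S (\<theta> ` T) = (\<Sum>R\<in>?A. a R * minor g R (\<theta> ` T)) \<longleftrightarrow>
        minor (\<lambda>i j. g i (\<theta> j)) S T = (\<Sum>R\<in>?A. a R * minor (\<lambda>i j. g i (\<theta> j)) R T)" if "T \<in> H" for a T
    proof -
      have "(\<Sum>R\<in>?A. a R * minor (\<lambda>i j. g i (\<theta> j)) R T) = (- 1) ^ inversions \<theta> T * (\<Sum>R\<in>?A. a R * minor g R (\<theta> ` T))"
        unfolding rel[OF that, symmetric] by (simp add: sum_distrib_left mult_ac)
      then show ?thesis unfolding rel[OF that, symmetric] by simp
    qed
    then show ?thesis
      unfolding img mem_span_on_image[OF finA] relabel_def by simp
  qed
  then show ?thesis unfolding shifted_faces_def by blast
qed

section \<open>Algebraic shifting of a gluing\<close>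

lemma abstract_complex_subset_Pow_vertices:
  assumes "abstract_complex K"
  shows "K \<subseteq> Pow (vertices K)"
proof
  fix F assume "F \<in> K"
  then have "{v} \<in> K" if "v \<in> F" for v
    using assms that unfolding abstract_complex_def by (metis empty_subsetI insert_subset)
  then show "F \<in> Pow (vertices K)" by (auto simp: vertices_def)
qed

lemma finite_vertices: "abstract_complex K \<Longrightarrow> finite (vertices K)"
proof -
  assume K: "abstract_complex K"
  have "vertices K \<subseteq> \<Union>K" unfolding vertices_def by blast
  then show ?thesis using K finite_subset[of _ "\<Union>K"] unfolding abstract_complex_def by blast
qed

lemma vertices_relabel: "vertices (relabel \<phi> K) = \<phi> ` vertices K" if "abstract_complex K"
proof (intro equalityI subsetI)
  fix w assume "w \<in> vertices (relabel \<phi> K)"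
  then obtain F where F: "F \<in> K" "{w} = \<phi> ` F" by (auto simp: vertices_def relabel_def)
  then obtain v where "v \<in> F" "w = \<phi> v" by blast
  then show "w \<in> \<phi> ` vertices K"
    using F(1) abstract_complex_subset_Pow_vertices[OF that] by blast
next
  show "w \<in> vertices (relabel \<phi> K)" if "w \<in> \<phi> ` vertices K" for w
    using that by (force simp: vertices_def relabel_def image_iff)
qed

lemma abstract_complex_relabel:
  assumes "abstract_complex K"
  shows "abstract_complex (relabel \<phi> K)"
  unfolding abstract_complex_def relabel_def
proof (intro conjI)
  show "finite ((`) \<phi> ` K)" "\<forall>F\<in>(`) \<phi> ` K. finite F" "{} \<in> (`) \<phi> ` K"
    using assms unfolding abstract_complex_def by auto
  show "\<forall>F\<in>(`) \<phi> ` K. \<forall>G. G \<subseteq> F \<longrightarrow> G \<in> (`) \<phi> ` K"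
  proof clarify
    fix F G assume "F \<in> K" "G \<subseteq> \<phi> ` F"
    then obtain F' where "F' \<subseteq> F" "G = \<phi> ` F'" by (meson subset_image_iff)
    then show "G \<in> (`) \<phi> ` K" using assms \<open>F \<in> K\<close> unfolding abstract_complex_def by blast
  qed
qed

lemma relabel_relabel: "relabel \<psi> (relabel \<phi> K) = relabel (\<psi> \<circ> \<phi>) K"
  by (simp add: relabel_def image_image comp_def)

lemma relabel_cong:
  assumes "\<And>v. v \<in> \<Union>K \<Longrightarrow> \<phi> v = \<psi> v"
  shows "relabel \<phi> K = relabel \<psi> K"
  unfolding relabel_def
proof (rule image_cong[OF refl])
  show "\<phi> ` F = \<psi> ` F" if "F \<in> K" for F
    by (rule image_cong[OF refl]) (use assms that in blast)
qed

lemma relabel_id: "relabel id K = K"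
  by (simp add: relabel_def)

section \<open>Independence of \<open>\<Delta>\<close> from the choices\<close>

lemma generic_rows_of:
  assumes "generic_matrix n \<alpha>"
  shows "generic ({1..n} \<times> {1..n}) (case_prod (rows_of n \<alpha>))"
proof -
  have "generic ({1..n} \<times> {1..n}) (case_prod \<alpha>)"
    using assms algebraically_independent_generic unfolding generic_matrix_def by blast
  then show ?thesis by (rule generic_cong) (auto simp: rows_of_def)
qed

lemma generic_matrix_exists: "\<exists>\<alpha>. generic_matrix n \<alpha>"
proof -
  obtain x where "algebraically_independent ({1..n} \<times> {1..n}) (x :: nat \<times> nat \<Rightarrow> real)"
    using exists_algebraically_independent[of "{1..n} \<times> {1..n}"] by auto
  then have "generic_matrix n (\<lambda>i j. x (i, j))"
    by (simp add: generic_matrix_def)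
  then show ?thesis by blast
qed

text \<open>Matrices of different sizes are made comparable by cutting both to their first
  \<open>card U\<close> rows. There one generic matrix may replace the other, once the second
  labelling has been moved from the complex to the columns.\<close>

lemma shifting_wrt_relabel_eq:
  fixes H :: "'a set set"
  assumes H: "abstract_complex H"
    and "generic_matrix n \<alpha>" "inj_on \<phi> (vertices H)" "\<phi> ` vertices H \<subseteq> {1..n}"
    and "generic_matrix n' \<alpha>'" "inj_on \<psi> (vertices H)" "\<psi> ` vertices H \<subseteq> {1..n'}"
  shows "shifting_wrt n \<alpha> (relabel \<phi> H) = shifting_wrt n' \<alpha>' (relabel \<psi> H)"
proof -
  let ?V = "vertices H"
  define U where "U = \<phi> ` ?V"
  \<comment> \<open>Carries the labels given by \<open>\<phi>\<close> to those given by
    \<open>\<psi>\<close>.\<close>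
  define \<theta> where "\<theta> = \<psi> \<circ> inv_into ?V \<phi>"
  let ?H1 = "relabel \<phi> H"
  let ?f = "rows_of n \<alpha>" and ?g = "\<lambda>i j. rows_of n' \<alpha>' i (\<theta> j)"
  have U: "finite U" "?H1 \<subseteq> Pow U" "U \<subseteq> {1..n}"
    using finite_vertices[OF H] abstract_complex_subset_Pow_vertices[OF H] assms(4)
    unfolding U_def relabel_def by auto
  have \<theta>U: "\<theta> ` U = \<psi> ` ?V"
    unfolding U_def \<theta>_def image_image using assms(3) by (intro image_cong) auto
  have inj\<theta>: "inj_on \<theta> U"
    unfolding \<theta>_def U_def
    by (intro comp_inj_on inj_on_inv_into inj_on_subset[OF assms(6)]) (auto simp: inv_into_into)
  have cn: "card U \<le> n" using card_mono[OF _ U(3)] by simp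
  have cn': "card U \<le> n'"
    using card_mono[OF _ assms(7)] card_image[OF inj\<theta>] \<theta>U by simp
  have rel: "relabel \<psi> H = relabel \<theta> ?H1"
    unfolding relabel_relabel
  proof (rule relabel_cong)
    fix v assume "v \<in> \<Union>H"
    then have "v \<in> ?V" using abstract_complex_subset_Pow_vertices[OF H] by blast
    then show "\<psi> v = (\<theta> \<circ> \<phi>) v" using assms(3) by (simp add: \<theta>_def)
  qed
  have gen_f: "generic ({1..n} \<times> U) (case_prod ?f)"
    by (rule generic_mono[OF generic_rows_of[OF assms(2)]]) (use U(3) in auto)
  have "generic ({1..n'} \<times> U) (\<lambda>x. case_prod (rows_of n' \<alpha>') (map_prod id \<theta> x))"
  proof (rule generic_reindex[OF generic_rows_of[OF assms(5)]])
    show "inj_on (map_prod id \<theta>) ({1..n'} \<times> U)" by (intro map_prod_inj_on inj\<theta>) simp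
    show "map_prod id \<theta> ` ({1..n'} \<times> U) \<subseteq> {1..n'} \<times> {1..n'}" using \<theta>U assms(7) by auto
  qed
  then have gen_g: "generic ({1..n'} \<times> U) (case_prod ?g)"
    by (rule generic_cong) auto
  have "shifting_wrt n \<alpha> ?H1 = shifted_faces n ?f ?H1"
    by (intro shifting_wrt_eq abstract_complex_relabel H)
  also have "\<dots> = shifted_faces (card U) ?f ?H1"
    by (rule shifted_faces_restrict_rows[OF generic_frame[OF gen_f U(1) cn] cn U(2)])
  also have "\<dots> = shifted_faces (card U) ?g ?H1"
    by (rule shifted_faces_generic[OF generic_mono[OF gen_f] generic_mono[OF gen_g] U(2)]) (use cn cn' in auto)
  also have "\<dots> = shifted_faces n' ?g ?H1"
    by (rule shifted_faces_restrict_rows[OF generic_frame[OF gen_g U(1) cn'] cn' U(2), symmetric])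
  also have "\<dots> = shifted_faces n' (rows_of n' \<alpha>') (relabel \<theta> ?H1)"
    by (rule shifted_faces_relabel[OF inj\<theta> U(1,2), symmetric])
  also have "\<dots> = shifting_wrt n' \<alpha>' (relabel \<psi> H)"
    unfolding rel by (intro shifting_wrt_eq [symmetric] abstract_complex_relabel H)
  finally show ?thesis .
qed

lemma \<Delta>_eq_shifting_wrt:
  assumes H: "abstract_complex H" and "generic_matrix n \<alpha>" "inj_on \<phi> (vertices H)" "\<phi> ` vertices H \<subseteq> {1..n}"
  shows "\<Delta> H = shifting_wrt n \<alpha> (relabel \<phi> H)"
  unfolding \<Delta>_def
proof (rule the_equality)
  show "is_shifting H (shifting_wrt n \<alpha> (relabel \<phi> H))"
    unfolding is_shifting_def using assms by blast
next
  fix D assume "is_shifting H D"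
  then show "D = shifting_wrt n \<alpha> (relabel \<phi> H)"
    unfolding is_shifting_def using shifting_wrt_relabel_eq[OF H _ _ _ assms(2-4)] by blast
qed

lemma \<Delta>_eq_shifted_faces:
  assumes H: "abstract_complex H" and "generic_matrix n \<alpha>" "vertices H \<subseteq> {1..n}"
  shows "\<Delta> H = shifted_faces n (rows_of n \<alpha>) H"
proof -
  have "\<Delta> H = shifting_wrt n \<alpha> (relabel id H)"
    using assms(3) by (intro \<Delta>_eq_shifting_wrt[OF H assms(2)]) auto
  then show ?thesis by (simp only: relabel_id shifting_wrt_eq[OF H])
qed

lemma \<Delta>_relabel:
  assumes H: "abstract_complex H" and inj: "inj_on \<phi> (vertices H)"
  shows "\<Delta> (relabel \<phi> H) = \<Delta> H"
proof -
  let ?V = "vertices (relabel \<phi> H)"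
  have V: "?V = \<phi> ` vertices H" by (rule vertices_relabel[OF H])
  have fin: "finite ?V" by (rule finite_vertices[OF abstract_complex_relabel[OF H]])
  obtain h where h: "bij_betw h ?V {1..card ?V}" using ex_bij_betw_nat_finite_1[OF fin] bij_betw_inv by blast
  obtain \<alpha> where \<alpha>: "generic_matrix (card ?V) \<alpha>" using generic_matrix_exists by blast
  have injh: "inj_on h ?V" and imgh: "h ` ?V \<subseteq> {1..card ?V}" using h by (auto simp: bij_betw_def)
  have "\<Delta> (relabel \<phi> H) = shifting_wrt (card ?V) \<alpha> (relabel h (relabel \<phi> H))"
    by (rule \<Delta>_eq_shifting_wrt[OF abstract_complex_relabel[OF H] \<alpha> injh imgh])
  also have "\<dots> = \<Delta> H"
    unfolding relabel_relabel
  proof (rule \<Delta>_eq_shifting_wrt[OF H \<alpha>, symmetric])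
    show "inj_on (h \<circ> \<phi>) (vertices H)" using comp_inj_on[OF inj] injh V by metis
    show "(h \<circ> \<phi>) ` vertices H \<subseteq> {1..card ?V}" using imgh V by (metis image_comp)
  qed
  finally show ?thesis .
qed

section \<open>Complete complexes, unions and the gluing criterion\<close>

lemma abstract_complex_Pow: "finite \<sigma> \<Longrightarrow> abstract_complex (Pow \<sigma>)"
  by (auto simp: abstract_complex_def intro: finite_subset)

lemma vertices_Pow: "vertices (Pow \<sigma>) = \<sigma>"
  by (auto simp: vertices_def)

lemma \<Delta>_Pow_card:
  fixes \<sigma> :: "'a set" and \<tau> :: "'b set"
  assumes "finite \<sigma>" "finite \<tau>" "card \<sigma> = card \<tau>"
  shows "\<Delta> (Pow \<sigma>) = \<Delta> (Pow \<tau>)"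
proof -
  obtain h where h: "bij_betw h \<sigma> \<tau>" using assms finite_same_card_bij by blast
  have "relabel h (Pow \<sigma>) = Pow \<tau>"
    using h by (simp add: relabel_def image_Pow_surj bij_betw_def)
  then show ?thesis
    using \<Delta>_relabel[of "Pow \<sigma>" h] h assms by (simp add: abstract_complex_Pow vertices_Pow bij_betw_def)
qed

lemma finite_Int_Pow:
  assumes "abstract_complex K" "K \<inter> L = Pow \<sigma>"
  shows "finite \<sigma>"
proof -
  have "\<sigma> \<in> K" using assms(2) by blast
  then show ?thesis using assms(1) by (simp add: abstract_complex_def)
qed

lemma abstract_complex_Un:
  assumes "abstract_complex K" "abstract_complex L"
  shows "abstract_complex (K \<union> L)"
  unfolding abstract_complex_def
proof (intro conjI ballI allI impI)
  show "finite (K \<union> L)" "{} \<in> K \<union> L"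
    using assms by (simp_all add: abstract_complex_def)
  show "finite F" if "F \<in> K \<union> L" for F
    using assms that by (auto simp: abstract_complex_def)
  show "G \<in> K \<union> L" if "F \<in> K \<union> L" "G \<subseteq> F" for F G
    using assms that unfolding abstract_complex_def by (metis Un_iff)
qed

lemma vertices_Un: "vertices (K \<union> L) = vertices K \<union> vertices L"
  by (auto simp: vertices_def)

text \<open>The analogue of \<open>extensions\<close> without a matrix and without n, so that its
  size visibly depends on the shifted complex alone.\<close>

definition above :: "nat set set \<Rightarrow> nat set \<Rightarrow> nat set" where
  "above D S = {t. t \<ge> 1 \<and> (\<forall>s\<in>S. s < t) \<and> insert t S \<in> D}"

text \<open>Here \<open>m\<close> is the maximum of \<open>S\<close>, or \<open>0\<close> if \<open>S\<close> is empty. Besides the faces in the theorem this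
  covers singletons and an \<open>n\<close> exceeding the number of vertices, as needed to recover all of
  \<open>\<Delta> (K \<union> L)\<close>.\<close>

lemma insert_mem_\<Delta>_gluing_iff:
  fixes K L :: "nat set set"
  assumes K: "abstract_complex K" and L: "abstract_complex L" and KL: "K \<inter> L = Pow \<sigma>"
    and Vn: "vertices (K \<union> L) \<subseteq> {1..n}" and S: "S \<subseteq> {1..n}" and t: "t \<in> {1..n}" "\<forall>s\<in>S. s < t"
    and m: "m < t" "\<forall>s\<in>S. s \<le> m" "m = 0 \<or> m \<in> S"
  shows "insert t S \<in> \<Delta> (K \<union> L) \<longleftrightarrow>
    int t - int m \<le> int (card (above (\<Delta> K) S)) + int (card (above (\<Delta> L) S)) - int (card (above (\<Delta> (Pow \<sigma>)) S))"
proof -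
  obtain \<alpha> where \<alpha>: "generic_matrix n \<alpha>" using generic_matrix_exists by blast
  let ?f = "rows_of n \<alpha>"
  have fin\<sigma>: "finite \<sigma>" by (rule finite_Int_Pow[OF K KL])
  have AB: "vertices K \<inter> vertices L = \<sigma>"
  proof -
    have "v \<in> vertices K \<inter> vertices L \<longleftrightarrow> v \<in> \<sigma>" for v
      using KL by (auto simp: vertices_def)
    then show ?thesis by blast
  qed
  have sub: "vertices K \<subseteq> {1..n}" "vertices L \<subseteq> {1..n}" "\<sigma> \<subseteq> {1..n}"
    using Vn AB unfolding vertices_Un by auto
  have gen: "generic ({1..n} \<times> {1..n}) (case_prod ?f)" by (rule generic_rows_of[OF \<alpha>])
  have fr: "frame ?f U" if "U \<subseteq> {1..n}" for U
    using that card_mono[of "{1..n}" U]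
    by (intro generic_frame[OF generic_mono[OF gen]]) (auto intro: finite_subset)
  have \<Delta>: "\<Delta> K = shifted_faces n ?f K" "\<Delta> L = shifted_faces n ?f L"
    "\<Delta> (Pow \<sigma>) = shifted_faces n ?f (Pow \<sigma>)" "\<Delta> (K \<union> L) = shifted_faces n ?f (K \<union> L)"
    using K L sub Vn fin\<sigma>
    by (auto intro!: \<Delta>_eq_shifted_faces[OF _ \<alpha>] abstract_complex_Un abstract_complex_Pow simp: vertices_Pow)
  have above: "above (shifted_faces n ?f H) S = extensions n ?f H S" for H
    unfolding above_def extensions_def by (auto simp: shifted_faces_def)
  have rows: "?f i \<in> vecs n" for i by (auto simp: rows_of_def vecs_def)
  have "card (extensions n ?f (K \<union> L) S) + card (extensions n ?f (Pow \<sigma>) S) =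
      card (extensions n ?f K S) + card (extensions n ?f L S)"
    using card_mono[OF _ sub(3)] AB KL
    by (intro card_extensions_gluing[OF rows fr fr _ abstract_complex_subset_Pow_vertices[OF K]
          abstract_complex_subset_Pow_vertices[OF L] _ _ S] sub(3)) auto
  moreover have "insert t S \<in> \<Delta> (K \<union> L) \<longleftrightarrow> t - m \<le> card (extensions n ?f (K \<union> L) S)"
  proof -
    let ?D = "extensions n ?f (K \<union> L) S"
    have "t \<in> ?D \<longleftrightarrow> t - m \<le> card ?D"
    proof (rule mem_down_closed_iff)
      show "finite ?D" by (simp add: extensions_def)
      show "?D \<subseteq> {m<..}" using m(3) by (auto simp: extensions_def)
      show "x \<in> ?D" if "x' \<in> ?D" "m < x" "x < x'" for x x'
      proof (rule extensions_down_closed[OF gen _ S that(1)])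
        have "x' \<le> n" using that(1) by (simp add: extensions_def)
        then show "x \<in> {1..n}" using that by auto
        show "\<forall>s\<in>S. s < x" using m(2) that(2) by fastforce
        show "K \<union> L \<subseteq> Pow {1..n}"
          using abstract_complex_subset_Pow_vertices[OF abstract_complex_Un[OF K L]] Vn by blast
      qed (rule that(3))
    qed (rule m(1))
    then show ?thesis using t unfolding \<Delta> extensions_def by simp
  qed
  \<comment> \<open>By \<open>m < t\<close> the truncated difference of naturals agrees with the
    integer one.\<close>
  ultimately show ?thesis
    using m(1) unfolding \<Delta>(1-3) above by linarith
qed

text \<open>The sets counted by \<open>D_num\<close> arise from \<open>S\<close> by adding one
  larger element; mapping that element to the set is a bijection from \<open>above\<close>.\<close>

lemma D_num_eq:
  assumes T: "T \<subseteq> {1..n}" "T = insert t S" "\<forall>s\<in>S. s < t" and \<Delta>: "\<And>F. F \<in> \<Delta> H \<Longrightarrow> F \<subseteq> {1..n}"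
  shows "D_num n H T = card (above (\<Delta> H) S)"
proof -
  have finS: "finite S" and tS: "t \<notin> S" using T finite_subset by auto
  have sorted: "sorted_list_of_set (insert x S) = sorted_list_of_set S @ [x]" if "\<forall>s\<in>S. s < x" for x
    using that finS by (intro sorted_list_of_set_unique[THEN iffD1]) (auto simp: sorted_wrt_append)
  have init: "init (card S) (insert x S) = S" if "\<forall>s\<in>S. s < x" for x
    using sorted[OF that] finS by (simp add: init_def)
  have "init (card T - 1) T = S" using init[OF T(3)] T(2) finS tS by simp
  moreover have "I1 n S \<inter> \<Delta> H = (\<lambda>x. insert x S) ` above (\<Delta> H) S"
  proof (intro equalityI subsetI)
    fix F assume F: "F \<in> I1 n S \<inter> \<Delta> H"
    then have Fn: "F \<subseteq> {1..n}" and c: "card F = card S + 1" and i: "init (card S) F = S"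
      by (auto simp: I1_def)
    have finF: "finite F" using Fn finite_subset by blast
    let ?L = "sorted_list_of_set F"
    have len: "length ?L = card S + 1" using c by simp
    then have L: "?L = take (card S) ?L @ [?L ! card S]"
      by (metis Suc_eq_plus1 lessI order_refl take_Suc_conv_app_nth take_all)
    have "set (take (card S) ?L) = S" using i by (simp add: init_def)
    moreover have "set ?L = F" using finF by simp
    ultimately have F': "F = insert (?L ! card S) S"
      using arg_cong[OF L, of set] by simp
    have "sorted_wrt (<) (take (card S) ?L @ [?L ! card S])"
      using strict_sorted_list_of_set[of F] L by metis
    then have "\<forall>s\<in>S. s < ?L ! card S"
      using \<open>set (take (card S) ?L) = S\<close> by (auto simp: sorted_wrt_append)
    then have "?L ! card S \<in> above (\<Delta> H) S"
      using F F' Fn by (auto simp: above_def)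
    then show "F \<in> (\<lambda>x. insert x S) ` above (\<Delta> H) S" using F' by blast
  next
    fix F assume "F \<in> (\<lambda>x. insert x S) ` above (\<Delta> H) S"
    then obtain x where x: "F = insert x S" "\<forall>s\<in>S. s < x" "F \<in> \<Delta> H" by (auto simp: above_def)
    then have "x \<notin> S" by auto
    then show "F \<in> I1 n S \<inter> \<Delta> H"
      using x \<Delta>[OF x(3)] init[OF x(2)] finS by (simp add: I1_def)
  qed
  moreover have "inj_on (\<lambda>x. insert x S) (above (\<Delta> H) S)"
  proof (rule inj_onI)
    fix x y assume "x \<in> above (\<Delta> H) S" "y \<in> above (\<Delta> H) S" "insert x S = insert y S"
    then show "x = y" by (auto simp: above_def)
  qed
  ultimately show ?thesis by (simp add: D_num_def card_image)
qed

lemma \<Delta>_subset: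
  assumes "abstract_complex H" "vertices H \<subseteq> {1..n}" "F \<in> \<Delta> H"
  shows "F \<subseteq> {1..n}"
proof -
  obtain \<alpha> where "generic_matrix n \<alpha>" using generic_matrix_exists by blast
  then show ?thesis using \<Delta>_eq_shifted_faces[OF assms(1) _ assms(2)] assms(3) by (auto simp: shifted_faces_def)
qed

lemma mem_\<Delta>_gluing_iff:
  fixes K L :: "nat set set" and t :: "nat \<Rightarrow> nat"
  assumes K: "abstract_complex K" and L: "abstract_complex L" and KL: "K \<inter> L = Pow \<sigma>"
    and V: "vertices (K \<union> L) = {1..n}"
    and j: "j \<ge> 1" and t: "strict_mono_on {1..j + 1} t" and T: "T = t ` {1..j + 1}" "T \<subseteq> {1..n}"
  shows "T \<in> \<Delta> (K \<union> L) \<longleftrightarrow>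
    int (t (j + 1)) - int (t j) \<le> int (D_num n K T) + int (D_num n L T) - int (D_num n (Pow \<sigma>) T)"
proof -
  define S where "S = t ` {1..j}"
  have TS: "T = insert (t (j + 1)) S"
    unfolding T(1) S_def by (auto simp: atLeastAtMostSuc_conv)
  have mono: "t a < t b" if "a \<in> {1..j + 1}" "b \<in> {1..j + 1}" "a < b" for a b
    using strict_mono_onD[OF t that] .
  have lt: "\<forall>s\<in>S. s < t (j + 1)" unfolding S_def by (auto intro!: mono)
  have le: "\<forall>s\<in>S. s \<le> t j"
  proof
    fix s assume "s \<in> S"
    then obtain a where a: "s = t a" "a \<in> {1..j}" unfolding S_def by blast
    then show "s \<le> t j" using mono[of a j] by (cases "a = j") auto
  qed
  have "vertices K \<subseteq> {1..n}" "vertices L \<subseteq> {1..n}" using V unfolding vertices_Un by auto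
  moreover have "\<sigma> \<subseteq> vertices K" using KL by (auto simp: vertices_def)
  ultimately have sub: "vertices K \<subseteq> {1..n}" "vertices L \<subseteq> {1..n}" "vertices (Pow \<sigma>) \<subseteq> {1..n}"
    by (auto simp: vertices_Pow)
  have "abstract_complex (Pow \<sigma>)" by (rule abstract_complex_Pow[OF finite_Int_Pow[OF K KL]])
  have D: "D_num n H T = card (above (\<Delta> H) S)" if "H \<in> {K, L, Pow \<sigma>}" for H
  proof (rule D_num_eq[OF T(2) TS lt])
    show "F \<subseteq> {1..n}" if "F \<in> \<Delta> H" for F
      using \<open>H \<in> _\<close> K L sub \<open>abstract_complex (Pow \<sigma>)\<close> \<Delta>_subset[OF _ _ that, of n] by blast
  qed
  have "T \<in> \<Delta> (K \<union> L) \<longleftrightarrow> int (t (j + 1)) - int (t j) \<le>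
     int (card (above (\<Delta> K) S)) + int (card (above (\<Delta> L) S)) - int (card (above (\<Delta> (Pow \<sigma>)) S))"
    unfolding TS
  proof (rule insert_mem_\<Delta>_gluing_iff[OF K L KL _ _ _ lt _ le])
    show "vertices (K \<union> L) \<subseteq> {1..n}" using V by simp
    show "S \<subseteq> {1..n}" "t (j + 1) \<in> {1..n}" using T(2) unfolding TS by blast+
    show "t j < t (j + 1)" using j by (intro mono) auto
    show "t j = 0 \<or> t j \<in> S" using j by (auto simp: S_def)
  qed
  then show ?thesis using D by simp
qed

section \<open>The shifted complex of a gluing depends only on the parts\<close>

lemma empty_mem_\<Delta>:
  fixes H :: "nat set set"
  assumes "abstract_complex H" "vertices H \<subseteq> {1..n}"
  shows "{} \<in> \<Delta> H"
proof -
  obtain \<alpha> where \<alpha>: "generic_matrix n \<alpha>" using generic_matrix_exists by blast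
  have "{R. R \<subseteq> {1..n} \<and> lex_less R {}} = {}" by (auto simp: lex_less_def dest: finite_subset)
  then have empty: "{minor (rows_of n \<alpha>) R | R. R \<subseteq> {1..n} \<and> lex_less R {}} = {}" by blast
  have "{} \<in> H" using assms(1) by (simp add: abstract_complex_def)
  then have "minor (rows_of n \<alpha>) {} \<notin> span_on H {minor (rows_of n \<alpha>) R | R. R \<subseteq> {1..n} \<and> lex_less R {}}"
    unfolding empty by (auto simp: span_on_def minor_empty zero_fun_apply intro!: bexI[of _ "{}"])
  then show ?thesis
    unfolding \<Delta>_eq_shifted_faces[OF assms(1) \<alpha> assms(2)] shifted_faces_def by blast
qed

text \<open>Brings gluings on arbitrary vertex types into the numbered setting by enumerating the
  vertices of \<open>M\<close>. The enumeration is injective on faces, so it carries the common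
  simplex to the intersection of the images, and \<open>\<Delta>\<close> is unchanged by injective
  relabelling.\<close>

lemma gluing_labelled:
  fixes K :: "'a set set" and L :: "'b set set" and M :: "'c set set"
  assumes K: "abstract_complex K" and L: "abstract_complex L" and M: "is_gluing d K L M"
  shows "\<exists>(K1 :: nat set set) L1 \<sigma> m. abstract_complex K1 \<and> abstract_complex L1 \<and> K1 \<inter> L1 = Pow \<sigma> \<and>
    int (card \<sigma>) = d + 1 \<and> vertices (K1 \<union> L1) \<subseteq> {1..m} \<and>
    \<Delta> K1 = \<Delta> K \<and> \<Delta> L1 = \<Delta> L \<and> \<Delta> (K1 \<union> L1) = \<Delta> M"
proof -
  obtain \<phi> \<psi> \<tau> where inj: "inj_on \<phi> (vertices K)" "inj_on \<psi> (vertices L)"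
    and MU: "M = relabel \<phi> K \<union> relabel \<psi> L" and I: "relabel \<phi> K \<inter> relabel \<psi> L = Pow \<tau>"
    and c: "int (card \<tau>) = d + 1"
    using M unfolding is_gluing_def by blast
  have cM: "abstract_complex M" unfolding MU by (intro abstract_complex_Un abstract_complex_relabel K L)
  have finV: "finite (vertices M)" by (rule finite_vertices[OF cM])
  obtain h where h: "bij_betw h (vertices M) {1..card (vertices M)}"
    using ex_bij_betw_nat_finite_1[OF finV] bij_betw_inv by blast
  then have injh: "inj_on h (vertices M)" and imgh: "h ` vertices M = {1..card (vertices M)}"
    by (auto simp: bij_betw_def)
  let ?K1 = "relabel h (relabel \<phi> K)" and ?L1 = "relabel h (relabel \<psi> L)"
  have U: "?K1 \<union> ?L1 = relabel h M" by (simp add: MU relabel_def image_Un)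
  have "?K1 \<inter> ?L1 = relabel h (relabel \<phi> K \<inter> relabel \<psi> L)"
  proof -
    have "inj_on ((`) h) M"
      using inj_on_image_Pow[OF injh] abstract_complex_subset_Pow_vertices[OF cM] by (rule inj_on_subset)
    then show ?thesis
      unfolding relabel_def [of h] by (intro inj_on_image_Int [symmetric]) (auto simp: MU)
  qed
  also have "\<dots> = Pow (h ` \<tau>)" unfolding I by (simp add: relabel_def image_Pow_surj)
  finally have I1: "?K1 \<inter> ?L1 = Pow (h ` \<tau>)" .
  have "Pow \<tau> \<subseteq> M" using I MU by blast
  then have "\<tau> \<subseteq> vertices M" by (auto simp: vertices_def)
  then have "card (h ` \<tau>) = card \<tau>" by (rule card_image[OF inj_on_subset[OF injh]])
  moreover have "\<Delta> ?K1 = \<Delta> K"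
    using inj(1) injh unfolding MU vertices_Un
    by (simp add: \<Delta>_relabel abstract_complex_relabel K inj_on_Un)
  moreover have "\<Delta> ?L1 = \<Delta> L"
    using inj(2) injh unfolding MU vertices_Un
    by (simp add: \<Delta>_relabel abstract_complex_relabel L inj_on_Un)
  moreover have "\<Delta> (?K1 \<union> ?L1) = \<Delta> M" unfolding U by (rule \<Delta>_relabel[OF cM injh])
  moreover have "vertices (?K1 \<union> ?L1) \<subseteq> {1..card (vertices M)}"
    unfolding U vertices_relabel[OF cM] imgh by simp
  moreover have "abstract_complex ?K1" "abstract_complex ?L1"
    by (intro abstract_complex_relabel K L)+
  ultimately show ?thesis using I1 c by metis
qed

text \<open>Remove the maximum from a nonempty \<open>T\<close>. The criterion for \<open>T\<close>
  then refers only to the shifted complexes of the two parts and of the simplex, and the last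
  depends only on the number of its vertices. Both gluings are placed in the common range up to
  \<open>max m m'\<close>.\<close>

lemma \<Delta>_gluing_subset:
  fixes K L K' L' :: "nat set set"
  assumes K: "abstract_complex K" "abstract_complex L" "K \<inter> L = Pow \<sigma>" "vertices (K \<union> L) \<subseteq> {1..m}"
    and K': "abstract_complex K'" "abstract_complex L'" "K' \<inter> L' = Pow \<sigma>'" "vertices (K' \<union> L') \<subseteq> {1..m'}"
    and eq: "\<Delta> K = \<Delta> K'" "\<Delta> L = \<Delta> L'" "card \<sigma> = card \<sigma>'"
  shows "\<Delta> (K \<union> L) \<subseteq> \<Delta> (K' \<union> L')"
proof
  fix T assume T: "T \<in> \<Delta> (K \<union> L)"
  let ?n = "max m m'"
  have V: "vertices (K \<union> L) \<subseteq> {1..?n}" "vertices (K' \<union> L') \<subseteq> {1..?n}" using K(4) K'(4) by force+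
  have Tn: "T \<subseteq> {1..?n}" by (rule \<Delta>_subset[OF abstract_complex_Un[OF K(1,2)] V(1) T])
  have finT: "finite T" using Tn finite_subset by blast
  show "T \<in> \<Delta> (K' \<union> L')"
  proof (cases "T = {}")
    case True
    then show ?thesis using empty_mem_\<Delta>[OF abstract_complex_Un[OF K'(1,2)] V(2)] by simp
  next
    case False
    define t where "t = Max T"
    define S where "S = T - {t}"
    \<comment> \<open>For a singleton \<open>T\<close> the value 0 makes \<open>t - m\<close> count
      all positions from 1 to \<open>t\<close>.\<close>
    define m where "m = (if S = {} then 0 else Max S)"
    have tT: "t \<in> T" using finT False by (simp add: t_def)
    have finS: "finite S" using finT by (simp add: S_def)
    have TS: "T = insert t S" using tT by (auto simp: S_def)
    have lt: "\<forall>s\<in>S. s < t"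
      using finT Max_ge[OF finT] unfolding S_def t_def by (auto simp: order_less_le)
    have tn: "t \<in> {1..?n}" and Sn: "S \<subseteq> {1..?n}" using tT Tn by (auto simp: S_def)
    have m: "m < t" "\<forall>s\<in>S. s \<le> m" "m = 0 \<or> m \<in> S"
      using lt tn finS by (auto simp: m_def)
    have "\<Delta> (Pow \<sigma>) = \<Delta> (Pow \<sigma>')"
      by (rule \<Delta>_Pow_card[OF finite_Int_Pow[OF K(1,3)] finite_Int_Pow[OF K'(1,3)] eq(3)])
    then show ?thesis
      using T insert_mem_\<Delta>_gluing_iff[OF K(1-3) V(1) Sn tn lt m]
        insert_mem_\<Delta>_gluing_iff[OF K'(1-3) V(2) Sn tn lt m] eq
      unfolding TS by simp
  qed
qed

lemma \<Delta>_gluing_unique: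
  fixes K :: "'a set set" and L :: "'b set set" and M :: "'c set set"
    and K' :: "'d set set" and L' :: "'e set set" and M' :: "'f set set"
  assumes "abstract_complex K" "abstract_complex L" "is_gluing d K L M"
    and "abstract_complex K'" "abstract_complex L'" "is_gluing d K' L' M'"
    and "\<Delta> K = \<Delta> K'" "\<Delta> L = \<Delta> L'"
  shows "\<Delta> M = \<Delta> M'"
proof -
  obtain K1 L1 :: "nat set set" and \<sigma> m where 1: "abstract_complex K1" "abstract_complex L1" "K1 \<inter> L1 = Pow \<sigma>"
    "vertices (K1 \<union> L1) \<subseteq> {1..m}" "int (card \<sigma>) = d + 1" "\<Delta> K1 = \<Delta> K" "\<Delta> L1 = \<Delta> L" "\<Delta> (K1 \<union> L1) = \<Delta> M"
    using gluing_labelled[OF assms(1-3)] by metis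
  obtain K2 L2 :: "nat set set" and \<sigma>' m' where 2: "abstract_complex K2" "abstract_complex L2" "K2 \<inter> L2 = Pow \<sigma>'"
    "vertices (K2 \<union> L2) \<subseteq> {1..m'}" "int (card \<sigma>') = d + 1" "\<Delta> K2 = \<Delta> K'" "\<Delta> L2 = \<Delta> L'" "\<Delta> (K2 \<union> L2) = \<Delta> M'"
    using gluing_labelled[OF assms(4-6)] by metis
  have eq: "\<Delta> K1 = \<Delta> K2" "\<Delta> L1 = \<Delta> L2" "card \<sigma> = card \<sigma>'" using 1 2 assms(7,8) by simp_all
  have "\<Delta> (K1 \<union> L1) = \<Delta> (K2 \<union> L2)"
    by (intro equalityI \<Delta>_gluing_subset[OF 1(1-4) 2(1-4) eq] \<Delta>_gluing_subset[OF 2(1-4) 1(1-4) eq[symmetric]])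
  then show ?thesis using 1(8) 2(8) by simp
qed

theorem theorem4p6:
  shows
    "(\<forall>(K :: nat set set) (L :: nat set set) (\<sigma> :: nat set) (n :: nat) (j :: nat) (t :: nat \<Rightarrow> nat) (T :: nat set).
        abstract_complex K \<and> abstract_complex L \<and> K \<inter> L = Pow \<sigma> \<and>
        vertices (K \<union> L) = {1..n} \<and>
        j \<ge> 1 \<and> strict_mono_on {1..j + 1} t \<and> T = t ` {1..j + 1} \<and> T \<subseteq> {1..n} \<longrightarrow>
        (T \<in> \<Delta> (K \<union> L) \<longleftrightarrow>
           int (t (j + 1)) - int (t j) \<le> int (D_num n K T) + int (D_num n L T) - int (D_num n (Pow \<sigma>) T)))
     \<and>
     (\<forall>(d :: int) (K :: 'a set set) (L :: 'b set set) (M :: 'c set set)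
        (K' :: 'd set set) (L' :: 'e set set) (M' :: 'f set set).
        abstract_complex K \<and> abstract_complex L \<and> is_gluing d K L M \<and>
        abstract_complex K' \<and> abstract_complex L' \<and> is_gluing d K' L' M' \<and>
        \<Delta> K = \<Delta> K' \<and> \<Delta> L = \<Delta> L' \<longrightarrow>
        \<Delta> M = \<Delta> M')"
proof (intro conjI allI impI; elim conjE)
  fix K L :: "nat set set" and \<sigma> T :: "nat set" and n j :: nat and t :: "nat \<Rightarrow> nat"
  assume "abstract_complex K" "abstract_complex L" "K \<inter> L = Pow \<sigma>" "vertices (K \<union> L) = {1..n}"
    "1 \<le> j" "strict_mono_on {1..j + 1} t" "T = t ` {1..j + 1}" "T \<subseteq> {1..n}"
  then show "T \<in> \<Delta> (K \<union> L) \<longleftrightarrow>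
      int (t (j + 1)) - int (t j) \<le> int (D_num n K T) + int (D_num n L T) - int (D_num n (Pow \<sigma>) T)"
    by (rule mem_\<Delta>_gluing_iff)
next
  fix d and K :: "'a set set" and L :: "'b set set" and M :: "'c set set"
    and K' :: "'d set set" and L' :: "'e set set" and M' :: "'f set set"
  assume "abstract_complex K" "abstract_complex L" "is_gluing d K L M"
    "abstract_complex K'" "abstract_complex L'" "is_gluing d K' L' M'" "\<Delta> K = \<Delta> K'" "\<Delta> L = \<Delta> L'"
  then show "\<Delta> M = \<Delta> M'" by (rule \<Delta>_gluing_unique)
qed

end
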